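(* Let $\mathcal{P}: A_0,\dots,A_{n-1}$ be a weakly closed path polyomino and let $K$ be a field. Then the polyomino ideal $I_{\mathcal{P}}\subset S=K[x_a\mid a\in V(\mathcal{P})]$ is a Knutson ideal.
   Context: $\mathbb{N}$ is the set of nonnegative integers, and $(i,j)\le (k,l)$ in $\mathbb{N}^2$ means $i\le k$ and $j\le l$. For $a=(i,j)\le b=(k,l)$ put $[a,b]=\{m\in\mathbb{N}^2: a\le m\le b\}$; it is a proper interval if $i<k$ and $j<l$. The anti-diagonal vertices of a proper interval are $(i,l)$ and $(k,j)$. A cell is $C=[a,a+(1,1)]$; $V(C)$ is the set of its four vertices and its edges are the four pairs of adjacent vertices. For a finite collection of cells $\mathcal{P}$ in $(\mathbb{N}\setminus\{0\})^2$, $V(\mathcal{P})=\bigcup_{C\in\mathcal{P}}V(C)$. Weakly closed path: a finite non-empty collection of cells $\mathcal{P}$ is a weakly closed path (polyomino) if it is a sequence of cells $A_0,A_1,\dots,A_{n-1},A_n$ with $n\ge 6$ such that: (1) $A_0=A_n$; (2) $A_i\ne A_j$ for all $i\neq j$ with $i,j\in\{1,\dots,n\}$; (3) $A_0\cap A_{n-1}$ is a vertex; (4) $A_i\cap A_{i+1}$ is a common edge for all $i\in\{0,\dots,n-2\}$; (5) $V(A_i)\cap V(A_j)=\emptyset$ for all $i\in\{1,\dots,n\}$ and all $j\notin\{i-2,i-1,i,i+1,i+2\}$, where the indices are reduced modulo $n$. An inner interval of $\mathcal{P}$ is a proper interval $[a,b]$ with $a,b\in V(\mathcal{P})$ all of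 whose cells belong to $\mathcal{P}$. $I_{\mathcal{P}}$ is the ideal of $S=K[x_a\mid a\in V(\mathcal{P})]$ generated by all binomials $x_ax_b-x_cx_d$, where $[a,b]$ ranges over the inner intervals of $\mathcal{P}$ and $c,d$ are the anti-diagonal vertices of $[a,b]$. Knutson ideals: let $f\in S$ be such that $\operatorname{in}_<(f)$ is a square-free monomial for some monomial order $<$ on $S$. $\mathcal{C}_f$ is the smallest set of ideals of $S$ such that: (1) $(f)\in\mathcal{C}_f$; (2) if $I\in\mathcal{C}_f$ and $J$ is any ideal of $S$, then $I:J\in\mathcal{C}_f$; (3) if $I,J\in\mathcal{C}_f$, then $I+J\in\mathcal{C}_f$ and $I\cap J\in\mathcal{C}_f$. An ideal is a Knutson ideal if it lies in $\mathcal{C}_f$ for some such $f$. *)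

theory Defs
  imports "HOL-Library.Poly_Mapping" "HOL-Algebra.Ideal"
begin

section \<open>Polynomial rings\<close>

text \<open>
  A monomial is its exponent vector, a polynomial is its coefficient function, and the type of
  polynomials has variables indexed by all of \<open>'v\<close>. The ring \<open>K[x\<^sub>a | a \<in> V]\<close> is the subring of
  those polynomials that only use variables from \<open>V\<close>.
\<close>

type_synonym 'v monom = "'v \<Rightarrow>\<^sub>0 nat"
type_synonym ('v, 'k) mpoly = "'v monom \<Rightarrow>\<^sub>0 'k"

definition monoms :: "'v set \<Rightarrow> 'v monom set" where
  "monoms V = {m. Poly_Mapping.keys m \<subseteq> V}"

definition mpoly_ring :: "'v set \<Rightarrow> ('v, 'k::field) mpoly ring" where
  "mpoly_ring V =
     \<lparr>carrier = {p. Poly_Mapping.keys p \<subseteq> monoms V}, mult = (*), one = 1, zero = 0, add = (+)\<rparr>"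

definition var :: "'v \<Rightarrow> ('v, 'k::field) mpoly" where
  "var a = Poly_Mapping.single (Poly_Mapping.single a 1) 1"

lemma cring_mpoly_ring: "cring (mpoly_ring V :: ('v, 'k::field) mpoly ring)"
proof -
  have add: "Poly_Mapping.keys (p + q) \<subseteq> monoms V"
    if "Poly_Mapping.keys p \<subseteq> monoms V" "Poly_Mapping.keys q \<subseteq> monoms V"
    for p q :: "('v, 'k) mpoly"
    using that keys_add[of p q] by blast
  have mult: "Poly_Mapping.keys (p * q) \<subseteq> monoms V"
    if "Poly_Mapping.keys p \<subseteq> monoms V" "Poly_Mapping.keys q \<subseteq> monoms V"
    for p q :: "('v, 'k) mpoly"
  proof
    fix m assume "m \<in> Poly_Mapping.keys (p * q)"
    then obtain a b where "m = a + b" "a \<in> Poly_Mapping.keys p" "b \<in> Poly_Mapping.keys q"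
      using keys_mult[of p q] by blast
    then show "m \<in> monoms V"
      using that keys_add[of a b] unfolding monoms_def by blast
  qed
  show ?thesis
  proof (rule cringI)
    show "abelian_group (mpoly_ring V :: ('v, 'k) mpoly ring)"
    proof (rule abelian_groupI)
      fix p :: "('v, 'k) mpoly" assume "p \<in> carrier (mpoly_ring V)"
      then show "\<exists>q\<in>carrier (mpoly_ring V). q \<oplus>\<^bsub>mpoly_ring V\<^esub> p = \<zero>\<^bsub>mpoly_ring V\<^esub>"
        by (intro bexI[of _ "- p"]) (auto simp: mpoly_ring_def)
    qed (use add in \<open>auto simp: mpoly_ring_def add.assoc add.commute\<close>)
    show "Group.comm_monoid (mpoly_ring V :: ('v, 'k) mpoly ring)"
    proof (rule comm_monoidI)
      show "\<one>\<^bsub>mpoly_ring V\<^esub> \<in> carrier (mpoly_ring V :: ('v, 'k) mpoly ring)"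
        by (auto simp: mpoly_ring_def monoms_def)
    qed (use mult in \<open>auto simp: mpoly_ring_def mult.assoc mult.commute\<close>)
  qed (auto simp: mpoly_ring_def distrib_right)
qed

section \<open>Monomial orders and Knutson ideals\<close>

text \<open>\<open>(m, m') \<in> r\<close> stands for \<open>m \<le> m'\<close>; multiplying monomials is adding exponent vectors.\<close>

definition monomial_order :: "'v set \<Rightarrow> 'v monom rel \<Rightarrow> bool" where
  "monomial_order V r \<longleftrightarrow>
     linear_order_on (monoms V) r \<and>
     (\<forall>m\<in>monoms V. (0, m) \<in> r) \<and>
     (\<forall>m m'. \<forall>u\<in>monoms V. (m, m') \<in> r \<longrightarrow> (m + u, m' + u) \<in> r)"

text \<open>Meaningful for nonzero polynomials only.\<close>

definition initial_monom :: "'v monom rel \<Rightarrow> ('v, 'k::field) mpoly \<Rightarrow> 'v monom" where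
  "initial_monom r f =
     (THE m. m \<in> Poly_Mapping.keys f \<and> (\<forall>m'\<in>Poly_Mapping.keys f. (m', m) \<in> r))"

definition squarefree_monom :: "'v monom \<Rightarrow> bool" where
  "squarefree_monom m \<longleftrightarrow> (\<forall>a. Poly_Mapping.lookup m a \<le> 1)"

definition colon_ideal :: "('a, 'b) ring_scheme \<Rightarrow> 'a set \<Rightarrow> 'a set \<Rightarrow> 'a set" where
  "colon_ideal R I J = {s \<in> carrier R. \<forall>j\<in>J. s \<otimes>\<^bsub>R\<^esub> j \<in> I}"

inductive_set knutson_family :: "('a, 'b) ring_scheme \<Rightarrow> 'a \<Rightarrow> 'a set set"
  for R :: "('a, 'b) ring_scheme" and f :: 'a
where
  principal: "PIdl\<^bsub>R\<^esub> f \<in> knutson_family R f"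
| colon: "I \<in> knutson_family R f \<Longrightarrow> ideal J R \<Longrightarrow> colon_ideal R I J \<in> knutson_family R f"
| sum: "I \<in> knutson_family R f \<Longrightarrow> J \<in> knutson_family R f \<Longrightarrow>
    I <+>\<^bsub>R\<^esub> J \<in> knutson_family R f"
| inter: "I \<in> knutson_family R f \<Longrightarrow> J \<in> knutson_family R f \<Longrightarrow> I \<inter> J \<in> knutson_family R f"

definition knutson_ideal :: "'v set \<Rightarrow> ('v, 'k::field) mpoly set \<Rightarrow> bool" where
  "knutson_ideal V I \<longleftrightarrow>
     (\<exists>r f. monomial_order V r \<and> f \<in> carrier (mpoly_ring V) \<and> f \<noteq> 0 \<and>
        squarefree_monom (initial_monom r f) \<and> I \<in> knutson_family (mpoly_ring V) f)"

section \<open>Polyominoes\<close>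

type_synonym vertex = "nat \<times> nat"

definition interval :: "vertex \<Rightarrow> vertex \<Rightarrow> vertex set" where
  "interval a b = {fst a..fst b} \<times> {snd a..snd b}"

definition proper_interval :: "vertex \<Rightarrow> vertex \<Rightarrow> bool" where
  "proper_interval a b \<longleftrightarrow> fst a < fst b \<and> snd a < snd b"

text \<open>
  Since intervals consist of lattice points, a cell is the set of its four vertices,
  so that \<open>V(C) = C\<close>.
\<close>

definition cell :: "vertex \<Rightarrow> vertex set" where
  "cell a = interval a (fst a + 1, snd a + 1)"

definition cell_edges :: "vertex set \<Rightarrow> vertex set set" where
  "cell_edges C =
     {{(i, j), (i + 1, j)} | i j. (i, j) \<in> C \<and> (i + 1, j) \<in> C} \<union>
     {{(i, j), (i, j + 1)} | i j. (i, j) \<in> C \<and> (i, j + 1) \<in> C}"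

definition vertices :: "vertex set set \<Rightarrow> vertex set" where
  "vertices P = \<Union> P"

definition weakly_closed_path :: "nat \<Rightarrow> (nat \<Rightarrow> vertex set) \<Rightarrow> bool" where
  "weakly_closed_path n A \<longleftrightarrow>
     n \<ge> 6 \<and>
     (\<forall>i\<le>n. \<exists>a. fst a \<ge> 1 \<and> snd a \<ge> 1 \<and> A i = cell a) \<and>
     A 0 = A n \<and>
     (\<forall>i\<in>{1..n}. \<forall>j\<in>{1..n}. i \<noteq> j \<longrightarrow> A i \<noteq> A j) \<and>
     (\<exists>v. A 0 \<inter> A (n - 1) = {v}) \<and>
     (\<forall>i\<in>{0..n - 2}. A i \<inter> A (i + 1) \<in> cell_edges (A i) \<inter> cell_edges (A (i + 1))) \<and>
     (\<forall>i\<in>{1..n}. \<forall>j\<in>{1..n}.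
        (\<forall>d\<in>{-2..2}. int j mod int n \<noteq> (int i + d) mod int n) \<longrightarrow> A i \<inter> A j = {})"

definition inner_interval :: "vertex set set \<Rightarrow> vertex \<Rightarrow> vertex \<Rightarrow> bool" where
  "inner_interval P a b \<longleftrightarrow>
     proper_interval a b \<and> a \<in> vertices P \<and> b \<in> vertices P \<and>
     (\<forall>c. cell c \<subseteq> interval a b \<longrightarrow> cell c \<in> P)"

definition polyomino_ideal :: "vertex set set \<Rightarrow> (vertex, 'k::field) mpoly set" where
  "polyomino_ideal P =
     Idl\<^bsub>mpoly_ring (vertices P)\<^esub>
       {var a * var b - var (fst a, snd b) * var (fst b, snd a) | a b. inner_interval P a b}"

end

theory Submission
  imports Defs "HOL-Library.Product_Lexorder"
begin

text \<open>Every binomial of an inner interval is a 2-minor. The polynomial \<open>f\<close> is a product of 2-minors,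
  roughly one for each cell: walking along the path, every cell contributes one new vertex, whose
  variable is multiplied in the initial monomial by the variable of a vertex left over from the
  previous cell. For a suitable lexicographic order these initial monomials are pairwise coprime, so
  that the initial monomial of \<open>f\<close> is square-free, and every chosen minor generates an ideal of the
  Knutson family of \<open>f\<close>. The ideal of all minors of a straight run of cells, together with the cells
  branching off from it, is a ladder determinantal ideal and therefore saturated with respect to the
  variables. Up to a monomial factor its generators lie in the sum of the ideals of chosen minors, so
  it is obtained from this sum by a colon ideal and belongs to the family. Every inner interval lies
  in such a run, hence the polyomino ideal is a sum of members of the family.\<close>

section \<open>Ideals of polynomial rings and Knutson families\<close>

text \<open>The vertices leave almost no slack: an open path of n cells has 2n + 1 vertices, of
  which n minors with coprime initial monomials use 2n, and a cycle of N cells with one further cell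
  has 2N + 2 vertices, all used by its N + 1 minors. So the vertex left over by a cell has to be
  spent on its successor, and after a turn it may lie outside this successor. The chosen minor then
  belongs to the rectangle formed by both cells, and the minor of the successor has to be recovered
  by comparing rows: if rows x, y and rows x, z are proportional on two columns, so are y and z, but
  only after cancelling a variable. Hence the saturations, and hence ladders with up to two short
  rows, one for a preceding turn and one for a cell branching off. The other obstacle is the closing
  of the path. If one end cell also meets the neighbour of the other end, all cells but one form a
  cycle, and the sequence of left over vertices has to return to itself. A turn makes its
  continuation independent of its past, so the cycle is cut at a turn.\<close>

abbreviation polys :: "'v set \<Rightarrow> ('v, 'k::field) mpoly set" where
  "polys V \<equiv> carrier (mpoly_ring V)"

abbreviation term_poly :: "'v monom \<Rightarrow> ('v, 'k::field) mpoly" where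
  "term_poly m \<equiv> Poly_Mapping.single m 1"

lemma mpoly_ring_simps [simp]:
  "mult (mpoly_ring V) = (*)" "one (mpoly_ring V) = 1" "zero (mpoly_ring V) = 0"
  "add (mpoly_ring V) = (+)"
  by (simp_all add: mpoly_ring_def)

lemma polys_iff: "p \<in> polys V \<longleftrightarrow> Poly_Mapping.keys p \<subseteq> monoms V"
  by (simp add: mpoly_ring_def)

lemma monoms_zero [simp]: "0 \<in> monoms V"
  by (simp add: monoms_def)

lemma monoms_add [intro]: "a \<in> monoms V \<Longrightarrow> b \<in> monoms V \<Longrightarrow> a + b \<in> monoms V"
  using keys_add[of a b] by (auto simp: monoms_def)

lemma monoms_single [intro]: "x \<in> V \<Longrightarrow> Poly_Mapping.single x e \<in> monoms V"
  by (simp add: monoms_def)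

lemma polys_add [intro]: "p \<in> polys V \<Longrightarrow> q \<in> polys V \<Longrightarrow> p + q \<in> polys V"
  unfolding polys_iff using keys_add[of p q] by blast

lemma polys_mult [intro]: "p \<in> polys V \<Longrightarrow> q \<in> polys V \<Longrightarrow> p * q \<in> polys V"
  using cring.cring_simprules(5)[OF cring_mpoly_ring, of p V q] by simp

lemma polys_single [intro]: "m \<in> monoms V \<Longrightarrow> Poly_Mapping.single m c \<in> polys V"
  by (simp add: polys_iff)

lemma polys_zero [simp, intro]: "0 \<in> polys V"
  by (simp add: polys_iff)

lemma polys_one [simp, intro]: "1 \<in> polys V"
  by (simp add: polys_iff)

lemma polys_uminus [intro]: "p \<in> polys V \<Longrightarrow> - p \<in> polys V"
  by (simp add: polys_iff keys_def)

lemma polys_diff [intro]: "p \<in> polys V \<Longrightarrow> q \<in> polys V \<Longrightarrow> p - q \<in> polys V"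
  using polys_add[of p V "- q"] polys_uminus[of q V] by simp

lemma polys_var [intro]: "x \<in> V \<Longrightarrow> var x \<in> polys V"
  unfolding var_def by (intro polys_single monoms_single)

lemma polys_prod [intro]: "(\<And>i. i \<in> I \<Longrightarrow> g i \<in> polys V) \<Longrightarrow> prod g I \<in> polys V"
  by (induction I rule: infinite_finite_induct) auto

lemma ideal_mpoly_ringD:
  assumes "ideal I (mpoly_ring V)"
  shows "I \<subseteq> polys V" "0 \<in> I" "p \<in> I \<Longrightarrow> q \<in> I \<Longrightarrow> p + q \<in> I"
    "p \<in> I \<Longrightarrow> q \<in> polys V \<Longrightarrow> q * p \<in> I" "p \<in> I \<Longrightarrow> - p \<in> I"
    "p \<in> I \<Longrightarrow> q \<in> I \<Longrightarrow> p - q \<in> I"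
proof -
  interpret ideal I "mpoly_ring V" by fact
  show I: "I \<subseteq> polys V" "0 \<in> I" "p \<in> I \<Longrightarrow> q \<in> I \<Longrightarrow> p + q \<in> I" for p q
    using a_subset additive_subgroup.zero_closed[OF is_additive_subgroup] a_closed[of p q]
      additive_subgroup.a_closed[OF is_additive_subgroup, of p q] by simp_all
  show m: "p \<in> I \<Longrightarrow> q \<in> polys V \<Longrightarrow> q * p \<in> I" for p q
    using I_l_closed by auto
  show u: "p \<in> I \<Longrightarrow> - p \<in> I" for p
    using m[of p "- 1"] by auto
  show "p \<in> I \<Longrightarrow> q \<in> I \<Longrightarrow> p - q \<in> I"
    using I(3)[of p "- q"] u by auto
qed

lemma ideal_mpoly_ringI:
  assumes "I \<subseteq> polys V" "0 \<in> I" "\<And>p q. p \<in> I \<Longrightarrow> q \<in> I \<Longrightarrow> p + q \<in> I"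
    "\<And>p q. p \<in> I \<Longrightarrow> q \<in> polys V \<Longrightarrow> q * p \<in> I"
  shows "ideal I (mpoly_ring V)"
proof -
  interpret cring "mpoly_ring V" by (rule cring_mpoly_ring)
  show ?thesis
  proof (rule idealI[OF ring_axioms])
    show "subgroup I (add_monoid (mpoly_ring V))"
    proof (rule add.subgroupI)
      fix a assume a: "a \<in> I"
      have "\<ominus>\<^bsub>mpoly_ring V\<^esub> a = - a"
        using a assms(1) by (intro minus_equality) auto
      moreover have "- a \<in> I"
        using assms(4)[OF a, of "- 1"] by auto
      ultimately show "\<ominus>\<^bsub>mpoly_ring V\<^esub> a \<in> I" by simp
    qed (use assms in auto)
  qed (use assms(4) in \<open>auto simp: mult.commute\<close>)
qed

lemma Idl_mpoly_ring:
  assumes "G \<subseteq> polys V"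
  shows "ideal (Idl\<^bsub>mpoly_ring V\<^esub> G) (mpoly_ring V)" "G \<subseteq> Idl\<^bsub>mpoly_ring V\<^esub> G"
    "ideal K (mpoly_ring V) \<Longrightarrow> G \<subseteq> K \<Longrightarrow> Idl\<^bsub>mpoly_ring V\<^esub> G \<subseteq> K"
proof -
  interpret cring "mpoly_ring V" by (rule cring_mpoly_ring)
  show "ideal (Idl\<^bsub>mpoly_ring V\<^esub> G) (mpoly_ring V)" "G \<subseteq> Idl\<^bsub>mpoly_ring V\<^esub> G"
    "ideal K (mpoly_ring V) \<Longrightarrow> G \<subseteq> K \<Longrightarrow> Idl\<^bsub>mpoly_ring V\<^esub> G \<subseteq> K"
    using genideal_ideal[OF assms] genideal_self[OF assms] genideal_minimal[of K G] by simp_all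
qed

lemma PIdl_mpoly_ring: "PIdl\<^bsub>mpoly_ring V\<^esub> f = {x * f | x. x \<in> polys V}"
  by (simp add: cgenideal_def)

lemma ideal_PIdl: "f \<in> polys V \<Longrightarrow> ideal (PIdl\<^bsub>mpoly_ring V\<^esub> f) (mpoly_ring V)"
  using cring.cgenideal_ideal[OF cring_mpoly_ring] .

lemma PIdl_self: "f \<in> polys V \<Longrightarrow> f \<in> PIdl\<^bsub>mpoly_ring V\<^esub> f"
  unfolding PIdl_mpoly_ring by (auto intro!: exI[of _ 1])

lemma PIdl_subset: "ideal I (mpoly_ring V) \<Longrightarrow> f \<in> I \<Longrightarrow> PIdl\<^bsub>mpoly_ring V\<^esub> f \<subseteq> I"
  unfolding PIdl_mpoly_ring using ideal_mpoly_ringD(4)[of I V f] by auto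

lemma sum_ideals_mpoly_ring:
  assumes "ideal I (mpoly_ring V)" "ideal J (mpoly_ring V)"
  shows "ideal (I <+>\<^bsub>mpoly_ring V\<^esub> J) (mpoly_ring V)"
    "I \<subseteq> I <+>\<^bsub>mpoly_ring V\<^esub> J" "J \<subseteq> I <+>\<^bsub>mpoly_ring V\<^esub> J"
    "ideal K (mpoly_ring V) \<Longrightarrow> I \<subseteq> K \<Longrightarrow> J \<subseteq> K \<Longrightarrow> I <+>\<^bsub>mpoly_ring V\<^esub> J \<subseteq> K"
proof -
  interpret cring "mpoly_ring V" by (rule cring_mpoly_ring)
  have eq: "I <+>\<^bsub>mpoly_ring V\<^esub> J = {p + q | p q. p \<in> I \<and> q \<in> J}"
    by (auto simp: set_add_def set_mult_def)
  show "ideal (I <+>\<^bsub>mpoly_ring V\<^esub> J) (mpoly_ring V)"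
    using add_ideals assms by blast
  show "I \<subseteq> I <+>\<^bsub>mpoly_ring V\<^esub> J" "J \<subseteq> I <+>\<^bsub>mpoly_ring V\<^esub> J"
    unfolding eq using ideal_mpoly_ringD(2)[OF assms(1)] ideal_mpoly_ringD(2)[OF assms(2)]
    by force+
  show "ideal K (mpoly_ring V) \<Longrightarrow> I \<subseteq> K \<Longrightarrow> J \<subseteq> K \<Longrightarrow> I <+>\<^bsub>mpoly_ring V\<^esub> J \<subseteq> K"
    unfolding eq using ideal_mpoly_ringD(3)[of K V] by blast
qed

lemma colon_PIdl:
  assumes "ideal I (mpoly_ring V)" "g \<in> polys V"
  shows "colon_ideal (mpoly_ring V) I (PIdl\<^bsub>mpoly_ring V\<^esub> g) = {s \<in> polys V. s * g \<in> I}"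
proof -
  have "s * (x * g) \<in> I" if "s * g \<in> I" "x \<in> polys V" for s x
    using ideal_mpoly_ringD(4)[OF assms(1) that] by (simp add: mult_ac)
  moreover have "g \<in> PIdl\<^bsub>mpoly_ring V\<^esub> g"
    using PIdl_self[OF assms(2)] .
  ultimately show ?thesis
    unfolding colon_ideal_def by (auto simp: PIdl_mpoly_ring)
qed

lemma knutson_family_ideal:
  assumes "I \<in> knutson_family (mpoly_ring V) f" "f \<in> polys V"
  shows "ideal I (mpoly_ring V)"
  using assms(1)
proof induction
  case principal
  then show ?case using ideal_PIdl[OF assms(2)] .
next
  case (colon I J)
  show ?case
    using ideal_mpoly_ringD[OF colon.IH] ideal_mpoly_ringD(1)[OF colon.hyps(2)]
    unfolding colon_ideal_def
    by (intro ideal_mpoly_ringI) (auto simp: distrib_right mult.assoc)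
next
  case (sum I J)
  then show ?case using sum_ideals_mpoly_ring(1) by blast
next
  case (inter I J)
  interpret cring "mpoly_ring V" by (rule cring_mpoly_ring)
  show ?case using i_intersect inter.IH by blast
qed

text \<open>A linear order on the variables makes the polynomials an integral domain, so
  \<open>h\<close> cancels and the colon of (f) by (h) is (g).\<close>

lemma knutson_family_PIdl_factor:
  fixes g h :: "('v::linorder, 'k::field) mpoly"
  assumes "g \<in> polys V" "h \<in> polys V" "h \<noteq> 0" "f = g * h"
  shows "PIdl\<^bsub>mpoly_ring V\<^esub> g \<in> knutson_family (mpoly_ring V) f"
proof -
  have f: "f \<in> polys V" using assms by auto
  have "colon_ideal (mpoly_ring V) (PIdl\<^bsub>mpoly_ring V\<^esub> f) (PIdl\<^bsub>mpoly_ring V\<^esub> h)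
      = {s \<in> polys V. s * h \<in> PIdl\<^bsub>mpoly_ring V\<^esub> f}"
    using colon_PIdl[OF ideal_PIdl[OF f] assms(2)] .
  also have "\<dots> = PIdl\<^bsub>mpoly_ring V\<^esub> g"
  proof (intro equalityI subsetI)
    fix s :: "('v, 'k) mpoly" assume "s \<in> {s \<in> polys V. s * h \<in> PIdl\<^bsub>mpoly_ring V\<^esub> f}"
    then obtain x where "x \<in> polys V" "s * h = (x * g) * h"
      by (auto simp: PIdl_mpoly_ring assms(4) mult.assoc)
    then show "s \<in> PIdl\<^bsub>mpoly_ring V\<^esub> g"
      using assms(3) by (auto simp: PIdl_mpoly_ring)
  qed (use assms in \<open>auto simp: PIdl_mpoly_ring mult.assoc\<close>)
  finally show ?thesis
    using knutson_family.colon[OF knutson_family.principal ideal_PIdl[OF assms(2)], of f] by simp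
qed

text \<open>The members that catch the single elements are added up; the bound by \<open>I\<close>
  survives because \<open>I\<close> is an ideal.\<close>

lemma knutson_family_finite_cover:
  fixes f :: "('v, 'k::field) mpoly"
  assumes f: "f \<in> polys V" and I: "ideal I (mpoly_ring V)" and "finite G" "G \<noteq> {}"
    and G: "\<And>g. g \<in> G \<Longrightarrow> \<exists>K \<in> knutson_family (mpoly_ring V) f. g \<in> K \<and> K \<subseteq> I"
  shows "\<exists>K \<in> knutson_family (mpoly_ring V) f. G \<subseteq> K \<and> K \<subseteq> I"
  using \<open>finite G\<close> \<open>G \<noteq> {}\<close> G
proof (induction G rule: finite_ne_induct)
  case (singleton g)
  then show ?case by blast
next
  case (insert g G)
  obtain K1 where K1: "K1 \<in> knutson_family (mpoly_ring V) f" "G \<subseteq> K1" "K1 \<subseteq> I"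
    using insert by blast
  obtain K2 where K2: "K2 \<in> knutson_family (mpoly_ring V) f" "g \<in> K2" "K2 \<subseteq> I"
    using insert.prems[of g] by blast
  note S = sum_ideals_mpoly_ring[OF knutson_family_ideal[OF K1(1) f] knutson_family_ideal[OF K2(1) f]]
  show ?case
  proof (intro bexI conjI)
    show "K1 <+>\<^bsub>mpoly_ring V\<^esub> K2 \<in> knutson_family (mpoly_ring V) f"
      using knutson_family.sum[OF K1(1) K2(1)] .
    show "K1 <+>\<^bsub>mpoly_ring V\<^esub> K2 \<subseteq> I"
      using S(4)[OF I K1(3) K2(3)] .
    show "insert g G \<subseteq> K1 <+>\<^bsub>mpoly_ring V\<^esub> K2"
      using S(2,3) K1(2) K2(2) by (meson insert_subset subset_trans subsetD)
  qed
qed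

lemma knutson_family_Idl:
  fixes f :: "('v, 'k::field) mpoly"
  assumes f: "f \<in> polys V" and "finite G" "G \<noteq> {}" "G \<subseteq> polys V"
    and G: "\<And>g. g \<in> G \<Longrightarrow>
      \<exists>K \<in> knutson_family (mpoly_ring V) f. g \<in> K \<and> K \<subseteq> Idl\<^bsub>mpoly_ring V\<^esub> G"
  shows "Idl\<^bsub>mpoly_ring V\<^esub> G \<in> knutson_family (mpoly_ring V) f"
proof -
  note I = Idl_mpoly_ring[OF \<open>G \<subseteq> polys V\<close>]
  obtain K where K: "K \<in> knutson_family (mpoly_ring V) f" "G \<subseteq> K" "K \<subseteq> Idl\<^bsub>mpoly_ring V\<^esub> G"
    using knutson_family_finite_cover[OF f I(1) \<open>finite G\<close> \<open>G \<noteq> {}\<close> G] by blast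
  then have "Idl\<^bsub>mpoly_ring V\<^esub> G = K"
    using I(3)[OF knutson_family_ideal[OF K(1) f]] by blast
  then show ?thesis using K(1) by simp
qed

section \<open>Saturation by monomials\<close>

text \<open>The saturation of \<open>K\<close> by the variables in \<open>V\<close>, phrased with
  one monomial multiplier instead of an ascending union of colon ideals.\<close>

definition sat :: "'v set \<Rightarrow> ('v, 'k::field) mpoly set \<Rightarrow> ('v, 'k) mpoly set" where
  "sat V K = {p \<in> polys V. \<exists>m \<in> monoms V. term_poly m * p \<in> K}"

lemma term_poly_add: "term_poly (m + m') = (term_poly m * term_poly m' :: ('v, 'k::field) mpoly)"
  by (simp add: mult_single)

lemma sat_superset: "ideal K (mpoly_ring V) \<Longrightarrow> K \<subseteq> sat V K"
  using ideal_mpoly_ringD(1)[of K V] unfolding sat_def by (auto intro!: bexI[of _ 0])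

lemma ideal_sat:
  assumes K: "ideal K (mpoly_ring V)"
  shows "ideal (sat V K) (mpoly_ring V)"
proof (rule ideal_mpoly_ringI)
  note D = ideal_mpoly_ringD[OF K]
  show "0 \<in> sat V K"
    using sat_superset[OF K] D(2) by blast
  show "p + q \<in> sat V K" if pq: "p \<in> sat V K" "q \<in> sat V K" for p q
  proof -
    obtain m m' where m: "m \<in> monoms V" "term_poly m * p \<in> K" "m' \<in> monoms V" "term_poly m' * q \<in> K"
      using pq by (auto simp: sat_def)
    have "term_poly (m + m') * (p + q) =
        term_poly m' * (term_poly m * p) + term_poly m * (term_poly m' * q)"
      by (simp add: term_poly_add algebra_simps)
    also have "\<dots> \<in> K"
      by (rule D(3)[OF D(4)[OF m(2) polys_single[OF m(3)]] D(4)[OF m(4) polys_single[OF m(1)]]])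
    finally show ?thesis
      using pq monoms_add[OF m(1,3)] unfolding sat_def
      by (intro CollectI conjI bexI[of _ "m + m'"] polys_add) simp_all
  qed
  show "q * p \<in> sat V K" if pq: "p \<in> sat V K" "q \<in> polys V" for p q
  proof -
    obtain m where m: "m \<in> monoms V" "term_poly m * p \<in> K"
      using pq by (auto simp: sat_def)
    have "term_poly m * (q * p) \<in> K"
      using D(4)[OF m(2) pq(2)] by (simp add: mult_ac)
    then show ?thesis
      using pq m(1) unfolding sat_def by (intro CollectI conjI bexI polys_mult) simp_all
  qed
qed (auto simp: sat_def)

lemma sat_cancel_var:
  assumes "x \<in> V" "p \<in> polys V" "var x * p \<in> sat V K"
  shows "p \<in> sat V K"
proof -
  obtain m where m: "m \<in> monoms V" "term_poly m * (var x * p) \<in> K"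
    using assms by (auto simp: sat_def)
  have "term_poly (m + Poly_Mapping.single x 1) * p = term_poly m * (var x * p)"
    by (simp only: var_def mult.assoc term_poly_add)
  moreover have "m + Poly_Mapping.single x 1 \<in> monoms V"
    using m(1) assms(1) by (intro monoms_add monoms_single)
  ultimately show ?thesis
    using m(2) assms(2) unfolding sat_def by (intro CollectI conjI bexI) simp_all
qed

text \<open>The three pairs are columns of a matrix with two rows. The syzygy b (a c' - c a') = a (b
  c' - c b') + c (a b' - b a') yields the third minor up to the factor b, which the saturation
  cancels. Proportionality of columns is thus transitive.\<close>

lemma sat_minor_trans:
  assumes K: "ideal K (mpoly_ring V)" and V: "a \<in> V" "a' \<in> V" "b \<in> V" "b' \<in> V" "c \<in> V" "c' \<in> V"
    and 1: "var a * var b' - var b * var a' \<in> sat V K"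
    and 2: "var b * var c' - var c * var b' \<in> sat V K"
  shows "var a * var c' - var c * var a' \<in> sat V K"
proof (rule sat_cancel_var[OF \<open>b \<in> V\<close>])
  note D = ideal_mpoly_ringD[OF ideal_sat[OF K]]
  have "var b * (var a * var c' - var c * var a') =
    var a * (var b * var c' - var c * var b') + var c * (var a * var b' - var b * var a')"
    by (simp add: algebra_simps)
  also have "\<dots> \<in> sat V K"
    by (rule D(3)[OF D(4)[OF 2 polys_var[OF V(1)]] D(4)[OF 1 polys_var[OF V(5)]]])
  finally show "var b * (var a * var c' - var c * var a') \<in> sat V K" .
qed (use V in auto)

text \<open>A common monomial multiplier for finitely many generators turns the saturation into a
  single colon ideal.\<close>

lemma knutson_family_saturated:
  fixes f :: "('v, 'k::field) mpoly"
  assumes f: "f \<in> polys V" and K: "K \<in> knutson_family (mpoly_ring V) f"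
    and G: "finite G" "G \<subseteq> sat V K" and KG: "K \<subseteq> Idl\<^bsub>mpoly_ring V\<^esub> G"
    and satI: "sat V (Idl\<^bsub>mpoly_ring V\<^esub> G) \<subseteq> Idl\<^bsub>mpoly_ring V\<^esub> G"
  shows "Idl\<^bsub>mpoly_ring V\<^esub> G \<in> knutson_family (mpoly_ring V) f"
proof -
  have Gp: "G \<subseteq> polys V" using G(2) by (auto simp: sat_def)
  have KI: "ideal K (mpoly_ring V)" using knutson_family_ideal[OF K f] .
  note D = ideal_mpoly_ringD[OF KI]
  have "\<exists>m \<in> monoms V. \<forall>g \<in> G. term_poly m * g \<in> K"
    using G
  proof (induction G rule: finite_induct)
    case (insert g G)
    obtain m m' where m: "m \<in> monoms V" "\<forall>g \<in> G. term_poly m * g \<in> K" "m' \<in> monoms V"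
      "term_poly m' * g \<in> K"
      using insert by (auto simp: sat_def)
    have "term_poly (m + m') * h \<in> K" if "h \<in> insert g G" for h
    proof -
      have "term_poly (m + m') * h = term_poly m * (term_poly m' * h)"
        "term_poly (m + m') * h = term_poly m' * (term_poly m * h)"
        by (simp_all add: term_poly_add mult_ac)
      then show ?thesis
        using that m D(4) by (metis insertE polys_single)
    qed
    then show ?case using m by blast
  qed (use monoms_zero in blast)
  then obtain m where m: "m \<in> monoms V" "\<And>g. g \<in> G \<Longrightarrow> term_poly m * g \<in> K" by blast
  have mp: "term_poly m \<in> polys V" using m by auto
  have C: "colon_ideal (mpoly_ring V) K (PIdl\<^bsub>mpoly_ring V\<^esub> (term_poly m)) =
      {s \<in> polys V. s * term_poly m \<in> K}" (is "?C = _")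
    using colon_PIdl[OF KI mp] .
  have CK: "?C \<in> knutson_family (mpoly_ring V) f"
    by (intro knutson_family.colon K ideal_PIdl mp)
  have "Idl\<^bsub>mpoly_ring V\<^esub> G \<subseteq> ?C"
    using m(2) Gp by (intro Idl_mpoly_ring(3)[OF Gp] knutson_family_ideal[OF CK f])
      (auto simp: C mult.commute)
  \<comment> \<open>The colon ideal is caught between the generated ideal and its saturation, which
    coincide by \<open>satI\<close>.\<close>
  moreover have "?C \<subseteq> sat V (Idl\<^bsub>mpoly_ring V\<^esub> G)"
    using m(1) KG unfolding C sat_def by (auto simp: mult.commute)
  ultimately have "?C = Idl\<^bsub>mpoly_ring V\<^esub> G" using satI by blast
  then show ?thesis using CK by simp
qed

section \<open>Initial monomials\<close>

text \<open>Relational form of \<open>initial_monom\<close>: multiplicativity can be shown without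
  handling a definite description.\<close>

definition lead :: "'v monom rel \<Rightarrow> ('v, 'k::field) mpoly \<Rightarrow> 'v monom \<Rightarrow> bool" where
  "lead r f m \<longleftrightarrow> m \<in> Poly_Mapping.keys f \<and> (\<forall>m' \<in> Poly_Mapping.keys f. (m', m) \<in> r)"

lemma monomial_order_antisym:
  "monomial_order V r \<Longrightarrow> (m, m') \<in> r \<Longrightarrow> (m', m) \<in> r \<Longrightarrow> m = m'"
  by (auto simp: monomial_order_def linear_order_on_def partial_order_on_def antisym_def)

lemma monomial_order_trans:
  "monomial_order V r \<Longrightarrow> (m, m') \<in> r \<Longrightarrow> (m', m'') \<in> r \<Longrightarrow> (m, m'') \<in> r"
  unfolding monomial_order_def linear_order_on_def partial_order_on_def preorder_on_def
  by (meson transD)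

lemma monomial_order_refl: "monomial_order V r \<Longrightarrow> m \<in> monoms V \<Longrightarrow> (m, m) \<in> r"
  by (auto simp: monomial_order_def linear_order_on_def partial_order_on_def preorder_on_def refl_on_def)

lemma initial_monom_eqI:
  assumes "monomial_order V r" "lead r f m"
  shows "initial_monom r f = m"
  unfolding initial_monom_def
  using assms monomial_order_antisym[OF assms(1)] by (intro the_equality) (auto simp: lead_def)

lemma keys_times_eq:
  assumes "k \<in> Poly_Mapping.keys (f * g)"
  obtains a b where "a \<in> Poly_Mapping.keys f" "b \<in> Poly_Mapping.keys g" "k = a + b"
  using assms keys_mult[of f g] by blast

text \<open>Only the two leading terms contribute to the exponent \<open>m + m'\<close>: after
  splitting them off, neither of the two remaining products reaches it.\<close>

lemma lead_mult:
  fixes f g :: "('v, 'k::field) mpoly"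
  assumes r: "monomial_order V r" and V: "f \<in> polys V" "g \<in> polys V"
    and f: "lead r f m" and g: "lead r g m'"
  shows "lead r (f * g) (m + m')"
proof -
  have add: "(a + c, b + c) \<in> r" if "(a, b) \<in> r" "c \<in> monoms V" for a b c
    using r that by (auto simp: monomial_order_def)
  have le: "(a + b, m + b) \<in> r" "(m + b, m + m') \<in> r"
    if "a \<in> Poly_Mapping.keys f" "b \<in> Poly_Mapping.keys g" for a b
  proof -
    have "(a, m) \<in> r" "(b, m') \<in> r" "b \<in> monoms V" "m \<in> monoms V"
      using that f g V by (auto simp: lead_def polys_iff)
    then show "(a + b, m + b) \<in> r" "(m + b, m + m') \<in> r"
      using add[of a m b] add[of b m' m] by (simp_all add: add.commute)
  qed
  define c where "c = Poly_Mapping.lookup f m"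
  define f' where "f' = f - Poly_Mapping.single m c"
  define d where "d = Poly_Mapping.lookup g m'"
  define g' where "g' = g - Poly_Mapping.single m' d"
  have kf: "Poly_Mapping.keys f' = Poly_Mapping.keys f - {m}"
    by (auto simp: f'_def c_def in_keys_iff lookup_minus lookup_single when_def split: if_splits)
  have kg: "Poly_Mapping.keys g' = Poly_Mapping.keys g - {m'}"
    by (auto simp: g'_def d_def in_keys_iff lookup_minus lookup_single when_def split: if_splits)
  have "m + m' \<notin> Poly_Mapping.keys (f' * g)"
  proof
    assume "m + m' \<in> Poly_Mapping.keys (f' * g)"
    then obtain a b where ab: "a \<in> Poly_Mapping.keys f'" "b \<in> Poly_Mapping.keys g" "m + m' = a + b"
      by (rule keys_times_eq)
    \<comment> \<open>Squeezed by a + b \<le> m + b \<le> m + m' = a + b.\<close>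
    then have "a + b = m + b"
      using le[of a b] kf monomial_order_antisym[OF r, of "a + b" "m + b"] by auto
    then show False using ab kf by simp
  qed
  moreover have "m + m' \<notin> Poly_Mapping.keys (Poly_Mapping.single m c * g')"
  proof
    assume "m + m' \<in> Poly_Mapping.keys (Poly_Mapping.single m c * g')"
    then obtain a b where ab: "a \<in> Poly_Mapping.keys (Poly_Mapping.single m c)" "b \<in> Poly_Mapping.keys g'"
      "m + m' = a + b"
      by (rule keys_times_eq)
    then show False using kg by (auto split: if_splits)
  qed
  moreover have "f * g = f' * g + Poly_Mapping.single m c * g' + Poly_Mapping.single (m + m') (c * d)"
    by (simp add: f'_def g'_def algebra_simps mult_single)
  ultimately have "Poly_Mapping.lookup (f * g) (m + m') = c * d"
    by (simp add: lookup_add in_keys_iff)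
  moreover have "c \<noteq> 0" "d \<noteq> 0"
    using f g by (auto simp: lead_def c_def d_def in_keys_iff)
  ultimately have "m + m' \<in> Poly_Mapping.keys (f * g)"
    by (simp add: in_keys_iff)
  moreover have "(k, m + m') \<in> r" if "k \<in> Poly_Mapping.keys (f * g)" for k
    using that le monomial_order_trans[OF r] by (metis keys_times_eq)
  ultimately show ?thesis by (simp add: lead_def)
qed

lemma lead_prod:
  fixes g :: "'e \<Rightarrow> ('v, 'k::field) mpoly"
  assumes r: "monomial_order V r" and "finite E"
    and "\<And>e. e \<in> E \<Longrightarrow> g e \<in> polys V" "\<And>e. e \<in> E \<Longrightarrow> lead r (g e) (m e)"
  shows "lead r (prod g E) (sum m E)"
  using assms(2-)
proof (induction E rule: finite_induct)
  case empty
  show ?case using monomial_order_refl[OF r monoms_zero] by (simp add: lead_def)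
next
  case (insert e E)
  then show ?case
    using lead_mult[OF r, of "g e" "prod g E" "m e" "sum m E"] by (simp add: polys_prod)
qed

text \<open>A lexicographic order with the variables sorted by rank. Comparing the pairs
  \<open>(rk x, x)\<close> breaks ties by the given order of the variables, so that
  \<open>rk\<close> may be any function, injective or not.\<close>

definition rank_order :: "'v::linorder set \<Rightarrow> ('v \<Rightarrow> nat) \<Rightarrow> 'v monom rel" where
  "rank_order V rk = {(m, m'). m \<in> monoms V \<and> m' \<in> monoms V \<and> (m = m' \<or>
     (\<exists>x \<in> V. Poly_Mapping.lookup m x < Poly_Mapping.lookup m' x \<and>
       (\<forall>y \<in> V. (rk x, x) < (rk y, y) \<longrightarrow> Poly_Mapping.lookup m y = Poly_Mapping.lookup m' y)))}"

lemma top_difference: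
  fixes V :: "'v::linorder set" and rk :: "'v \<Rightarrow> nat"
  assumes "finite V" "m \<in> monoms V" "m' \<in> monoms V" "m \<noteq> m'"
  obtains x where "x \<in> V" "Poly_Mapping.lookup m x \<noteq> Poly_Mapping.lookup m' x"
    "\<And>y. y \<in> V \<Longrightarrow> (rk x, x) < (rk y, y) \<Longrightarrow> Poly_Mapping.lookup m y = Poly_Mapping.lookup m' y"
proof -
  let ?D = "{x \<in> V. Poly_Mapping.lookup m x \<noteq> Poly_Mapping.lookup m' x}"
  let ?K = "(\<lambda>x. (rk x, x)) ` ?D"
  obtain x0 where x0: "Poly_Mapping.lookup m x0 \<noteq> Poly_Mapping.lookup m' x0"
    using assms(4) poly_mapping_eqI by metis
  then have "x0 \<in> V"
    using assms(2,3) by (cases "Poly_Mapping.lookup m x0 = 0") (auto simp: monoms_def in_keys_iff subset_iff)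
  with x0 have ne: "?K \<noteq> {}" and fin: "finite ?K"
    using assms(1) by auto
  obtain x where x: "x \<in> ?D" "Max ?K = (rk x, x)"
    using Max_in[OF fin ne] by (elim imageE)
  have eq: "Poly_Mapping.lookup m y = Poly_Mapping.lookup m' y" if "y \<in> V" "(rk x, x) < (rk y, y)" for y
  proof (rule ccontr)
    assume "Poly_Mapping.lookup m y \<noteq> Poly_Mapping.lookup m' y"
    then have "(rk y, y) \<in> ?K" using that(1) by blast
    then have "(rk y, y) \<le> Max ?K"
      by (rule Max_ge[OF fin])
    then show False using that(2) unfolding x(2) by (rule leD[THEN notE])
  qed
  show ?thesis
  proof (rule that)
    show "x \<in> V" "Poly_Mapping.lookup m x \<noteq> Poly_Mapping.lookup m' x"
      using x(1) by blast+
  qed (rule eq)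
qed

lemma monomial_order_rank_order:
  fixes V :: "'v::linorder set"
  assumes V: "finite V"
  shows "monomial_order V (rank_order V rk)"
proof -
  let ?r = "rank_order V rk"
  have tot: "(m, m') \<in> ?r \<or> (m', m) \<in> ?r" if m: "m \<in> monoms V" "m' \<in> monoms V" for m m'
  proof (cases "m = m'")
    case False
    obtain x where x: "x \<in> V" "Poly_Mapping.lookup m x \<noteq> Poly_Mapping.lookup m' x"
      "\<And>y. y \<in> V \<Longrightarrow> (rk x, x) < (rk y, y) \<Longrightarrow> Poly_Mapping.lookup m y = Poly_Mapping.lookup m' y"
      using top_difference[OF V m False] by metis
    show ?thesis
    proof (cases "Poly_Mapping.lookup m x < Poly_Mapping.lookup m' x")
      case True
      then show ?thesis using x(1,3) m unfolding rank_order_def by blast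
    next
      case False
      then have "Poly_Mapping.lookup m' x < Poly_Mapping.lookup m x" using x(2) by simp
      then show ?thesis using x(1) x(3)[symmetric] m unfolding rank_order_def by blast
    qed
  qed (use m in \<open>auto simp: rank_order_def\<close>)
  have trans: "(m, m'') \<in> ?r" if r: "(m, m') \<in> ?r" "(m', m'') \<in> ?r" for m m' m''
  proof (cases "m = m' \<or> m' = m''")
    case False
    obtain x where x: "x \<in> V" "Poly_Mapping.lookup m x < Poly_Mapping.lookup m' x"
      "\<And>y. y \<in> V \<Longrightarrow> (rk x, x) < (rk y, y) \<Longrightarrow> Poly_Mapping.lookup m y = Poly_Mapping.lookup m' y"
      using r(1) False unfolding rank_order_def by blast
    obtain x' where x': "x' \<in> V" "Poly_Mapping.lookup m' x' < Poly_Mapping.lookup m'' x'"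
      "\<And>y. y \<in> V \<Longrightarrow> (rk x', x') < (rk y, y) \<Longrightarrow> Poly_Mapping.lookup m' y = Poly_Mapping.lookup m'' y"
      using r(2) False unfolding rank_order_def by blast
    have mm: "m \<in> monoms V" "m'' \<in> monoms V"
      using r by (auto simp: rank_order_def)
    consider "(rk x, x) < (rk x', x')" | "(rk x', x') < (rk x, x)" | "x = x'"
      using less_linear[of "(rk x, x)" "(rk x', x')"] by (metis prod.inject)
    then have "\<exists>z \<in> V. Poly_Mapping.lookup m z < Poly_Mapping.lookup m'' z \<and>
       (\<forall>y \<in> V. (rk z, z) < (rk y, y) \<longrightarrow> Poly_Mapping.lookup m y = Poly_Mapping.lookup m'' y)"
    proof cases
      case 1
      show ?thesis
        using x(3)[OF x'(1) 1] x' x(3) less_trans[OF 1] by (intro bexI[of _ x'] conjI ballI impI) auto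
    next
      case 2
      show ?thesis
        using x'(3)[OF x(1) 2] x x'(3) less_trans[OF 2] by (intro bexI[of _ x] conjI ballI impI) auto
    next
      case 3
      then show ?thesis
        using x x' less_trans by (intro bexI[of _ x] conjI ballI impI) auto
    qed
    then show ?thesis using mm unfolding rank_order_def by blast
  qed (use r in auto)
  have anti: "m = m'" if r: "(m, m') \<in> ?r" "(m', m) \<in> ?r" for m m'
  proof (rule ccontr)
    assume ne: "m \<noteq> m'"
    obtain x where x: "x \<in> V" "Poly_Mapping.lookup m x < Poly_Mapping.lookup m' x"
      "\<And>y. y \<in> V \<Longrightarrow> (rk x, x) < (rk y, y) \<Longrightarrow> Poly_Mapping.lookup m y = Poly_Mapping.lookup m' y"
      using r(1) ne unfolding rank_order_def by blast
    obtain x' where x': "x' \<in> V" "Poly_Mapping.lookup m' x' < Poly_Mapping.lookup m x'"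
      "\<And>y. y \<in> V \<Longrightarrow> (rk x', x') < (rk y, y) \<Longrightarrow> Poly_Mapping.lookup m' y = Poly_Mapping.lookup m y"
      using r(2) ne unfolding rank_order_def by blast
    consider "(rk x, x) < (rk x', x')" | "(rk x', x') < (rk x, x)" | "x = x'"
      using less_linear[of "(rk x, x)" "(rk x', x')"] by (metis prod.inject)
    then show False
      using x(2) x'(2) x(3)[OF x'(1)] x'(3)[OF x(1)] by cases auto
  qed
  have "(0, m) \<in> ?r" if m: "m \<in> monoms V" for m
  proof (cases "m = 0")
    case False
    obtain x where "x \<in> V" "Poly_Mapping.lookup 0 x \<noteq> Poly_Mapping.lookup m x"
      "\<And>y. y \<in> V \<Longrightarrow> (rk x, x) < (rk y, y) \<Longrightarrow> Poly_Mapping.lookup 0 y = Poly_Mapping.lookup m y"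
      using top_difference[OF V monoms_zero m False[symmetric]] by metis
    then show ?thesis using m unfolding rank_order_def by auto
  qed (simp add: rank_order_def)
  moreover have "(m + u, m' + u) \<in> ?r" if "u \<in> monoms V" "(m, m') \<in> ?r" for m m' u
    using that by (auto simp: rank_order_def lookup_add)
  moreover have "linear_order_on (monoms V) ?r"
    unfolding linear_order_on_def partial_order_on_def preorder_on_def
  proof (intro conjI)
    show "?r \<subseteq> monoms V \<times> monoms V"
      by (auto simp: rank_order_def)
    show "refl_on (monoms V) ?r"
      by (auto simp: rank_order_def refl_on_def)
    show "trans ?r" using trans by (rule transI)
    show "antisym ?r" using anti by (rule antisymI)
    show "total_on (monoms V) ?r" using tot by (simp add: total_on_def)
  qed
  ultimately show ?thesis
    unfolding monomial_order_def by blast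
qed

text \<open>The variable that decides the comparison has rank at least \<open>rk x\<close>, because
  the exponents already differ at \<open>x\<close>; in this range of ranks they can only
  grow.\<close>

lemma rank_orderI:
  fixes V :: "'v::linorder set"
  assumes "finite V" "m \<in> monoms V" "m' \<in> monoms V"
    and "Poly_Mapping.lookup m x < Poly_Mapping.lookup m' x"
    and le: "\<And>y. rk x \<le> rk y \<Longrightarrow> Poly_Mapping.lookup m y \<le> Poly_Mapping.lookup m' y"
  shows "(m, m') \<in> rank_order V rk"
proof -
  have "m \<noteq> m'" using assms(4) by auto
  then obtain z where z: "z \<in> V" "Poly_Mapping.lookup m z \<noteq> Poly_Mapping.lookup m' z"
    "\<And>y. y \<in> V \<Longrightarrow> (rk z, z) < (rk y, y) \<Longrightarrow> Poly_Mapping.lookup m y = Poly_Mapping.lookup m' y"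
    using top_difference[OF assms(1-3)] by metis
  have "x \<in> V"
    using assms(3,4) by (auto simp: monoms_def in_keys_iff subset_iff)
  then have "rk x \<le> rk z"
    using z(3)[of x] assms(4) by (cases "rk z < rk x") auto
  then have "Poly_Mapping.lookup m z < Poly_Mapping.lookup m' z"
    using le[of z] z(2) by simp
  then show ?thesis
    using z(1,3) assms(2,3) unfolding rank_order_def by blast
qed

section \<open>Products of minors with coprime initial monomials\<close>

definition minor :: "vertex \<Rightarrow> vertex \<Rightarrow> (vertex, 'k::field) mpoly" where
  "minor a b = var a * var b - var (fst a, snd b) * var (fst b, snd a)"

lemma minor_polys:
  assumes "{a, b, (fst a, snd b), (fst b, snd a)} \<subseteq> V"
  shows "minor a b \<in> polys V"
  unfolding minor_def using assms by (intro polys_diff polys_mult polys_var) auto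

text \<open>From rank \<open>rk t\<close> upwards the antidiagonal monomial has only zero exponents,
  while the diagonal one contains \<open>t\<close>.\<close>

lemma lead_minor:
  fixes V :: "vertex set"
  assumes V: "finite V" "{a, b, c, d} \<subseteq> V"
    and cd: "c = (fst a, snd b)" "d = (fst b, snd a)"
    and t: "t \<in> {a, b}" "rk c < rk t" "rk d < rk t"
  shows "lead (rank_order V rk) (minor a b :: (vertex, 'k::field) mpoly)
    (Poly_Mapping.single a 1 + Poly_Mapping.single b 1)"
proof -
  let ?m = "Poly_Mapping.single a 1 + Poly_Mapping.single b (1 :: nat)"
  let ?m' = "Poly_Mapping.single c 1 + Poly_Mapping.single d (1 :: nat)"
  have eq: "minor a b = Poly_Mapping.single ?m (1 :: 'k) - Poly_Mapping.single ?m' 1"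
    by (simp add: minor_def var_def mult_single cd)
  have m: "?m \<in> monoms V" "?m' \<in> monoms V"
    using V(2) by auto
  have ne: "?m \<noteq> ?m'"
  proof
    assume "?m = ?m'"
    then have "Poly_Mapping.lookup ?m t = Poly_Mapping.lookup ?m' t" by simp
    then show False using t by (auto simp: lookup_add lookup_single when_def split: if_splits)
  qed
  have "(?m', ?m) \<in> rank_order V rk"
    using t by (intro rank_orderI[OF V(1) m(2,1), of t])
      (auto simp: lookup_add lookup_single when_def)
  moreover have "(?m, ?m) \<in> rank_order V rk"
    using m by (simp add: rank_order_def)
  moreover have "Poly_Mapping.keys (minor a b :: (vertex, 'k) mpoly) = {?m, ?m'}"
    unfolding eq using ne by (auto simp: in_keys_iff lookup_minus lookup_single when_def split: if_splits)
  ultimately show ?thesis by (simp add: lead_def)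
qed

text \<open>A set \<open>E\<close> of rectangles, each given by the diagonal that carries the initial monomial of its
  minor. The initial monomials are controlled by a set of labels \<open>(x, k)\<close>, saying that the vertex
  \<open>x\<close> has rank at least \<open>k\<close>.\<close>

locale schedule =
  fixes V :: "vertex set" and E :: "(vertex \<times> vertex) set" and labels :: "(vertex \<times> nat) set"
  assumes V: "finite V" and E: "finite E"
    and labels: "finite labels"
    and corners: "\<And>a b. (a, b) \<in> E \<Longrightarrow> {a, b, (fst a, snd b), (fst b, snd a)} \<subseteq> V"
    and ne: "\<And>a b. (a, b) \<in> E \<Longrightarrow> a \<noteq> b"
    and disjoint: "\<And>a b a' b'. (a, b) \<in> E \<Longrightarrow> (a', b') \<in> E \<Longrightarrow> (a, b) \<noteq> (a', b') \<Longrightarrow>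
      {a, b} \<inter> {a', b'} = {}"
    and top: "\<And>a b. (a, b) \<in> E \<Longrightarrow> \<exists>t \<in> {a, b}. \<exists>k > 0. (t, k) \<in> labels \<and>
        (\<forall>k'. ((fst a, snd b), k') \<in> labels \<or> ((fst b, snd a), k') \<in> labels \<longrightarrow> k' < k)"
begin

text \<open>Vertices without a label get rank 0, the reason for the positive label in
  \<open>top\<close>.\<close>

definition rk :: "vertex \<Rightarrow> nat" where
  "rk x = Max (insert 0 {k. (x, k) \<in> labels})"

definition f :: "(vertex, 'k::field) mpoly" where
  "f = (\<Prod>(a, b) \<in> E. minor a b)"

lemma finite_labels_at: "finite {k. (x, k) \<in> labels}"
proof -
  have "{k. (x, k) \<in> labels} \<subseteq> snd ` labels" by force
  then show ?thesis using finite_subset labels by blast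
qed

lemma rk_ge: "(x, k) \<in> labels \<Longrightarrow> k \<le> rk x"
  unfolding rk_def using finite_labels_at[of x] by (intro Max_ge) auto

lemma rk_less: "0 < k \<Longrightarrow> (\<And>k'. (x, k') \<in> labels \<Longrightarrow> k' < k) \<Longrightarrow> rk x < k"
  unfolding rk_def using finite_labels_at[of x] by (subst Max_less_iff) auto

lemma lead_E:
  assumes "(a, b) \<in> E"
  shows "lead (rank_order V rk) (minor a b :: (vertex, 'k::field) mpoly)
    (Poly_Mapping.single a 1 + Poly_Mapping.single b 1)"
proof -
  obtain t k where t: "t \<in> {a, b}" "k > 0" "(t, k) \<in> labels"
    "\<And>k'. ((fst a, snd b), k') \<in> labels \<or> ((fst b, snd a), k') \<in> labels \<Longrightarrow> k' < k"
    using top[OF assms] by blast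
  have "rk (fst a, snd b) < rk t" "rk (fst b, snd a) < rk t"
    using rk_less[OF t(2), of "(fst a, snd b)"] rk_less[OF t(2), of "(fst b, snd a)"] t(4)
      rk_ge[OF t(3)] by force+
  then show ?thesis
    using lead_minor[OF V corners[OF assms] refl refl t(1)] by blast
qed

lemma minor_E: "(a, b) \<in> E \<Longrightarrow> minor a b \<in> polys V"
  using minor_polys[OF corners] .

lemma prod_minor_polys:
  assumes "E' \<subseteq> E"
  shows "(\<Prod>(a, b) \<in> E'. minor a b) \<in> polys V"
proof (rule polys_prod)
  fix e assume "e \<in> E'"
  then have "(fst e, snd e) \<in> E" using assms by auto
  from minor_E[OF this] show "(case e of (a, b) \<Rightarrow> minor a b) \<in> polys V"
    by (simp only: case_prod_unfold)
qed

lemma f_polys: "f \<in> polys V"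
  unfolding f_def using prod_minor_polys by blast

lemma lead_f: "lead (rank_order V rk) (f :: (vertex, 'k::field) mpoly)
    (\<Sum>(a, b) \<in> E. Poly_Mapping.single a 1 + Poly_Mapping.single b 1)"
  unfolding f_def using lead_E minor_E
  by (intro lead_prod[OF monomial_order_rank_order[OF V] E]) auto

lemma squarefree_lead:
  "squarefree_monom (\<Sum>(a, b) \<in> E. Poly_Mapping.single a 1 + Poly_Mapping.single b 1)"
  unfolding squarefree_monom_def
proof
  fix x :: vertex
  let ?g = "\<lambda>(a, b). Poly_Mapping.lookup (Poly_Mapping.single a 1 + Poly_Mapping.single b (1::nat)) x"
  have eq: "Poly_Mapping.lookup (\<Sum>(a, b) \<in> E. Poly_Mapping.single a 1 + Poly_Mapping.single b (1::nat)) x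
      = sum ?g E"
    by (simp add: lookup_sum case_prod_unfold)
  show "Poly_Mapping.lookup (\<Sum>(a, b) \<in> E. Poly_Mapping.single a 1 + Poly_Mapping.single b 1) x \<le> (1::nat)"
  proof (cases "\<exists>e \<in> E. x \<in> {fst e, snd e}")
    case True
    then obtain e where e: "e \<in> E" "x \<in> {fst e, snd e}" by blast
    have "?g e' = 0" if "e' \<in> E - {e}" for e'
      using disjoint[of "fst e" "snd e" "fst e'" "snd e'"] that e
      by (auto simp: lookup_add lookup_single when_def split: prod.splits)
    then have "sum ?g E = ?g e"
      using sum.remove[OF E e(1), of ?g] by simp
    also have "\<dots> \<le> 1"
      using ne[of "fst e" "snd e"] e by (auto simp: lookup_add lookup_single when_def split: prod.splits)
    finally show ?thesis using eq by simp
  next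
    case False
    then have "?g e = 0" if "e \<in> E" for e
      using that by (force simp: lookup_add lookup_single when_def split: prod.splits)
    then have "sum ?g E = 0" by (intro sum.neutral) blast
    then show ?thesis using eq by simp
  qed
qed

lemma PIdl_minor:
  assumes "(a, b) \<in> E"
  shows "PIdl\<^bsub>mpoly_ring V\<^esub> (minor a b) \<in> knutson_family (mpoly_ring V) (f :: (vertex, 'k::field) mpoly)"
proof (rule knutson_family_PIdl_factor)
  show "(f :: (vertex, 'k) mpoly) = minor a b * (\<Prod>(a, b) \<in> E - {(a, b)}. minor a b)"
    unfolding f_def using prod.remove[OF E assms, of "\<lambda>(a, b). minor a b"] by simp
  show "(minor a b :: (vertex, 'k) mpoly) \<in> polys V"
    using minor_E[OF assms] .
  show "(\<Prod>(a, b) \<in> E - {(a, b)}. minor a b :: (vertex, 'k) mpoly) \<in> polys V"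
    using prod_minor_polys by blast
  have "(minor a b :: (vertex, 'k) mpoly) \<noteq> 0" if "(a, b) \<in> E" for a b
    using lead_E[OF that, where ?'k = 'k] by (auto simp: lead_def)
  then show "(\<Prod>(a, b) \<in> E - {(a, b)}. minor a b :: (vertex, 'k) mpoly) \<noteq> 0"
    using E by auto
qed

lemma knutson_ideal_Idl:
  fixes G :: "(vertex, 'k::field) mpoly set"
  assumes G: "finite G" "G \<noteq> {}" "G \<subseteq> polys V"
    and K: "\<And>g. g \<in> G \<Longrightarrow>
      \<exists>K \<in> knutson_family (mpoly_ring V) f. g \<in> K \<and> K \<subseteq> Idl\<^bsub>mpoly_ring V\<^esub> G"
  shows "knutson_ideal V (Idl\<^bsub>mpoly_ring V\<^esub> G)"
  unfolding knutson_ideal_def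
proof (intro exI conjI)
  show r: "monomial_order V (rank_order V rk)"
    using monomial_order_rank_order[OF V] .
  show "squarefree_monom (initial_monom (rank_order V rk) (f :: (vertex, 'k) mpoly))"
    using squarefree_lead by (simp only: initial_monom_eqI[OF r lead_f])
  show "(f :: (vertex, 'k) mpoly) \<noteq> 0"
    using lead_f[where ?'k = 'k] by (auto simp: lead_def)
  show "Idl\<^bsub>mpoly_ring V\<^esub> G \<in> knutson_family (mpoly_ring V) f"
    using knutson_family_Idl[OF f_polys G K] by blast
  show "(f :: (vertex, 'k) mpoly) \<in> polys V" by (rule f_polys)
qed

end

section \<open>Saturatedness of ladder ideals\<close>

lemma monom_split:
  fixes m :: "'v monom"
  assumes "0 < Poly_Mapping.lookup m x"
  obtains m1 where "m = m1 + Poly_Mapping.single x 1"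
proof
  show "m = Poly_Mapping.update x (Poly_Mapping.lookup m x - 1) m + Poly_Mapping.single x 1"
    using assms by (intro poly_mapping_eqI) (auto simp: lookup_add lookup_update lookup_single when_def)
qed

lemma monoms_addD: "a + b \<in> monoms V \<Longrightarrow> a \<in> monoms V"
  by (auto simp: monoms_def in_keys_iff lookup_add subset_iff)

text \<open>Adding \<open>a\<close> is injective on exponent vectors, so only one term of
  \<open>p\<close> contributes.\<close>

lemma lookup_single_times:
  fixes p :: "('v, 'k::field) mpoly"
  shows "Poly_Mapping.lookup (Poly_Mapping.single a c * p) (a + m) = c * Poly_Mapping.lookup p m"
proof -
  define d where "d = Poly_Mapping.lookup p m"
  define p' where "p' = p - Poly_Mapping.single m d"
  have kp: "m \<notin> Poly_Mapping.keys p'"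
    by (simp add: p'_def d_def in_keys_iff lookup_minus)
  have "a + m \<notin> Poly_Mapping.keys (Poly_Mapping.single a c * p')"
  proof
    assume "a + m \<in> Poly_Mapping.keys (Poly_Mapping.single a c * p')"
    then obtain a' b where "a' \<in> Poly_Mapping.keys (Poly_Mapping.single a c)"
      "b \<in> Poly_Mapping.keys p'" "a + m = a' + b"
      by (rule keys_times_eq)
    then show False using kp by (auto split: if_splits)
  qed
  moreover have "Poly_Mapping.single a c * p =
      Poly_Mapping.single a c * p' + Poly_Mapping.single (a + m) (c * d)"
    by (simp add: p'_def algebra_simps mult_single)
  ultimately show ?thesis
    by (simp add: lookup_add in_keys_iff d_def)
qed

lemma mpoly_sum_terms:
  "p = (\<Sum>m \<in> Poly_Mapping.keys p. Poly_Mapping.single m (Poly_Mapping.lookup p m))"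
  by (rule poly_mapping_eqI) (auto simp: lookup_sum lookup_single when_def in_keys_iff)

text \<open>A partial matrix of distinct variables with columns \<open>X\<close>: two full rows \<open>0\<close> and \<open>1\<close>, and two
  rows \<open>2\<close> and \<open>3\<close> occupying disjoint sets of columns.\<close>

locale ladder =
  fixes V :: "'v set" and \<phi> :: "nat \<times> nat \<Rightarrow> 'v" and X Z2 Z3 :: "nat set"
  assumes finite_X: "finite X" and Z: "Z2 \<subseteq> X" "Z3 \<subseteq> X" "Z2 \<inter> Z3 = {}"
    and inj: "inj_on \<phi> ({0, 1} \<times> X \<union> {2} \<times> Z2 \<union> {3} \<times> Z3)"
    and \<phi>V: "\<phi> ` ({0, 1} \<times> X \<union> {2} \<times> Z2 \<union> {3} \<times> Z3) \<subseteq> V"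
begin

definition D :: "(nat \<times> nat) set" where
  "D = {0, 1} \<times> X \<union> {2} \<times> Z2 \<union> {3} \<times> Z3"

definition mn :: "nat \<Rightarrow> nat \<Rightarrow> nat \<Rightarrow> nat \<Rightarrow> ('v, 'k::field) mpoly" where
  "mn r r' c c' = var (\<phi> (r, c)) * var (\<phi> (r', c')) - var (\<phi> (r, c')) * var (\<phi> (r', c))"

definition minors :: "('v, 'k::field) mpoly set" where
  "minors = {mn r r' c c' | r r' c c'. {r, r'} \<times> {c, c'} \<subseteq> D}"

abbreviation lad :: "('v, 'k::field) mpoly set" where
  "lad \<equiv> Idl\<^bsub>mpoly_ring V\<^esub> minors"

lemma finite_D: "finite D"
  using finite_X Z finite_subset unfolding D_def by blast

lemma D_V: "d \<in> D \<Longrightarrow> \<phi> d \<in> V"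
  using \<phi>V unfolding D_def by blast

lemma D_inj: "d \<in> D \<Longrightarrow> d' \<in> D \<Longrightarrow> \<phi> d = \<phi> d' \<longleftrightarrow> d = d'"
  using inj unfolding D_def inj_on_def by blast

text \<open>Completing three corners of a rectangle. If row \<open>r\<close> is short, both columns
  belong to it, and a different short row cannot contain column \<open>c\<close> because
  \<open>Z2\<close> and \<open>Z3\<close> are disjoint. Between the full rows there is no
  restriction.\<close>

lemma D_exchange:
  assumes "(r, c) \<in> D" "(r, c') \<in> D" "(r', c) \<in> D" "2 \<le> r \<or> r' < 2"
  shows "(r', c') \<in> D"
  using assms Z unfolding D_def by auto

lemma minors_polys: "minors \<subseteq> polys V"
  unfolding minors_def mn_def using D_V by (force)

lemma finite_minors: "finite minors"
proof -
  have "minors \<subseteq> (\<lambda>(d, d'). mn (fst d) (fst d') (snd d) (snd d')) ` (D \<times> D)"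
    unfolding minors_def by force
  then show ?thesis using finite_D finite_subset by blast
qed

lemmas ideal_lad = Idl_mpoly_ring(1)[OF minors_polys]

lemma mn_lad: "{r, r'} \<times> {c, c'} \<subseteq> D \<Longrightarrow> mn r r' c c' \<in> lad"
  using Idl_mpoly_ring(2)[OF minors_polys] unfolding minors_def by blast

text \<open>Both monomials have the same image under the toric parametrization that sends the entry
  in row r and column c to s_r t_c and fixes all other variables.\<close>

definition margins :: "'v monom \<Rightarrow> 'v monom \<Rightarrow> bool" where
  "margins m m' \<longleftrightarrow>
    (\<forall>r. (\<Sum>d | d \<in> D \<and> fst d = r. Poly_Mapping.lookup m (\<phi> d)) =
         (\<Sum>d | d \<in> D \<and> fst d = r. Poly_Mapping.lookup m' (\<phi> d))) \<and>
    (\<forall>c. (\<Sum>d | d \<in> D \<and> snd d = c. Poly_Mapping.lookup m (\<phi> d)) =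
         (\<Sum>d | d \<in> D \<and> snd d = c. Poly_Mapping.lookup m' (\<phi> d))) \<and>
    (\<forall>x. x \<notin> \<phi> ` D \<longrightarrow> Poly_Mapping.lookup m x = Poly_Mapping.lookup m' x)"

lemma margins_refl [simp]: "margins m m"
  by (simp add: margins_def)

lemma margins_sym: "margins m m' \<Longrightarrow> margins m' m"
  by (simp add: margins_def)

lemma margins_trans: "margins m m' \<Longrightarrow> margins m' m'' \<Longrightarrow> margins m m''"
  by (simp add: margins_def)

lemma margins_add_cancel [simp]: "margins (a + m) (a + m') \<longleftrightarrow> margins m m'"
  by (simp add: margins_def lookup_add sum.distrib)

lemma margins_add_cancel' [simp]: "margins (m + a) (m' + a) \<longleftrightarrow> margins m m'"
  using margins_add_cancel[of a m m'] by (simp add: add.commute)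

lemma sum_single_D:
  assumes "d \<in> D"
  shows "(\<Sum>d' | d' \<in> D \<and> P d'. Poly_Mapping.lookup (Poly_Mapping.single (\<phi> d) (1::nat)) (\<phi> d')) =
    (if P d then 1 else 0)"
proof -
  have "(\<Sum>d' | d' \<in> D \<and> P d'. Poly_Mapping.lookup (Poly_Mapping.single (\<phi> d) (1::nat)) (\<phi> d')) =
      (\<Sum>d' | d' \<in> D \<and> P d'. if d' = d then 1 else 0)"
    using assms D_inj by (intro sum.cong) (auto simp: lookup_single when_def)
  also have "\<dots> = (if P d then 1 else 0)"
    using assms finite_D by simp
  finally show ?thesis .
qed

lemma margins_exchange:
  assumes "{r, r'} \<times> {c, c'} \<subseteq> D"
  shows "margins (Poly_Mapping.single (\<phi> (r, c')) 1 + Poly_Mapping.single (\<phi> (r', c)) 1)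
    (Poly_Mapping.single (\<phi> (r, c)) 1 + Poly_Mapping.single (\<phi> (r', c')) 1)"
  using assms unfolding margins_def
  by (auto simp: lookup_add sum.distrib sum_single_D simp del: One_nat_def)
     (auto simp: lookup_single when_def)

text \<open>The fibres of the toric parametrization are connected by moves along minors. The
  induction is on the degree of \<open>m'\<close> in the ladder variables: one move makes
  \<open>m\<close> share a variable with \<open>m'\<close>, which is then divided out.\<close>

lemma margins_connected:
  fixes m m' :: "'v monom"
  assumes "m \<in> monoms V" "m' \<in> monoms V" "margins m m'"
  shows "(term_poly m - term_poly m' :: ('v, 'k::field) mpoly) \<in> lad"
  using assms
proof (induction "\<Sum>d \<in> D. Poly_Mapping.lookup m' (\<phi> d)" arbitrary: m m' rule: less_induct)
  case less
  note L = ideal_mpoly_ringD[OF ideal_lad]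
  have common: "(term_poly n - term_poly m' :: ('v, 'k) mpoly) \<in> lad"
    if n: "n \<in> monoms V" "margins n m'" and d: "d \<in> D" "0 < Poly_Mapping.lookup n (\<phi> d)"
      "0 < Poly_Mapping.lookup m' (\<phi> d)" for n d
  proof -
    obtain n1 where n1: "n = n1 + Poly_Mapping.single (\<phi> d) 1"
      using monom_split[OF d(2)] .
    obtain m1 where m1: "m' = m1 + Poly_Mapping.single (\<phi> d) 1"
      using monom_split[OF d(3)] .
    have "(\<Sum>d \<in> D. Poly_Mapping.lookup m1 (\<phi> d)) < (\<Sum>d \<in> D. Poly_Mapping.lookup m' (\<phi> d))"
      using finite_D d(1)
      by (intro sum_strict_mono_ex1 ballI bexI[of _ d]) (simp_all add: m1 lookup_add lookup_single)
    moreover have "n1 \<in> monoms V" "m1 \<in> monoms V"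
      using n(1) less.prems(2) n1 m1 monoms_addD by auto
    moreover have "margins n1 m1"
      using n(2) by (simp add: n1 m1)
    ultimately have "(term_poly n1 - term_poly m1 :: ('v, 'k) mpoly) \<in> lad"
      using less.hyps by blast
    then have "var (\<phi> d) * (term_poly n1 - term_poly m1 :: ('v, 'k) mpoly) \<in> lad"
      using L(4) polys_var[OF D_V[OF d(1)]] by blast
    moreover have "var (\<phi> d) * (term_poly n1 - term_poly m1) = (term_poly n - term_poly m' :: ('v, 'k) mpoly)"
      by (simp add: n1 m1 term_poly_add var_def algebra_simps del: One_nat_def)
    ultimately show ?thesis by simp
  qed
  have row: "\<exists>c'. (r, c') \<in> D \<and> 0 < Poly_Mapping.lookup n' (\<phi> (r, c'))"
    if "margins n n'" "(r, c) \<in> D" "0 < Poly_Mapping.lookup n (\<phi> (r, c))" for n n' r c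
  proof (rule ccontr)
    assume "\<not> ?thesis"
    then have "(\<Sum>d | d \<in> D \<and> fst d = r. Poly_Mapping.lookup n' (\<phi> d)) = 0"
      by (intro sum.neutral) auto
    then have "(\<Sum>d | d \<in> D \<and> fst d = r. Poly_Mapping.lookup n (\<phi> d)) = 0"
      using that(1) by (simp add: margins_def)
    then show False using that(2,3) finite_D by auto
  qed
  have col: "\<exists>r'. (r', c) \<in> D \<and> 0 < Poly_Mapping.lookup n' (\<phi> (r', c))"
    if "margins n n'" "(r, c) \<in> D" "0 < Poly_Mapping.lookup n (\<phi> (r, c))" for n n' r c
  proof (rule ccontr)
    assume "\<not> ?thesis"
    then have "(\<Sum>d | d \<in> D \<and> snd d = c. Poly_Mapping.lookup n' (\<phi> d)) = 0"
      by (intro sum.neutral) auto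
    then have "(\<Sum>d | d \<in> D \<and> snd d = c. Poly_Mapping.lookup n (\<phi> d)) = 0"
      using that(1) by (simp add: margins_def)
    then show False using that(2,3) finite_D by auto
  qed
  show ?case
  proof (cases "\<exists>d \<in> D. 0 < Poly_Mapping.lookup m' (\<phi> d)")
    case True
    \<comment> \<open>A variable of \<open>m'\<close> in a short row is preferred. If there is none,
      equal row sums show that \<open>m\<close> has none either. In both cases
      \<open>D_exchange\<close> places the rectangle of the move inside \<open>D\<close>.\<close>
    have "\<exists>r c. (r, c) \<in> D \<and> 0 < Poly_Mapping.lookup m' (\<phi> (r, c)) \<and>
      (2 \<le> r \<or> (\<forall>r' c'. (r', c') \<in> D \<and> 0 < Poly_Mapping.lookup m' (\<phi> (r', c')) \<longrightarrow> r' < 2))"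
      using True by (metis not_less surj_pair)
    then obtain r c where rc: "(r, c) \<in> D" "0 < Poly_Mapping.lookup m' (\<phi> (r, c))"
      "2 \<le> r \<or> (\<forall>r' c'. (r', c') \<in> D \<and> 0 < Poly_Mapping.lookup m' (\<phi> (r', c')) \<longrightarrow> r' < 2)"
      by blast
    obtain c' where c': "(r, c') \<in> D" "0 < Poly_Mapping.lookup m (\<phi> (r, c'))"
      using row[OF margins_sym[OF less.prems(3)] rc(1,2)] by blast
    obtain r' where r': "(r', c) \<in> D" "0 < Poly_Mapping.lookup m (\<phi> (r', c))"
      using col[OF margins_sym[OF less.prems(3)] rc(1,2)] by blast
    have "2 \<le> r \<or> r' < 2"
      using rc(3) row[OF less.prems(3) r'] by blast
    then have D: "{r, r'} \<times> {c, c'} \<subseteq> D"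
      using D_exchange rc(1) c'(1) r'(1) by blast
    show ?thesis
    proof (cases "0 < Poly_Mapping.lookup m (\<phi> (r, c))")
      case True
      from common[OF less.prems(1,3) rc(1) this rc(2)] show ?thesis .
    next
      case False
      then have "c' \<noteq> c" "r' \<noteq> r" using c' r' by auto
      obtain m1 where m1: "m = m1 + Poly_Mapping.single (\<phi> (r, c')) 1"
        using monom_split[OF c'(2)] .
      have "0 < Poly_Mapping.lookup m1 (\<phi> (r', c))"
        using r'(2) D_inj[OF c'(1) r'(1)] \<open>c' \<noteq> c\<close> by (simp add: m1 lookup_add lookup_single when_def)
      then obtain m0 where m0: "m1 = m0 + Poly_Mapping.single (\<phi> (r', c)) 1"
        by (rule monom_split)
      \<comment> \<open>The move: the two factors of \<open>m\<close> exchange their columns, which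
        produces the variable at \<open>(r, c)\<close> shared with \<open>m'\<close>.\<close>
      define n where "n = m0 + (Poly_Mapping.single (\<phi> (r, c)) 1 + Poly_Mapping.single (\<phi> (r', c')) 1)"
      have m: "m = m0 + (Poly_Mapping.single (\<phi> (r, c')) 1 + Poly_Mapping.single (\<phi> (r', c)) 1)"
        by (simp add: m0 m1 add_ac)
      have m0V: "m0 \<in> monoms V"
        using less.prems(1) m monoms_addD by blast
      have "margins m n"
        using margins_exchange[OF D] unfolding m n_def by simp
      then have "margins n m'"
        using less.prems(3) margins_sym margins_trans by blast
      moreover have "n \<in> monoms V"
        using m0V D D_V unfolding n_def by (intro monoms_add monoms_single) auto
      moreover have "0 < Poly_Mapping.lookup n (\<phi> (r, c))"
        by (simp add: n_def lookup_add)
      ultimately have 1: "(term_poly n - term_poly m' :: ('v, 'k) mpoly) \<in> lad"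
        using common[of n "(r, c)"] rc(1,2) by simp
      have "(mn r r' c' c :: ('v, 'k) mpoly) \<in> lad"
        using D by (intro mn_lad) auto
      then have "(term_poly m0 * mn r r' c' c :: ('v, 'k) mpoly) \<in> lad"
        using L(4) polys_single[OF m0V] by blast
      moreover have "term_poly m0 * mn r r' c' c = (term_poly m - term_poly n :: ('v, 'k) mpoly)"
        unfolding m n_def mn_def term_poly_add var_def by (simp add: algebra_simps)
      ultimately have "(term_poly m - term_poly n :: ('v, 'k) mpoly) \<in> lad" by simp
      from L(3)[OF this 1] show ?thesis by simp
    qed
  next
    case False
    then have z': "Poly_Mapping.lookup m' (\<phi> d) = 0" if "d \<in> D" for d
      using that by auto
    have z: "Poly_Mapping.lookup m (\<phi> d) = 0" if "d \<in> D" for d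
    proof (rule ccontr)
      assume "Poly_Mapping.lookup m (\<phi> d) \<noteq> 0"
      then show False
        using row[OF less.prems(3), of "fst d" "snd d"] that z' by auto
    qed
    have "m = m'"
    proof (rule poly_mapping_eqI)
      fix x show "Poly_Mapping.lookup m x = Poly_Mapping.lookup m' x"
        using z z' less.prems(3) by (cases "x \<in> \<phi> ` D") (auto simp: margins_def)
    qed
    then show ?thesis using L(2) by simp
  qed
qed

text \<open>The coefficient, in the image of \<open>p\<close> under the toric parametrization, of
  the image of \<open>m0\<close>. The set \<open>balanced\<close> is therefore the kernel.\<close>

definition fibre_sum :: "('v, 'k::field) mpoly \<Rightarrow> 'v monom \<Rightarrow> 'k" where
  "fibre_sum p m0 = (\<Sum>m | m \<in> Poly_Mapping.keys p \<and> margins m m0. Poly_Mapping.lookup p m)"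

lemma fibre_sum_superset:
  assumes "finite A" "Poly_Mapping.keys p \<subseteq> A"
  shows "fibre_sum p m0 = (\<Sum>m | m \<in> A \<and> margins m m0. Poly_Mapping.lookup p m)"
  unfolding fibre_sum_def using assms
  by (intro sum.mono_neutral_left) (auto simp: in_keys_iff)

lemma fibre_sum_add: "fibre_sum (p + q) m0 = fibre_sum p m0 + fibre_sum q m0"
proof -
  let ?A = "Poly_Mapping.keys p \<union> Poly_Mapping.keys q"
  show ?thesis
    using fibre_sum_superset[of ?A p m0] fibre_sum_superset[of ?A q m0]
      fibre_sum_superset[of ?A "p + q" m0] keys_add[of p q]
    by (simp add: lookup_add sum.distrib)
qed

lemma fibre_sum_zero [simp]: "fibre_sum 0 m0 = 0"
  by (simp add: fibre_sum_def)

lemma fibre_sum_sum: "fibre_sum (\<Sum>i \<in> I. g i) m0 = (\<Sum>i \<in> I. fibre_sum (g i) m0)"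
  by (induction I rule: infinite_finite_induct) (auto simp: fibre_sum_add)

lemma fibre_sum_single: "fibre_sum (Poly_Mapping.single m c) m0 = (if margins m m0 then c else 0)"
proof -
  have "fibre_sum (Poly_Mapping.single m c) m0 =
      (\<Sum>m' | m' \<in> {m} \<and> margins m' m0. Poly_Mapping.lookup (Poly_Mapping.single m c) m')"
    by (rule fibre_sum_superset) auto
  also have "{m'. m' \<in> {m} \<and> margins m' m0} = (if margins m m0 then {m} else {})" by auto
  finally show ?thesis by simp
qed

lemma fibre_sum_single_times:
  "fibre_sum (Poly_Mapping.single a c * p) m0 =
    c * (\<Sum>m | m \<in> Poly_Mapping.keys p \<and> margins (a + m) m0. Poly_Mapping.lookup p m)"
proof -
  have "Poly_Mapping.keys (Poly_Mapping.single a c * p) \<subseteq> (+) a ` Poly_Mapping.keys p"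
    using keys_mult[of "Poly_Mapping.single a c" p] by (auto split: if_splits)
  then have "fibre_sum (Poly_Mapping.single a c * p) m0 =
      (\<Sum>m | m \<in> (+) a ` Poly_Mapping.keys p \<and> margins m m0.
        Poly_Mapping.lookup (Poly_Mapping.single a c * p) m)"
    by (intro fibre_sum_superset) auto
  also have "{m. m \<in> (+) a ` Poly_Mapping.keys p \<and> margins m m0} =
      (+) a ` {m. m \<in> Poly_Mapping.keys p \<and> margins (a + m) m0}" by auto
  also have "(\<Sum>m \<in> \<dots>. Poly_Mapping.lookup (Poly_Mapping.single a c * p) m) =
      (\<Sum>m | m \<in> Poly_Mapping.keys p \<and> margins (a + m) m0. c * Poly_Mapping.lookup p m)"
    by (subst sum.reindex) (auto simp: inj_on_def lookup_single_times)
  finally show ?thesis by (simp add: sum_distrib_left)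
qed

definition balanced :: "('v, 'k::field) mpoly set" where
  "balanced = {p \<in> polys V. \<forall>m0. fibre_sum p m0 = 0}"

lemma ideal_balanced: "ideal balanced (mpoly_ring V)"
proof (rule ideal_mpoly_ringI)
  show "q * p \<in> balanced" if p: "p \<in> balanced" and q: "q \<in> polys V" for p q :: "('v, 'k::field) mpoly"
  proof -
    have "fibre_sum (Poly_Mapping.single a c * p) m0 = 0" for a c m0
    proof (cases "\<exists>m1. margins (a + m1) m0")
      case True
      then obtain m1 where m1: "margins (a + m1) m0" by blast
      \<comment> \<open>Multiplication by a monomial maps fibres into fibres, and by cancellation
        different fibres stay different.\<close>
      have "margins (a + m) m0 \<longleftrightarrow> margins m m1" for m
        using m1 margins_trans margins_sym margins_add_cancel[of a m m1] by blast
      then show ?thesis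
        using p by (simp add: fibre_sum_single_times balanced_def flip: fibre_sum_def)
    next
      case False
      then show ?thesis by (simp add: fibre_sum_single_times)
    qed
    then have "fibre_sum (q * p) m0 = 0" for m0
      by (subst mpoly_sum_terms[of q]) (simp add: sum_distrib_right fibre_sum_sum)
    then show ?thesis
      using p q by (auto simp: balanced_def)
  qed
qed (auto simp: balanced_def fibre_sum_add)

lemma lad_subset_balanced: "(lad :: ('v, 'k::field) mpoly set) \<subseteq> balanced"
proof (rule Idl_mpoly_ring(3)[OF minors_polys ideal_balanced], rule subsetI)
  fix p :: "('v, 'k) mpoly" assume p: "p \<in> minors"
  then obtain r r' c c' where D: "{r, r'} \<times> {c, c'} \<subseteq> D" and eq: "p = mn r r' c c'"
    by (auto simp: minors_def)
  let ?m = "Poly_Mapping.single (\<phi> (r, c)) 1 + Poly_Mapping.single (\<phi> (r', c')) (1::nat)"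
  let ?m' = "Poly_Mapping.single (\<phi> (r, c')) 1 + Poly_Mapping.single (\<phi> (r', c)) (1::nat)"
  have "p = Poly_Mapping.single ?m 1 + Poly_Mapping.single ?m' (- 1)"
    by (simp add: eq mn_def var_def mult_single single_uminus)
  moreover have "margins ?m m0 \<longleftrightarrow> margins ?m' m0" for m0
    using margins_exchange[OF D] margins_trans margins_sym by blast
  ultimately have "fibre_sum p m0 = 0" for m0
    by (simp only: fibre_sum_add fibre_sum_single) simp
  then show "p \<in> balanced"
    using p minors_polys by (auto simp: balanced_def)
qed

text \<open>In a kernel element each term has a partner in its fibre. Subtracting a multiple of the
  difference of the two monomials, which lies in \<open>lad\<close>, removes a term.\<close>

lemma balanced_subset_lad: "(balanced :: ('v, 'k::field) mpoly set) \<subseteq> lad"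
proof
  fix p :: "('v, 'k) mpoly" assume "p \<in> balanced"
  then show "p \<in> lad"
  proof (induction "card (Poly_Mapping.keys p)" arbitrary: p rule: less_induct)
    case less
    note L = ideal_mpoly_ringD[OF ideal_lad]
    note B = ideal_mpoly_ringD[OF ideal_balanced]
    show ?case
    proof (cases "p = 0")
      case True
      then show ?thesis using L(2) by simp
    next
      case False
      then obtain m where m: "m \<in> Poly_Mapping.keys p"
        by (metis ex_in_conv keys_eq_empty)
      have pV: "Poly_Mapping.keys p \<subseteq> monoms V"
        using less.prems by (auto simp: balanced_def polys_iff)
      have "\<exists>m' \<in> Poly_Mapping.keys p. margins m' m \<and> m' \<noteq> m"
      proof (rule ccontr)
        assume "\<not> ?thesis"
        then have "{m'. m' \<in> Poly_Mapping.keys p \<and> margins m' m} = {m}"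
          using m by auto
        then have "fibre_sum p m = Poly_Mapping.lookup p m"
          by (simp add: fibre_sum_def)
        then show False using m less.prems by (auto simp: balanced_def in_keys_iff)
      qed
      then obtain m' where m': "m' \<in> Poly_Mapping.keys p" "margins m' m" "m' \<noteq> m" by blast
      define c where "c = Poly_Mapping.lookup p m"
      define t :: "('v, 'k) mpoly" where "t = Poly_Mapping.single 0 c * (term_poly m - term_poly m')"
      have "(term_poly m - term_poly m' :: ('v, 'k) mpoly) \<in> lad"
        using margins_connected[of m m'] m m' pV margins_sym by blast
      then have t: "t \<in> lad"
        unfolding t_def using L(4) polys_single[OF monoms_zero] by blast
      have teq: "t = Poly_Mapping.single m c - Poly_Mapping.single m' c"
        by (simp add: t_def right_diff_distrib mult_single)
      have "Poly_Mapping.keys (p - t) \<subseteq> Poly_Mapping.keys p - {m}"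
        using m m' by (auto simp: teq c_def in_keys_iff lookup_minus lookup_single when_def split: if_splits)
      then have "card (Poly_Mapping.keys (p - t)) < card (Poly_Mapping.keys p)"
        using m by (intro psubset_card_mono) auto
      moreover have "p - t \<in> balanced"
        using B(6) less.prems t lad_subset_balanced by blast
      ultimately have "p - t \<in> lad"
        using less.hyps by blast
      from L(3)[OF this t] show ?thesis by simp
    qed
  qed
qed

text \<open>A monomial factor \<open>a\<close> carries the fibre of \<open>m0\<close> to that of
  \<open>a + m0\<close> without changing its sum, so membership in the kernel can be tested after
  the multiplication.\<close>

lemma lad_saturated: "sat V (lad :: ('v, 'k::field) mpoly set) \<subseteq> lad"
proof
  fix p :: "('v, 'k) mpoly" assume "p \<in> sat V lad"
  then obtain a where p: "p \<in> polys V" and a: "term_poly a * p \<in> lad"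
    by (auto simp: sat_def)
  have "fibre_sum p m0 = 0" for m0
  proof -
    have "fibre_sum (term_poly a * p) (a + m0) = fibre_sum p m0"
      unfolding fibre_sum_single_times by (simp add: fibre_sum_def)
    then show ?thesis
      using a lad_subset_balanced by (auto simp: balanced_def)
  qed
  then show "p \<in> lad"
    using p balanced_subset_lad by (auto simp: balanced_def)
qed

section \<open>Comparing rows and columns of a ladder\<close>

lemma mn_swap: "mn r r' c c' = - mn r r' c' c" "mn r r' c c' = mn r' r c' c"
  by (simp_all add: mn_def mult.commute)

lemma mn_same [simp]: "mn r r c c' = 0" "mn r r' c c = 0"
  by (simp_all add: mn_def mult.commute)

lemma sat_mn_col_trans:
  assumes "ideal K (mpoly_ring V)" "{r, r'} \<times> {c1, c2, c3} \<subseteq> D"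
    and "mn r r' c1 c2 \<in> sat V K" "mn r r' c2 c3 \<in> sat V K"
  shows "mn r r' c1 c3 \<in> sat V K"
  using sat_minor_trans[OF assms(1), of "\<phi> (r, c1)" "\<phi> (r', c1)" "\<phi> (r, c2)" "\<phi> (r', c2)"
      "\<phi> (r, c3)" "\<phi> (r', c3)"] assms D_V
  by (simp add: mn_def)

lemma sat_mn_row_trans:
  assumes "ideal K (mpoly_ring V)" "{r1, r2, r3} \<times> {c, c'} \<subseteq> D"
    and "mn r1 r2 c c' \<in> sat V K" "mn r2 r3 c c' \<in> sat V K"
  shows "mn r1 r3 c c' \<in> sat V K"
  using sat_minor_trans[OF assms(1), of "\<phi> (r1, c)" "\<phi> (r1, c')" "\<phi> (r2, c)" "\<phi> (r2, c')"
      "\<phi> (r3, c)" "\<phi> (r3, c')"] assms D_V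
  by (simp add: mn_def mult.commute)

lemma sat_mn_uminus:
  assumes "ideal K (mpoly_ring V)" "mn r r' c c' \<in> sat V K"
  shows "mn r r' c' c \<in> sat V K"
  using ideal_mpoly_ringD(5)[OF ideal_sat[OF assms(1)] assms(2)] by (simp add: mn_swap(1)[of r r' c' c])

text \<open>Two kinds of minors suffice, those of a short row with a full row and those of the two
  full rows, since different short rows have no column in common. The premises speak of every ideal
  \<open>K\<close> above \<open>B\<close> because the member of the family that contains
  \<open>B\<close> is only known to exist.\<close>

lemma lad_in_family:
  fixes f :: "('v, 'k::field) mpoly"
  assumes f: "f \<in> polys V" and B: "finite B" "B \<noteq> {}" "B \<subseteq> lad"
    and BK: "\<And>b. b \<in> B \<Longrightarrow> PIdl\<^bsub>mpoly_ring V\<^esub> b \<in> knutson_family (mpoly_ring V) f"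
    and rows: "\<And>K r r' c c'. ideal K (mpoly_ring V) \<Longrightarrow> B \<subseteq> K \<Longrightarrow> 2 \<le> r \<Longrightarrow> r' < 2 \<Longrightarrow>
      {r, r'} \<times> {c, c'} \<subseteq> D \<Longrightarrow> mn r r' c c' \<in> sat V K"
    and cols: "\<And>K c c'. ideal K (mpoly_ring V) \<Longrightarrow> B \<subseteq> K \<Longrightarrow> c \<in> X \<Longrightarrow> c' \<in> X \<Longrightarrow>
      mn 0 1 c c' \<in> sat V K"
  shows "lad \<in> knutson_family (mpoly_ring V) f"
proof -
  have BL: "\<exists>K \<in> knutson_family (mpoly_ring V) f. b \<in> K \<and> K \<subseteq> lad" if "b \<in> B" for b
    using BK[OF that] B(3) that PIdl_self[of b V] PIdl_subset[OF ideal_lad] ideal_mpoly_ringD(1)[OF ideal_lad]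
    by (intro bexI[of _ "PIdl\<^bsub>mpoly_ring V\<^esub> b"] conjI) auto
  obtain K where K: "K \<in> knutson_family (mpoly_ring V) f" "B \<subseteq> K" "K \<subseteq> lad"
    using knutson_family_finite_cover[OF f ideal_lad B(1,2) BL] by blast
  have KI: "ideal K (mpoly_ring V)" using knutson_family_ideal[OF K(1) f] .
  note S = ideal_mpoly_ringD[OF ideal_sat[OF KI]]
  have "mn r r' c c' \<in> sat V K" if D: "{r, r'} \<times> {c, c'} \<subseteq> D" for r r' c c'
  proof -
    consider "r = r'" | "c = c'" | "2 \<le> r" "r' < 2" | "2 \<le> r'" "r < 2" | "r = 0" "r' = 1" | "r = 1" "r' = 0"
      | "2 \<le> r" "2 \<le> r'" "r \<noteq> r'"
      by linarith
    then show ?thesis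
    proof cases
      case 3
      then show ?thesis using rows[OF KI K(2)] D by blast
    next
      case 4
      then have "mn r' r c' c \<in> sat V K"
        using rows[OF KI K(2), of r' r c' c] D by blast
      then show ?thesis by (simp add: mn_swap(2)[of r r'])
    next
      case 5
      then show ?thesis using cols[OF KI K(2), of c c'] D by (auto simp: D_def)
    next
      case 6
      then have "mn r' r c' c \<in> sat V K"
        using cols[OF KI K(2), of c' c] D by (auto simp: D_def)
      then show ?thesis by (simp add: mn_swap(2)[of r r'])
    next
      case 7
      then show ?thesis using D Z(3) by (auto simp: D_def)
    qed (use S(2) in simp_all)
  qed
  then have "minors \<subseteq> sat V K"
    unfolding minors_def by blast
  then show ?thesis
    using knutson_family_saturated[OF f K(1) finite_minors _ K(3) lad_saturated] by blast
qed

end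

section \<open>Geometry of cells\<close>

text \<open>The Boolean \<open>t\<close> selects the direction: \<open>co t\<close> is the coordinate along it and \<open>ac t\<close> the one
  across.\<close>

definition co :: "bool \<Rightarrow> vertex \<Rightarrow> nat" where "co t v = (if t then snd v else fst v)"
definition ac :: "bool \<Rightarrow> vertex \<Rightarrow> nat" where "ac t v = (if t then fst v else snd v)"
definition mk :: "bool \<Rightarrow> nat \<Rightarrow> nat \<Rightarrow> vertex" where "mk t c r = (if t then (r, c) else (c, r))"

lemma co_ac_mk [simp]: "co t (mk t c r) = c" "ac t (mk t c r) = r" "mk t (co t v) (ac t v) = v"
  by (auto simp: co_def ac_def mk_def)

lemma mk_inject [simp]: "mk t c r = mk t c' r' \<longleftrightarrow> c = c' \<and> r = r'"
  by (auto simp: mk_def)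

lemma vertex_eq_iff: "v = w \<longleftrightarrow> co t v = co t w \<and> ac t v = ac t w"
  by (auto simp: co_def ac_def prod_eq_iff)

lemma cell_iff: "v \<in> cell a \<longleftrightarrow> (co t v = co t a \<or> co t v = co t a + 1) \<and> (ac t v = ac t a \<or> ac t v = ac t a + 1)"
  by (cases v) (auto simp: cell_def interval_def co_def ac_def)

lemma cell_iff_fst_snd:
  "v \<in> cell a \<longleftrightarrow> (fst v = fst a \<or> fst v = fst a + 1) \<and> (snd v = snd a \<or> snd v = snd a + 1)"
  using cell_iff[of v a False] by (simp add: co_def ac_def)

lemma self_in_cell [simp]: "a \<in> cell a"
  by (simp add: cell_iff_fst_snd)

lemma cell_inject [simp]: "cell a = cell b \<longleftrightarrow> a = b"
proof
  assume "cell a = cell b"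
  then have "a \<in> cell b" "b \<in> cell a"
    using self_in_cell[of a] self_in_cell[of b] by simp_all
  moreover have "(fst a + 1, snd a + 1) \<in> cell b" "(fst b + 1, snd b + 1) \<in> cell a"
    using \<open>cell a = cell b\<close> cell_iff_fst_snd[of "(fst a + 1, snd a + 1)" a]
      cell_iff_fst_snd[of "(fst b + 1, snd b + 1)" b] by simp_all
  ultimately show "a = b"
    unfolding cell_iff_fst_snd prod_eq_iff by simp linarith
qed simp

definition adj :: "vertex \<Rightarrow> vertex \<Rightarrow> bool" where
  "adj a b \<longleftrightarrow> fst a = fst b \<and> (snd a = snd b + 1 \<or> snd b = snd a + 1) \<or>
    snd a = snd b \<and> (fst a = fst b + 1 \<or> fst b = fst a + 1)"

lemma adj_iff: "adj a b \<longleftrightarrow> co t a = co t b \<and> (ac t a = ac t b + 1 \<or> ac t b = ac t a + 1) \<or>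
    ac t a = ac t b \<and> (co t a = co t b + 1 \<or> co t b = co t a + 1)"
  by (auto simp: adj_def co_def ac_def)

lemma adj_sym: "adj a b \<Longrightarrow> adj b a"
  by (auto simp: adj_def)

lemma adj_cases:
  assumes "adj p q"
  obtains t where "ac t p = ac t q" "co t q = co t p + 1" | t where "ac t p = ac t q" "co t p = co t q + 1"
proof -
  consider "fst p = fst q" "snd q = snd p + 1" | "fst p = fst q" "snd p = snd q + 1"
    | "snd p = snd q" "fst q = fst p + 1" | "snd p = snd q" "fst p = fst q + 1"
    using assms by (auto simp: adj_def)
  then show ?thesis
    using that(1)[of True] that(2)[of True] that(1)[of False] that(2)[of False]
    by cases (simp_all add: co_def ac_def)
qed

text \<open>\<open>shift p q u\<close> is the projection of a vertex \<open>u\<close> of the cell at \<open>p\<close> to the edge by which the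
  adjacent cell at \<open>q\<close> extends it; \<open>across p q u\<close> is the other vertex of that edge.\<close>

definition shift :: "vertex \<Rightarrow> vertex \<Rightarrow> vertex \<Rightarrow> vertex" where
  "shift p q u = (if fst p = fst q then (fst u, if snd p < snd q then snd q + 1 else snd q)
     else (if fst p < fst q then fst q + 1 else fst q, snd u))"

definition across :: "vertex \<Rightarrow> vertex \<Rightarrow> vertex \<Rightarrow> vertex" where
  "across p q u = (if fst p = fst q then (2 * fst q + 1 - fst u, if snd p < snd q then snd q + 1 else snd q)
     else (if fst p < fst q then fst q + 1 else fst q, 2 * snd q + 1 - snd u))"

lemma shift_along:
  assumes "adj p q" "ac t p = ac t q"
  shows "shift p q u = mk t (if co t p < co t q then co t q + 1 else co t q) (ac t u)"
    "across p q u = mk t (if co t p < co t q then co t q + 1 else co t q) (2 * ac t q + 1 - ac t u)"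
  using assms by (auto simp: shift_def across_def adj_def co_def ac_def mk_def)

lemma shift_new:
  assumes "adj p q" "u \<in> cell p"
  shows "shift p q u \<in> cell q - cell p" "across p q u \<in> cell q - cell p" "shift p q u \<noteq> across p q u"
proof -
  have "shift p q u \<in> cell q - cell p \<and> across p q u \<in> cell q - cell p \<and> shift p q u \<noteq> across p q u"
    using assms(1)
  proof (cases rule: adj_cases)
    case (1 t)
    then show ?thesis
      using assms(2) by (auto simp: shift_along[OF assms(1), of t] cell_iff[of _ _ t])
  next
    case (2 t)
    then show ?thesis
      using assms(2) by (auto simp: shift_along[OF assms(1), of t] cell_iff[of _ _ t])
  qed
  then show "shift p q u \<in> cell q - cell p" "across p q u \<in> cell q - cell p" "shift p q u \<noteq> across p q u"
    by blast+
qed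

lemma corners_mk:
  "{(fst v, snd w), (fst w, snd v)} = {mk t (co t v) (ac t w), mk t (co t w) (ac t v)}"
  by (auto simp: mk_def co_def ac_def)

text \<open>These are the other corners of the rectangle with diagonal from \<open>u\<close> to
  \<open>across p q u\<close>; the corner \<open>z\<close> shares with \<open>u\<close> the edge
  across the step. If \<open>u\<close> lies on the common edge, the rectangle is the cell at
  \<open>q\<close>, otherwise it consists of both cells.\<close>

lemma minor_corners:
  assumes "adj p q" "u \<in> cell p"
  shows "\<exists>z. z \<in> cell p \<and> z \<noteq> u \<and> (u \<in> cell q \<longrightarrow> z \<in> cell q) \<and>
    {(fst u, snd (across p q u)), (fst (across p q u), snd u)} = {shift p q u, z}"
  using assms(1)
proof (cases rule: adj_cases)
  case (1 t)
  then show ?thesis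
    using assms(2) unfolding corners_mk[of _ _ t]
    by (intro exI[of _ "mk t (co t u) (2 * ac t q + 1 - ac t u)"])
      (auto simp: shift_along[OF assms(1), of t] cell_iff[of _ _ t] vertex_eq_iff[of _ u t])
next
  case (2 t)
  then show ?thesis
    using assms(2) unfolding corners_mk[of _ _ t]
    by (intro exI[of _ "mk t (co t u) (2 * ac t q + 1 - ac t u)"])
      (auto simp: shift_along[OF assms(1), of t] cell_iff[of _ _ t] vertex_eq_iff[of _ u t])
qed

lemma adj_cases4:
  assumes "adj p q"
  obtains "ac t q = ac t p" "co t q = co t p + 1" | "ac t q = ac t p" "co t p = co t q + 1"
    | "co t q = co t p" "ac t q = ac t p + 1" | "co t q = co t p" "ac t p = ac t q + 1"
  using assms unfolding adj_iff[of _ _ t] by linarith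

lemma shift_across:
  assumes "adj p q" "co t p = co t q"
  shows "shift p q u = mk t (co t u) (if ac t p < ac t q then ac t q + 1 else ac t q)"
  using assms by (auto simp: shift_def adj_def co_def ac_def mk_def)

text \<open>Three cells in line have disjoint outer cells, and the outer cells of a bend share only
  its inner corner, a vertex of the middle cell.\<close>

lemma cells_two_apart:
  assumes "adj p q" "adj q r" "p \<noteq> r"
  shows "cell p \<inter> cell r \<subseteq> cell q"
proof
  fix v assume v: "v \<in> cell p \<inter> cell r"
  show "v \<in> cell q"
    using assms(1)
  proof (cases rule: adj_cases)
    case (1 t)
    show ?thesis
      using assms(2) by (cases rule: adj_cases4[of _ _ t])
        (use v assms(3) 1 in \<open>auto simp: cell_iff[of _ _ t] vertex_eq_iff[of p r t]\<close>)
  next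
    case (2 t)
    show ?thesis
      using assms(2) by (cases rule: adj_cases4[of _ _ t])
        (use v assms(3) 2 in \<open>auto simp: cell_iff[of _ _ t] vertex_eq_iff[of p r t]\<close>)
  qed
qed

text \<open>Otherwise the path would turn the same way at two consecutive corners and touch itself.\<close>

lemma shift_stays:
  assumes pq: "adj p q" and qr: "adj q r" and rs: "adj r s" and ne: "p \<noteq> r" "q \<noteq> s"
    and disj: "cell p \<inter> cell s = {}" and u: "u \<in> cell q" "u \<notin> cell p" "u \<notin> cell r"
  shows "shift q r u \<in> cell s"
proof -
  have far: "\<not> (co t p = co t s \<and> (ac t s = ac t p + 1 \<or> ac t p = ac t s + 1))" for t
  proof
    assume t: "co t p = co t s \<and> (ac t s = ac t p + 1 \<or> ac t p = ac t s + 1)"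
    have "mk t (co t p) (max (ac t p) (ac t s)) \<in> cell p \<inter> cell s"
      using t by (auto simp: cell_iff[of _ _ t])
    then show False using disj by blast
  qed
  have main: ?thesis if pq': "ac t q = ac t p" "co t q = co t p + 1 \<or> co t p = co t q + 1" for t
  proof -
    have cu: "co t u = (if co t p < co t q then co t q + 1 else co t q)"
      using u(1,2) pq' by (auto simp: cell_iff[of _ _ t])
    \<comment> \<open>A straight continuation would keep \<open>u\<close> in the cell at
      \<open>r\<close>, so the path turns at \<open>q\<close>.\<close>
    have cr: "co t q = co t r"
    proof (rule ccontr)
      assume "co t q \<noteq> co t r"
      then have "ac t r = ac t q" "co t r = co t q + 1 \<or> co t q = co t r + 1"
        using qr unfolding adj_iff[of q r t] by auto
      then show False
        using pq' u ne(1) cu unfolding vertex_eq_iff[of p r t] by (auto simp: cell_iff[of _ _ t] split: if_splits)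
    qed
    have ar: "ac t r = ac t q + 1 \<or> ac t q = ac t r + 1"
      using qr cr unfolding adj_iff[of q r t] by auto
    have sh: "shift q r u = mk t (co t u) (if ac t q < ac t r then ac t r + 1 else ac t r)"
      by (rule shift_across[OF qr cr])
    show ?thesis
      using rs
    proof (cases rule: adj_cases4[of _ _ t])
      case 1
      then show ?thesis
        using far[of t] pq' cu cr ar sh by (auto simp: cell_iff[of _ _ t])
    next
      case 2
      then show ?thesis
        using far[of t] pq' cu cr ar sh by (auto simp: cell_iff[of _ _ t])
    next
      case 3
      then show ?thesis
        using ne(2) pq' cu cr ar sh unfolding vertex_eq_iff[of q s t] by (auto simp: cell_iff[of _ _ t])
    next
      case 4
      then show ?thesis
        using ne(2) pq' cu cr ar sh unfolding vertex_eq_iff[of q s t] by (auto simp: cell_iff[of _ _ t])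
    qed
  qed
  show ?thesis
    using pq
  proof (cases rule: adj_cases)
    case (1 t)
    then show ?thesis using main[of t] by simp
  next
    case (2 t)
    then show ?thesis using main[of t] by simp
  qed
qed

definition inline :: "vertex \<Rightarrow> vertex \<Rightarrow> vertex \<Rightarrow> bool" where
  "inline p q r \<longleftrightarrow> fst p = fst q \<and> fst q = fst r \<or> snd p = snd q \<and> snd q = snd r"

lemma inline_iff: "inline p q r \<longleftrightarrow> co t p = co t q \<and> co t q = co t r \<or> ac t p = ac t q \<and> ac t q = ac t r"
  by (auto simp: inline_def co_def ac_def)

lemma inline_disjoint:
  assumes "adj p q" "adj q r" "p \<noteq> r" "inline p q r"
  shows "cell p \<inter> cell r = {}"
proof (rule equals0I)
  fix v assume v: "v \<in> cell p \<inter> cell r"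
  show False
    using assms(1)
  proof (cases rule: adj_cases)
    case (1 t)
    show ?thesis
      using assms(2) by (cases rule: adj_cases4[of _ _ t])
        (use v assms(3,4) 1 in \<open>auto simp: cell_iff[of _ _ t] vertex_eq_iff[of p r t] inline_iff[of _ _ _ t]\<close>)
  next
    case (2 t)
    show ?thesis
      using assms(2) by (cases rule: adj_cases4[of _ _ t])
        (use v assms(3,4) 2 in \<open>auto simp: cell_iff[of _ _ t] vertex_eq_iff[of p r t] inline_iff[of _ _ _ t]\<close>)
  qed
qed

text \<open>The vertices of the cell at \<open>q\<close> outside that at \<open>p\<close> form the
  edge through which a straight path goes on.\<close>

lemma inline_stays:
  assumes "adj p q" "adj q r" "p \<noteq> r" "inline p q r" "u \<in> cell q - cell p"
  shows "u \<in> cell r"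
  using assms(1)
proof (cases rule: adj_cases)
  case (1 t)
  show ?thesis
    using assms(2) by (cases rule: adj_cases4[of _ _ t])
      (use assms(3-5) 1 in \<open>auto simp: cell_iff[of _ _ t] vertex_eq_iff[of p r t] inline_iff[of _ _ _ t]\<close>)
next
  case (2 t)
  show ?thesis
    using assms(2) by (cases rule: adj_cases4[of _ _ t])
      (use assms(3-5) 2 in \<open>auto simp: cell_iff[of _ _ t] vertex_eq_iff[of p r t] inline_iff[of _ _ _ t]\<close>)
qed

text \<open>The two candidates lie on the edge facing away from \<open>p\<close>, so they differ
  only in the direction in which the path leaves the corner, and projecting along this direction
  identifies them. A corner thus erases the memory of the sequence of left over vertices.\<close>

lemma corner_shift_unique:
  assumes "adj p q" "adj q r" "\<not> inline p q r" "u \<in> cell q - cell p" "u' \<in> cell q - cell p"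
  shows "shift q r u = shift q r u'"
  using assms(1)
proof (cases rule: adj_cases)
  case (1 t)
  then have "co t q = co t r"
    using assms(2,3) by (auto simp: adj_iff[of q r t] inline_iff[of _ _ _ t])
  then show ?thesis
    using assms(4,5) 1 by (auto simp: shift_across[OF assms(2)] cell_iff[of _ _ t])
next
  case (2 t)
  then have "co t q = co t r"
    using assms(2,3) by (auto simp: adj_iff[of q r t] inline_iff[of _ _ _ t])
  then show ?thesis
    using assms(4,5) 2 by (auto simp: shift_across[OF assms(2)] cell_iff[of _ _ t])
qed

section \<open>Polyomino ideals\<close>

lemma minor_commute: "minor a b = minor b a"
  by (simp add: minor_def mult.commute)

lemma minor_antidiagonal: "minor (fst a, snd b) (fst b, snd a) = - minor a b"
  by (simp add: minor_def)

lemma minor_mk: "minor (mk t c r) (mk t c' r') =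
    var (mk t c r) * var (mk t c' r') - var (mk t c r') * var (mk t c' r)"
  by (auto simp: minor_def mk_def mult.commute)

lemma minor_mk_swap: "minor (mk t c r') (mk t c' r) = - minor (mk t c r) (mk t c' r')"
  by (simp add: minor_mk)

lemma minor_line [simp]: "fst a = fst b \<Longrightarrow> minor a b = 0" "snd a = snd b \<Longrightarrow> minor a b = 0"
  by (cases a; cases b; simp add: minor_def mult.commute)+

lemma PIdl_uminus: "PIdl\<^bsub>mpoly_ring V\<^esub> (- g) = PIdl\<^bsub>mpoly_ring V\<^esub> g"
  unfolding PIdl_mpoly_ring
  by (auto intro: exI[of _ "- x" for x])

lemma polyomino_ideal_eq:
  "polyomino_ideal P = Idl\<^bsub>mpoly_ring (vertices P)\<^esub> {minor a b | a b. inner_interval P a b}"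
  by (simp add: polyomino_ideal_def minor_def)

lemma inner_interval_cells:
  assumes "inner_interval (cell ` Q) a b" "fst a \<le> fst c" "fst c < fst b" "snd a \<le> snd c" "snd c < snd b"
  shows "c \<in> Q"
proof -
  have "cell c \<subseteq> interval a b"
    using assms(2-) by (auto simp: cell_iff_fst_snd interval_def)
  then have "cell c \<in> cell ` Q"
    using assms(1) unfolding inner_interval_def by blast
  then show ?thesis by auto
qed

lemma inner_intervalI:
  assumes "fst a < fst b" "snd a < snd b"
    and Q: "\<And>c. fst a \<le> fst c \<Longrightarrow> fst c < fst b \<Longrightarrow> snd a \<le> snd c \<Longrightarrow> snd c < snd b \<Longrightarrow> c \<in> Q"
  shows "inner_interval (cell ` Q) a b"
  unfolding inner_interval_def
proof (intro conjI allI impI)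
  show "proper_interval a b"
    using assms by (simp add: proper_interval_def)
  have "a \<in> Q" using assms(1,2) by (intro Q) auto
  then show "a \<in> vertices (cell ` Q)"
    by (auto simp: vertices_def intro: bexI[of _ a])
  let ?b = "(fst b - 1, snd b - 1)"
  have "?b \<in> Q" using assms(1,2) by (intro Q) auto
  moreover have "b \<in> cell ?b" using assms(1,2) by (auto simp: cell_iff_fst_snd)
  ultimately show "b \<in> vertices (cell ` Q)"
    by (auto simp: vertices_def)
  fix c assume "cell c \<subseteq> interval a b"
  moreover have "(fst c + 1, snd c + 1) \<in> cell c"
    by (simp add: cell_iff_fst_snd)
  ultimately have "c \<in> interval a b" "(fst c + 1, snd c + 1) \<in> interval a b"
    using self_in_cell[of c] by blast+
  then show "cell c \<in> cell ` Q"
    using Q[of c] by (auto simp: interval_def)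
qed

lemma inner_interval_corners:
  assumes "inner_interval (cell ` Q) a b"
  shows "{a, b, (fst a, snd b), (fst b, snd a)} \<subseteq> vertices (cell ` Q)"
proof -
  have ab: "fst a < fst b" "snd a < snd b" "a \<in> vertices (cell ` Q)" "b \<in> vertices (cell ` Q)"
    using assms by (auto simp: inner_interval_def proper_interval_def)
  have "(fst a, snd b - 1) \<in> Q" "(fst b - 1, snd a) \<in> Q"
    using ab by (auto intro: inner_interval_cells[OF assms])
  moreover have "(fst a, snd b) \<in> cell (fst a, snd b - 1)" "(fst b, snd a) \<in> cell (fst b - 1, snd a)"
    using ab by (auto simp: cell_iff_fst_snd)
  ultimately show ?thesis using ab by (auto simp: vertices_def)
qed

lemma inner_minors_polys:
  "{minor a b | a b. inner_interval (cell ` Q) a b} \<subseteq> polys (vertices (cell ` Q))"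
  using minor_polys[OF inner_interval_corners] by blast

lemma ideal_polyomino_ideal:
  "ideal (polyomino_ideal (cell ` Q)) (mpoly_ring (vertices (cell ` Q)))"
  unfolding polyomino_ideal_eq by (rule Idl_mpoly_ring(1)[OF inner_minors_polys])

text \<open>The points may be opposite corners of either diagonal and come in any order, which
  affects only the sign; on a common line the minor is 0. The parameter \<open>t\<close> lets the
  rectangle be described in coordinates along and across a run.\<close>

lemma minor_in_polyomino_ideal:
  assumes Q: "\<And>c. min (co t x) (co t y) \<le> co t c \<Longrightarrow> co t c < max (co t x) (co t y) \<Longrightarrow>
    min (ac t x) (ac t y) \<le> ac t c \<Longrightarrow> ac t c < max (ac t x) (ac t y) \<Longrightarrow> c \<in> Q"
  shows "(minor x y :: (vertex, 'k::field) mpoly) \<in> polyomino_ideal (cell ` Q)"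
proof -
  let ?I = "polyomino_ideal (cell ` Q) :: (vertex, 'k) mpoly set"
  note I = ideal_mpoly_ringD[OF ideal_polyomino_ideal[of Q]]
  have Q': "c \<in> Q" if "min (fst x) (fst y) \<le> fst c" "fst c < max (fst x) (fst y)"
    "min (snd x) (snd y) \<le> snd c" "snd c < max (snd x) (snd y)" for c
    using Q[of c] that by (cases t) (auto simp: co_def ac_def)
  let ?a = "(min (fst x) (fst y), min (snd x) (snd y))"
  let ?b = "(max (fst x) (fst y), max (snd x) (snd y))"
  show ?thesis
  proof (cases "fst x = fst y \<or> snd x = snd y")
    case True
    then show ?thesis using I(2) by auto
  next
    case False
    have "inner_interval (cell ` Q) ?a ?b"
      using False Q' by (intro inner_intervalI) auto
    then have ab: "minor ?a ?b \<in> ?I"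
      unfolding polyomino_ideal_eq using Idl_mpoly_ring(2)[OF inner_minors_polys] by blast
    have "(minor x y :: (vertex, 'k) mpoly) = minor ?a ?b \<or> (minor x y :: (vertex, 'k) mpoly) = - minor ?a ?b"
      by (cases "fst x < fst y"; cases "snd x < snd y") (auto simp: min_def max_def minor_def mult.commute)
    then show ?thesis using ab I(5) by auto
  qed
qed

section \<open>Straight runs of cells\<close>

text \<open>A discrete intermediate value theorem.\<close>

lemma int_steps_intermediate:
  fixes g :: "int \<Rightarrow> nat"
  assumes "a \<le> j" and "\<And>k. a < k \<Longrightarrow> k \<le> j \<Longrightarrow> g k \<le> g (k - 1) + 1 \<and> g (k - 1) \<le> g k + 1"
    and "k1 \<in> {a..j}" "k2 \<in> {a..j}" "g k1 \<le> x" "x \<le> g k2"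
  shows "\<exists>i \<in> {a..j}. g i = x"
  using assms
proof (induction j arbitrary: k1 k2 rule: int_ge_induct)
  case base
  then have "k1 = a" "k2 = a" by auto
  then show ?case using base.prems by (intro bexI[of _ a]) auto
next
  case (step j)
  have IH: "\<exists>i \<in> {a..j + 1}. g i = x" if "k1 \<in> {a..j}" "k2 \<in> {a..j}" "g k1 \<le> x" "x \<le> g k2" for k1 k2
    using step.IH[of k1 k2] step.prems(1) that by force
  have s: "g (j + 1) \<le> g j + 1" "g j \<le> g (j + 1) + 1"
    using step.prems(1)[of "j + 1"] step.hyps by auto
  show ?case
  proof (cases "g (j + 1) = x")
    case True
    then show ?thesis using step.hyps by (intro bexI[of _ "j + 1"]) auto
  next
    case False
    have "k1 \<in> {a..j} \<or> k1 = j + 1" "k2 \<in> {a..j} \<or> k2 = j + 1"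
      using step.prems(2,3) by auto
    moreover have "g j \<le> x" if "k1 = j + 1"
      using that False s step.prems(4) by auto
    moreover have "x \<le> g j" if "k2 = j + 1"
      using that False s step.prems(5) by auto
    moreover have "j \<in> {a..j}" using step.hyps by auto
    ultimately show ?thesis
      using IH[of k1 k2] IH[of j k2] IH[of k1 j] IH[of j j] step.prems(4,5) by blast
  qed
qed

locale board =
  fixes Q :: "vertex set" and f :: "(vertex, 'k::field) mpoly"
  assumes finite_Q: "finite Q" and f: "f \<in> polys (vertices (cell ` Q))"
begin

abbreviation V :: "vertex set" where "V \<equiv> vertices (cell ` Q)"

abbreviation I :: "(vertex, 'k) mpoly set" where "I \<equiv> polyomino_ideal (cell ` Q)"

abbreviation family :: "(vertex, 'k) mpoly set set" where
  "family \<equiv> knutson_family (mpoly_ring V) f"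

definition avail :: "vertex \<Rightarrow> vertex \<Rightarrow> bool" where
  "avail x y \<longleftrightarrow> PIdl\<^bsub>mpoly_ring V\<^esub> (minor x y) \<in> family"

lemma avail_sym: "avail x y \<longleftrightarrow> avail y x"
  by (simp add: avail_def minor_commute)

lemma avail_mk_swap: "avail (mk t c r) (mk t c' r') \<longleftrightarrow> avail (mk t c r') (mk t c' r)"
  by (simp add: avail_def minor_mk_swap[of t c r' c' r] PIdl_uminus)

lemma V_I: "v \<in> cell q \<Longrightarrow> q \<in> Q \<Longrightarrow> v \<in> V"
  by (auto simp: vertices_def)

definition cols :: "bool \<Rightarrow> vertex \<Rightarrow> nat set" where
  "cols t q = {co t q, co t q + 1}"

lemma cell_cols: "v \<in> cell q \<Longrightarrow> co t v \<in> cols t q"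
  by (auto simp: cell_iff[of _ _ t] cols_def)

text \<open>The row \<open>e\<close> extends the cell at \<open>q\<close> by two vertices whose minors with the rows of the cell
  generate ideals of the family.\<close>

definition apexed :: "bool \<Rightarrow> vertex \<Rightarrow> nat \<Rightarrow> bool" where
  "apexed t q e \<longleftrightarrow> e \<noteq> ac t q \<and> e \<noteq> ac t q + 1 \<and>
    (\<forall>c \<in> cols t q. \<forall>c' \<in> cols t q. \<forall>\<rho> \<in> {ac t q, ac t q + 1}.
      mk t c e \<in> V \<and> minor (mk t c e) (mk t c' \<rho>) \<in> I \<and>
      (c \<noteq> c' \<longrightarrow> avail (mk t c e) (mk t c' \<rho>)))"

text \<open>The run is read as a ladder whose full rows are \<open>r\<close> and
  \<open>r + 1\<close>. One short row, \<open>r2\<close>, lies over the first cell and comes from a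
  turn; the other, \<open>r3\<close>, lies over the cell that carries an attached cell. By
  \<open>seed\<close> the two columns of the first cell can be compared, and by \<open>av\<close>
  each further column can be compared with an earlier one.\<close>

lemma run_minors:
  fixes p u :: "int \<Rightarrow> vertex"
  assumes aj: "a \<le> j" and row: "\<And>k. k \<in> {a..j} \<Longrightarrow> ac t (p k) = r"
    and pQ: "\<And>k. k \<in> {a..j} \<Longrightarrow> p k \<in> Q"
    and adj: "\<And>k. k \<in> {a<..j} \<Longrightarrow> adj (p (k - 1)) (p k)"
    and u: "\<And>k. k \<in> {a..j} \<Longrightarrow> u k \<in> cell (p k)"
    and step: "\<And>k. k \<in> {a<..j} \<Longrightarrow> u k = shift (p (k - 1)) (p k) (u (k - 1))"
    and av: "\<And>k. k \<in> {a<..j} \<Longrightarrow>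
      avail (u (k - 1)) (across (p (k - 1)) (p k) (u (k - 1))) \<or> Z3 = cols t (p k)"
    and Z2: "Z2 = {} \<or> Z2 = cols t (p a) \<and> apexed t (p a) r2"
    and Z3: "Z3 = {} \<or> (\<exists>s \<in> {a..j}. Z3 = cols t (p s) \<and> apexed t (p s) r3)"
    and Z23: "Z2 \<inter> Z3 = {}"
    and seed: "Z2 \<noteq> {} \<or> Z3 = cols t (p a) \<or> avail (mk t (co t (p a)) r) (mk t (co t (p a) + 1) (r + 1))"
  shows "\<exists>K \<in> family. K \<subseteq> I \<and>
    (\<forall>x \<in> (\<Union>k \<in> {a..j}. cell (p k)). \<forall>y \<in> (\<Union>k \<in> {a..j}. cell (p k)). minor x y \<in> K) \<and>
    (\<forall>c \<in> Z3. \<forall>c' \<in> Z3. \<forall>e \<in> {r, r + 1, r3}. \<forall>e' \<in> {r, r + 1, r3}. minor (mk t c e) (mk t c' e') \<in> K)"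
proof -
  define X where "X = (\<Union>k \<in> {a..j}. cols t (p k))"
  define rw where "rw = (\<lambda>\<rho>::nat. if \<rho> = 0 then r else if \<rho> = 1 then r + 1 else if \<rho> = 2 then r2 else r3)"
  define \<phi> where "\<phi> = (\<lambda>(\<rho>, c). mk t c (rw \<rho>))"
  have aa: "a \<in> {a..j}" using aj by simp
  have Z2X: "Z2 \<subseteq> X" and Z3X: "Z3 \<subseteq> X"
    using Z2 Z3 aa unfolding X_def by blast+
  have r2: "r2 \<noteq> r" "r2 \<noteq> r + 1" if "Z2 \<noteq> {}"
    using Z2 that row[of a] aj by (auto simp: apexed_def)
  have r3: "r3 \<noteq> r" "r3 \<noteq> r + 1" if "Z3 \<noteq> {}"
    using Z3 that row by (auto simp: apexed_def)
  have XV: "mk t c e \<in> V" if c: "c \<in> X" and e: "e \<in> {r, r + 1}" for c e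
  proof -
    obtain k where k: "k \<in> {a..j}" "c \<in> cols t (p k)" using c by (auto simp: X_def)
    have "mk t c e \<in> cell (p k)"
      using k e row[OF k(1)] by (auto simp: cell_iff[of _ _ t] cols_def)
    then show ?thesis using V_I pQ[OF k(1)] by blast
  qed
  have Z2V: "mk t c r2 \<in> V" if "c \<in> Z2" for c
    using Z2 that by (auto simp: apexed_def)
  have Z3V: "mk t c r3 \<in> V" if "c \<in> Z3" for c
    using Z3 that by (auto simp: apexed_def)
  interpret L: ladder V \<phi> X Z2 Z3
  proof
    show "finite X" unfolding X_def cols_def by auto
    show "inj_on \<phi> ({0, 1} \<times> X \<union> {2} \<times> Z2 \<union> {3} \<times> Z3)"
    proof (rule inj_onI)
      fix d d' assume d: "d \<in> {0, 1} \<times> X \<union> {2} \<times> Z2 \<union> {3} \<times> Z3"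
        "d' \<in> {0, 1} \<times> X \<union> {2} \<times> Z2 \<union> {3} \<times> Z3" and eq: "\<phi> d = \<phi> d'"
      have "snd d = snd d'" "rw (fst d) = rw (fst d')"
        using eq by (auto simp: \<phi>_def case_prod_unfold)
      then show "d = d'"
        using d r2 r3 Z23 by (cases "Z2 = {}"; cases "Z3 = {}") (auto simp: rw_def)
    qed
    show "\<phi> ` ({0, 1} \<times> X \<union> {2} \<times> Z2 \<union> {3} \<times> Z3) \<subseteq> V"
      using XV Z2V Z3V by (auto simp: \<phi>_def rw_def)
  qed (use Z2X Z3X Z23 in auto)
  have L_D: "(\<rho>, c) \<in> L.D \<longleftrightarrow> \<rho> < 2 \<and> c \<in> X \<or> \<rho> = 2 \<and> c \<in> Z2 \<or> \<rho> = 3 \<and> c \<in> Z3" for \<rho> c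
    unfolding L.D_def by auto
  have Z2a: "co t (p a) \<in> Z2" "co t (p a) + 1 \<in> Z2" if "Z2 \<noteq> {}"
    using Z2 that by (auto simp: cols_def)
  have Z3a: "co t (p a) \<in> Z3" "co t (p a) + 1 \<in> Z3" if "Z3 = cols t (p a)"
    using that by (auto simp: cols_def)
  have mn: "(L.mn \<rho> \<rho>' c c' :: (vertex, 'k) mpoly) = minor (mk t c (rw \<rho>)) (mk t c' (rw \<rho>'))"
    for \<rho> \<rho>' c c'
    unfolding L.mn_def minor_mk by (simp add: \<phi>_def)
  define B where "B = {b \<in> L.minors. PIdl\<^bsub>mpoly_ring V\<^esub> b \<in> family}"
  have inB: "L.mn \<rho> \<rho>' c c' \<in> B"
    if "{\<rho>, \<rho>'} \<times> {c, c'} \<subseteq> L.D" "avail (mk t c (rw \<rho>)) (mk t c' (rw \<rho>'))" for \<rho> \<rho>' c c'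
    using that unfolding B_def L.minors_def avail_def by (auto simp: mn)
  have rowsB: "L.mn \<rho> \<rho>' c c' \<in> B"
    if asm: "2 \<le> \<rho>" "\<rho>' < 2" "{\<rho>, \<rho>'} \<times> {c, c'} \<subseteq> L.D" "c \<noteq> c'" for \<rho> \<rho>' c c'
  proof (rule inB)
    have r': "rw \<rho>' \<in> {r, r + 1}" using asm(2) by (auto simp: rw_def)
    consider "\<rho> = 2" "c \<in> Z2" "c' \<in> Z2" | "\<rho> = 3" "c \<in> Z3" "c' \<in> Z3"
      using asm(1,3) by (auto simp: L_D)
    then show "avail (mk t c (rw \<rho>)) (mk t c' (rw \<rho>'))"
    proof cases
      case 1
      then have "rw \<rho> = r2" by (simp add: rw_def)
      then show ?thesis
        using 1 Z2 r' asm(4) row[of a] aj unfolding apexed_def by auto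
    next
      case 2
      then have "rw \<rho> = r3" by (simp add: rw_def)
      then show ?thesis
        using 2 Z3 r' asm(4) row unfolding apexed_def by auto
    qed
  qed (use asm in blast)
  have ca: "co t (p a) \<in> X" "co t (p a) + 1 \<in> X"
    using aa unfolding X_def cols_def by blast+
  have famL: "L.lad \<in> family"
  proof (rule L.lad_in_family[OF f])
    show "finite B" unfolding B_def using L.finite_minors by auto
    show "B \<subseteq> L.lad" unfolding B_def using Idl_mpoly_ring(2)[OF L.minors_polys] by auto
    show "PIdl\<^bsub>mpoly_ring V\<^esub> b \<in> family" if "b \<in> B" for b
      using that by (simp add: B_def)
    have "L.mn 2 0 (co t (p a)) (co t (p a) + 1) \<in> B" if "Z2 \<noteq> {}"
      using Z2a[OF that] ca by (intro rowsB) (auto simp: L_D)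
    moreover have "L.mn 3 0 (co t (p a)) (co t (p a) + 1) \<in> B" if "Z3 = cols t (p a)"
      using Z3a[OF that] ca by (intro rowsB) (auto simp: L_D)
    moreover have "L.mn 0 1 (co t (p a)) (co t (p a) + 1) \<in> B"
      if "avail (mk t (co t (p a)) r) (mk t (co t (p a) + 1) (r + 1))"
      using that ca by (intro inB) (auto simp: L_D rw_def)
    ultimately show "B \<noteq> {}" using seed by blast
    fix K assume K: "ideal K (mpoly_ring V)" and BK: "B \<subseteq> K"
    have BS: "B \<subseteq> sat V K" using BK sat_superset[OF K] by blast
    have S0: "0 \<in> sat V K" using ideal_mpoly_ringD(2)[OF ideal_sat[OF K]] .
    have rows: "L.mn \<rho> \<rho>' c c' \<in> sat V K"
      if "2 \<le> \<rho>" "\<rho>' < 2" "{\<rho>, \<rho>'} \<times> {c, c'} \<subseteq> L.D" for \<rho> \<rho>' c c'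
      using rowsB[OF that] BS S0 by (cases "c = c'") auto
    then show "L.mn \<rho> \<rho>' c c' \<in> sat V K"
      if "2 \<le> \<rho>" "\<rho>' < 2" "{\<rho>, \<rho>'} \<times> {c, c'} \<subseteq> L.D" for \<rho> \<rho>' c c'
      using that by blast
    \<comment> \<open>On the columns of a short row both full rows are compared with it, and hence
      with each other.\<close>
    have apex: "L.mn 0 1 c c' \<in> sat V K" if D: "{\<rho>} \<times> {c, c'} \<subseteq> L.D" and \<rho>: "2 \<le> \<rho>" for \<rho> c c'
    proof (rule L.sat_mn_row_trans[OF K, of 0 \<rho> 1])
      show D': "{0, \<rho>, 1} \<times> {c, c'} \<subseteq> L.D"
        using D \<rho> Z2X Z3X by (auto simp: L_D)
      show "L.mn \<rho> 1 c c' \<in> sat V K"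
        using D' \<rho> by (intro rows) auto
      have "L.mn \<rho> 0 c' c \<in> sat V K"
        using D' \<rho> by (intro rows) auto
      then show "L.mn 0 \<rho> c c' \<in> sat V K" by (simp add: L.mn_swap(2)[of 0])
    qed
    have apex2: "L.mn 0 1 c c' \<in> sat V K" if "c \<in> Z2" "c' \<in> Z2" for c c'
      using that by (intro apex[of 2]) (auto simp: L_D)
    have apex3: "L.mn 0 1 c c' \<in> sat V K" if "c \<in> Z3" "c' \<in> Z3" for c c'
      using that by (intro apex[of 3]) (auto simp: L_D)
    have trans: "L.mn 0 1 c1 c3 \<in> sat V K"
      if "c1 \<in> X" "c2 \<in> X" "c3 \<in> X" "L.mn 0 1 c1 c2 \<in> sat V K" "L.mn 0 1 c2 c3 \<in> sat V K" for c1 c2 c3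
      using that by (intro L.sat_mn_col_trans[OF K, of 0 1 c1 c2 c3]) (auto simp: L_D)
    have seed': "L.mn 0 1 (co t (p a)) (co t (p a) + 1) \<in> sat V K"
    proof -
      have "L.mn 0 1 (co t (p a)) (co t (p a) + 1) \<in> B"
        if "avail (mk t (co t (p a)) r) (mk t (co t (p a) + 1) (r + 1))"
        using that ca by (intro inB) (auto simp: L_D rw_def)
      then show ?thesis
        using seed apex2[OF Z2a] apex3[OF Z3a] BS by blast
    qed
    \<comment> \<open>Induction along the run: modulo the saturation every column is proportional to
      the first one.\<close>
    have base: "\<forall>c \<in> cols t (p k). L.mn 0 1 (co t (p a)) c \<in> sat V K" if "a \<le> k" "k \<le> j" for k
      using that
    proof (induction k rule: int_ge_induct)
      case base
      then show ?case using seed' S0 by (auto simp: cols_def)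
    next
      case (step k)
      have k: "k + 1 \<in> {a<..j}" "k \<in> {a..j}" "k + 1 \<in> {a..j}" using step by auto
      note adjk = adj[OF k(1), simplified]
      have ack: "ac t (p k) = ac t (p (k + 1))"
        using row[OF k(2)] row[OF k(3)] by simp
      have uk: "u (k + 1) = shift (p k) (p (k + 1)) (u k)"
        using assms(6)[OF k(1)] by simp
      have IH: "\<forall>c \<in> cols t (p k). L.mn 0 1 (co t (p a)) c \<in> sat V K"
        using step by auto
      have colsX: "cols t (p k) \<subseteq> X" "cols t (p (k + 1)) \<subseteq> X"
        using k(2,3) unfolding X_def by blast+
      show ?case
      proof
        fix c assume c: "c \<in> cols t (p (k + 1))"
        show "L.mn 0 1 (co t (p a)) c \<in> sat V K"
        proof (cases "c \<in> cols t (p k)")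
          case True
          then show ?thesis using IH by blast
        next
          case new: False
          have cu: "c = co t (u (k + 1))"
            using c new adjk ack unfolding uk shift_along(1)[OF adjk ack]
            by (auto simp: cols_def adj_iff[of _ _ t])
          consider (direct) "avail (u k) (across (p k) (p (k + 1)) (u k))" | (Z) "Z3 = cols t (p (k + 1))"
            using av[OF k(1)] by auto
          then show ?thesis
          proof cases
            case direct
            \<comment> \<open>The chosen minor compares the new column with that of
              \<open>u k\<close>, one of the two columns of the preceding cell; rectangles of one
              cell and of two cells serve equally.\<close>
            let ?c0 = "co t (u k)"
            have uc: "u k \<in> cell (p k)" using u[OF k(2)] .
            have c0: "?c0 \<in> cols t (p k)" using cell_cols[OF uc] .
            have "u k = mk t ?c0 (ac t (u k))" by simp
            moreover have "across (p k) (p (k + 1)) (u k) = mk t c (2 * r + 1 - ac t (u k))"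
              using shift_along[OF adjk ack, of "u k"] cu uk row[OF k(3)] by simp
            ultimately have av': "avail (mk t ?c0 (ac t (u k))) (mk t c (2 * r + 1 - ac t (u k)))"
              using direct by simp
            have "ac t (u k) = r \<or> ac t (u k) = r + 1"
              using uc row[OF k(2)] by (auto simp: cell_iff[of _ _ t])
            then have "avail (mk t ?c0 r) (mk t c (r + 1))"
              using av' avail_mk_swap[of t ?c0 "r + 1" c r] by (auto simp del: co_ac_mk)
            then have "L.mn 0 1 ?c0 c \<in> B"
              using c0 c colsX by (intro inB) (auto simp: L_D rw_def)
            then have "L.mn 0 1 ?c0 c \<in> sat V K" using BS by blast
            then show ?thesis
              using trans[of "co t (p a)" ?c0 c] IH c0 c colsX ca by blast
          next
            case Z
            obtain c1 where c1: "c1 \<in> cols t (p k)" "c1 \<in> cols t (p (k + 1))"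
              using adjk ack by (auto simp: cols_def adj_iff[of _ _ t])
            then have "L.mn 0 1 c1 c \<in> sat V K"
              using Z c apex3 by blast
            then show ?thesis
              using trans[of "co t (p a)" c1 c] IH c1 c colsX ca by blast
          qed
        qed
      qed
    qed
    show "L.mn 0 1 c c' \<in> sat V K" if "c \<in> X" "c' \<in> X" for c c'
    proof -
      have b: "L.mn 0 1 (co t (p a)) d \<in> sat V K" if "d \<in> X" for d
        using that base by (auto simp: X_def)
      show ?thesis
        using trans[of c "co t (p a)" c'] L.sat_mn_uminus[OF K b[OF that(1)]] b[OF that(2)] that ca by blast
    qed
  qed
  have subI: "L.lad \<subseteq> I"
  proof (rule Idl_mpoly_ring(3)[OF L.minors_polys ideal_polyomino_ideal], rule subsetI)
    note I = ideal_mpoly_ringD[OF ideal_polyomino_ideal[of Q]]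
    \<comment> \<open>Consecutive cells are adjacent, so the run leaves no gap between two of its
      columns and the rectangle is filled with cells.\<close>
    have between: "minor (mk t c e) (mk t c' e') \<in> I"
      if c: "c \<in> X" "c' \<in> X" and e: "e \<in> {r, r + 1}" "e' \<in> {r, r + 1}" for c c' e e'
    proof (rule minor_in_polyomino_ideal[of t])
      fix q assume "min (co t (mk t c e)) (co t (mk t c' e')) \<le> co t q"
        "co t q < max (co t (mk t c e)) (co t (mk t c' e'))"
        "min (ac t (mk t c e)) (ac t (mk t c' e')) \<le> ac t q"
        "ac t q < max (ac t (mk t c e)) (ac t (mk t c' e'))"
      then have q: "min c c' \<le> co t q" "co t q < max c c'" "ac t q = r"
        using e by auto
      have "min c c' \<in> X" "max c c' \<in> X"
        using c by (auto simp: min_def max_def)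
      then obtain k1 k2 where k1: "k1 \<in> {a..j}" "min c c' \<in> cols t (p k1)"
        and k2: "k2 \<in> {a..j}" "max c c' \<in> cols t (p k2)"
        unfolding X_def by blast
      have "\<exists>i \<in> {a..j}. co t (p i) = co t q"
      proof (rule int_steps_intermediate[OF aj, of "\<lambda>k. co t (p k)" k1 k2])
        fix k assume "a < k" "k \<le> j"
        then show "co t (p k) \<le> co t (p (k - 1)) + 1 \<and> co t (p (k - 1)) \<le> co t (p k) + 1"
          using adj[of k] by (auto simp: adj_iff[of _ _ t])
      qed (use k1 k2 q in \<open>auto simp: cols_def\<close>)
      then obtain i where i: "i \<in> {a..j}" "co t (p i) = co t q" by blast
      then have "q = p i"
        using row[OF i(1)] q(3) by (simp add: vertex_eq_iff[of q _ t])
      then show "q \<in> Q" using pQ[OF i(1)] by simp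
    qed
    have low: "L.mn \<rho> \<rho>' c c' \<in> I" if asm: "2 \<le> \<rho>" "\<rho>' < 2" "{\<rho>, \<rho>'} \<times> {c, c'} \<subseteq> L.D" for \<rho> \<rho>' c c'
    proof -
      have r': "rw \<rho>' \<in> {r, r + 1}" using asm(2) by (auto simp: rw_def)
      consider "\<rho> = 2" "c \<in> Z2" "c' \<in> Z2" | "\<rho> = 3" "c \<in> Z3" "c' \<in> Z3"
        using asm(1,3) by (auto simp: L_D)
      then show ?thesis
      proof cases
        case 1
        then have "rw \<rho> = r2" by (simp add: rw_def)
        then show ?thesis
          using 1 Z2 r' row[of a] aj unfolding apexed_def mn by auto
      next
        case 2
        then have "rw \<rho> = r3" by (simp add: rw_def)
        then show ?thesis
          using 2 Z3 r' row unfolding apexed_def mn by auto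
      qed
    qed
    fix b :: "(vertex, 'k) mpoly"
    assume "b \<in> L.minors"
    then obtain \<rho> \<rho>' c c' where D: "{\<rho>, \<rho>'} \<times> {c, c'} \<subseteq> L.D" and b: "b = L.mn \<rho> \<rho>' c c'"
      by (auto simp: L.minors_def)
    consider "\<rho> < 2" "\<rho>' < 2" | "2 \<le> \<rho>" "\<rho>' < 2" | "2 \<le> \<rho>'" "\<rho> < 2" | "\<rho> = \<rho>'" | "2 \<le> \<rho>" "2 \<le> \<rho>'" "\<rho> \<noteq> \<rho>'"
      by linarith
    then show "b \<in> I"
    proof cases
      case 1
      then have "c \<in> X" "c' \<in> X" "rw \<rho> \<in> {r, r + 1}" "rw \<rho>' \<in> {r, r + 1}"
        using D by (auto simp: L_D rw_def)
      then show ?thesis unfolding b mn by (rule between)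
    next
      case 2
      then show ?thesis unfolding b using low D by blast
    next
      case 3
      then have "L.mn \<rho>' \<rho> c' c \<in> I" using low[of \<rho>' \<rho> c' c] D by blast
      then show ?thesis unfolding b by (simp add: L.mn_swap(2)[of \<rho>])
    next
      case 4
      then show ?thesis unfolding b using I(2) by simp
    next
      case 5
      then show ?thesis using D Z23 by (auto simp: L_D)
    qed
  qed
  have m1: "(minor x y :: (vertex, 'k) mpoly) \<in> L.lad"
    if xy: "x \<in> (\<Union>k \<in> {a..j}. cell (p k))" "y \<in> (\<Union>k \<in> {a..j}. cell (p k))" for x y
  proof -
    have rep: "\<exists>\<rho> < 2. co t x \<in> X \<and> x = mk t (co t x) (rw \<rho>)" if "x \<in> (\<Union>k \<in> {a..j}. cell (p k))" for x
    proof -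
      obtain k where k: "k \<in> {a..j}" "x \<in> cell (p k)" using \<open>x \<in> _\<close> by blast
      have "co t x \<in> X" using cell_cols[OF k(2)] k(1) unfolding X_def by blast
      moreover have "ac t x = rw 0 \<or> ac t x = rw 1"
        using k row[OF k(1)] by (auto simp: cell_iff[of _ _ t] rw_def)
      then have "x = mk t (co t x) (rw 0) \<or> x = mk t (co t x) (rw 1)"
        by (metis co_ac_mk(3))
      then have "\<exists>\<rho> < 2. x = mk t (co t x) (rw \<rho>)"
        by (elim disjE) (intro exI[of _ 0] conjI, simp, assumption, intro exI[of _ 1] conjI, simp, assumption)
      ultimately show ?thesis by blast
    qed
    obtain \<rho> where \<rho>: "\<rho> < 2" "co t x \<in> X" "x = mk t (co t x) (rw \<rho>)" using rep[OF xy(1)] by blast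
    obtain \<rho>' where \<rho>': "\<rho>' < 2" "co t y \<in> X" "y = mk t (co t y) (rw \<rho>')" using rep[OF xy(2)] by blast
    have "(minor x y :: (vertex, 'k) mpoly) = L.mn \<rho> \<rho>' (co t x) (co t y)"
      unfolding mn using \<rho>(3) \<rho>'(3) by metis
    moreover have "(L.mn \<rho> \<rho>' (co t x) (co t y) :: (vertex, 'k) mpoly) \<in> L.lad"
      using \<rho>(1,2) \<rho>'(1,2) by (intro L.mn_lad) (auto simp: L_D)
    ultimately show ?thesis by metis
  qed
  have m2: "(minor (mk t c e) (mk t c' e') :: (vertex, 'k) mpoly) \<in> L.lad"
    if c: "c \<in> Z3" "c' \<in> Z3" and e: "e \<in> {r, r + 1, r3}" "e' \<in> {r, r + 1, r3}" for c c' e e'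
  proof -
    have rep: "\<exists>\<rho> \<in> {0, 1, 3}. e = rw \<rho>" if "e \<in> {r, r + 1, r3}" for e
      using that by (auto simp: rw_def)
    obtain \<rho> \<rho>' where \<rho>: "\<rho> \<in> {0, 1, 3}" "e = rw \<rho>" "\<rho>' \<in> {0, 1, 3}" "e' = rw \<rho>'"
      using rep[OF e(1)] rep[OF e(2)] by blast
    have "(L.mn \<rho> \<rho>' c c' :: (vertex, 'k) mpoly) \<in> L.lad"
      using \<rho> c Z3X by (intro L.mn_lad) (auto simp: L_D)
    then show ?thesis using \<rho> by (simp add: mn)
  qed
  show ?thesis
    by (intro bexI[OF _ famL] conjI ballI) (fact subI, erule (1) m1, erule (3) m2)
qed

end

section \<open>Paths of cells\<close>

context board
begin

lemma avail_rect:
  assumes "avail x y" "{fst x, fst y} = {fst x', fst y'}" "{snd x, snd y} = {snd x', snd y'}"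
  shows "avail x' y'"
proof -
  have 1: "avail (fst x, snd y) (fst y, snd x)"
    using assms(1) by (simp add: avail_def minor_antidiagonal PIdl_uminus)
  have "(x' = x \<and> y' = y) \<or> (x' = y \<and> y' = x) \<or> (x' = (fst x, snd y) \<and> y' = (fst y, snd x)) \<or>
      (x' = (fst y, snd x) \<and> y' = (fst x, snd y))"
    using assms(2,3) unfolding doubleton_eq_iff prod_eq_iff fst_conv snd_conv by metis
  then show ?thesis
    using assms(1) 1 avail_sym[of x y] avail_sym[of "(fst x, snd y)"] by (elim disjE conjE) simp_all
qed

lemma avail_rect':
  assumes "avail x y" "{co t x, co t y} = {co t x', co t y'}" "{ac t x, ac t y} = {ac t x', ac t y'}"
  shows "avail x' y'"
  using assms avail_rect[of x y x' y'] by (cases t) (simp_all add: co_def ac_def)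

lemma avail_cell:
  assumes "avail x y" "x \<in> cell q" "y \<in> cell q" "co t x \<noteq> co t y" "ac t x \<noteq> ac t y"
    and "x' \<in> cell q" "y' \<in> cell q" "co t x' \<noteq> co t y'" "ac t x' \<noteq> ac t y'"
  shows "avail x' y'"
proof (rule avail_rect'[OF assms(1), of t])
  have two: "{co t v, co t w} = {co t q, co t q + 1}" "{ac t v, ac t w} = {ac t q, ac t q + 1}"
    if "v \<in> cell q" "w \<in> cell q" "co t v \<noteq> co t w" "ac t v \<noteq> ac t w" for v w
    using that unfolding cell_iff[of _ _ t] doubleton_eq_iff by (elim disjE conjE; simp)+
  show "{co t x, co t y} = {co t x', co t y'}" "{ac t x, ac t y} = {ac t x', ac t y'}"
    using two[OF assms(2-5)] two[OF assms(6-9)] by simp_all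
qed

text \<open>For \<open>q'\<close> beside \<open>q\<close> across the run: the row of the edge of
  \<open>q'\<close> that faces away from \<open>q\<close>.\<close>

definition far_row :: "bool \<Rightarrow> vertex \<Rightarrow> vertex \<Rightarrow> nat" where
  "far_row t q q' = (if ac t q < ac t q' then ac t q' + 1 else ac t q')"

text \<open>Together with the common edge the far edge of \<open>q'\<close> spans the cell at
  \<open>q'\<close>, together with the other row of \<open>q\<close> it spans the rectangle of both
  cells. Comparing these two minors is what later gives the minor of the cell at
  \<open>q\<close>.\<close>

lemma apexed_cell:
  assumes "adj q q'" "co t q = co t q'" "q \<in> Q" "q' \<in> Q"
    and av: "\<And>x y. x \<in> cell q' \<Longrightarrow> x \<notin> cell q \<Longrightarrow> y \<in> cell q \<Longrightarrow> co t x \<noteq> co t y \<Longrightarrow> avail x y"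
  shows "apexed t q (far_row t q q')"
proof -
  let ?e = "far_row t q q'"
  have ac: "ac t q' = ac t q + 1 \<or> ac t q = ac t q' + 1"
    using assms(1,2) by (auto simp: adj_iff[of _ _ t])
  have e: "?e \<noteq> ac t q" "?e \<noteq> ac t q + 1"
    using ac unfolding far_row_def by (elim disjE; simp)+
  have far: "mk t c ?e \<in> cell q'" if "c \<in> cols t q" for c
    using ac that assms(2) unfolding far_row_def cell_iff[of _ _ t] cols_def insert_iff empty_iff co_ac_mk
    by (smt (verit))
  have far': "mk t c ?e \<notin> cell q" for c
    using e unfolding cell_iff[of _ _ t] co_ac_mk by blast
  have near: "mk t c \<rho> \<in> cell q" if "c \<in> cols t q" "\<rho> \<in> {ac t q, ac t q + 1}" for c \<rho>
    using that by (auto simp: cell_iff[of _ _ t] cols_def)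
  have mI: "minor (mk t c ?e) (mk t c' \<rho>) \<in> I"
    if c: "c \<in> cols t q" "c' \<in> cols t q" and \<rho>: "\<rho> \<in> {ac t q, ac t q + 1}" for c c' \<rho>
  proof (rule minor_in_polyomino_ideal[of t])
    fix v assume v: "min (co t (mk t c ?e)) (co t (mk t c' \<rho>)) \<le> co t v"
      "co t v < max (co t (mk t c ?e)) (co t (mk t c' \<rho>))"
      "min (ac t (mk t c ?e)) (ac t (mk t c' \<rho>)) \<le> ac t v"
      "ac t v < max (ac t (mk t c ?e)) (ac t (mk t c' \<rho>))"
    have "co t v = co t q"
      using v(1,2) c by (auto simp: cols_def)
    moreover have "ac t v = ac t q \<or> ac t v = ac t q'"
      using v(3,4) \<rho> ac by (auto simp: far_row_def)
    ultimately have "v = q \<or> v = q'"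
      using assms(2) by (auto simp: vertex_eq_iff[of v _ t])
    then show "v \<in> Q" using assms(3,4) by blast
  qed
  show ?thesis
    unfolding apexed_def
  proof (intro conjI ballI impI)
    fix c c' \<rho> assume c: "c \<in> cols t q" "c' \<in> cols t q" "\<rho> \<in> {ac t q, ac t q + 1}"
    show "mk t c ?e \<in> V" by (rule V_I[OF far[OF c(1)] \<open>q' \<in> Q\<close>])
    show "minor (mk t c ?e) (mk t c' \<rho>) \<in> I" by (rule mI[OF c])
    assume "c \<noteq> c'"
    then show "avail (mk t c ?e) (mk t c' \<rho>)"
      by (intro av[OF far[OF c(1)] far' near[OF c(2,3)]]) simp
  qed (rule e)+
qed

end

lemma shift_across_coords:
  assumes "adj p q" "u \<in> cell p"
  shows "co t u \<noteq> co t (across p q u)" "ac t u \<noteq> ac t (across p q u)"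
proof -
  have "\<exists>t. co t u \<noteq> co t (across p q u) \<and> ac t u \<noteq> ac t (across p q u)"
    using assms(1)
  proof (cases rule: adj_cases)
    case (1 t)
    \<comment> \<open>Parity: no vertex is its own mirror image in the middle line of a
      cell.\<close>
    have "ac t u \<noteq> 2 * ac t q + 1 - ac t u" by presburger
    then show ?thesis
      using 1 assms(2) unfolding shift_along(2)[OF assms(1) 1(1)] cell_iff[of _ _ t]
      by (intro exI[of _ t]) auto
  next
    case (2 t)
    have "ac t u \<noteq> 2 * ac t q + 1 - ac t u" by presburger
    then show ?thesis
      using 2 assms(2) unfolding shift_along(2)[OF assms(1) 2(1)] cell_iff[of _ _ t]
      by (intro exI[of _ t]) auto
  qed
  then have "fst u \<noteq> fst (across p q u)" "snd u \<noteq> snd (across p q u)"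
    by (auto simp: co_def ac_def split: if_splits)
  then show "co t u \<noteq> co t (across p q u)" "ac t u \<noteq> ac t (across p q u)"
    by (simp_all add: co_def ac_def)
qed

text \<open>A path of cells together with the projected vertices \<open>u\<close>, and possibly one further cell \<open>T\<close>
  attached to the cells with indices in \<open>St\<close>.\<close>

locale route = board +
  fixes J :: "int set" and p u :: "int \<Rightarrow> vertex" and St :: "int set" and T :: vertex
  assumes convex: "i \<in> J \<Longrightarrow> j \<in> J \<Longrightarrow> i \<le> k \<Longrightarrow> k \<le> j \<Longrightarrow> k \<in> J"
    and Q: "Q = p ` J \<union> (if St = {} then {} else {T})"
    and adj: "i - 1 \<in> J \<Longrightarrow> i \<in> J \<Longrightarrow> adj (p (i - 1)) (p i)"
    and ne2: "i - 2 \<in> J \<Longrightarrow> i \<in> J \<Longrightarrow> p (i - 2) \<noteq> p i"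
    and far: "i - 3 \<in> J \<Longrightarrow> i \<in> J \<Longrightarrow> cell (p (i - 3)) \<inter> cell (p i) = {}"
    and u_cell: "i \<in> J \<Longrightarrow> u i \<in> cell (p i)"
    and u_step: "i - 1 \<in> J \<Longrightarrow> i \<in> J \<Longrightarrow> u i = shift (p (i - 1)) (p i) (u (i - 1))"
    and u_start: "i \<in> J \<Longrightarrow> i - 1 \<notin> J \<Longrightarrow> i + 1 \<in> J \<Longrightarrow> u i \<in> cell (p (i + 1))"
    and start_avail: "i \<in> J \<Longrightarrow> i - 1 \<notin> J \<Longrightarrow> avail (p i) (fst (p i) + 1, snd (p i) + 1)"
    and step_avail: "i - 1 \<in> J \<Longrightarrow> i \<in> J \<Longrightarrow> i \<notin> St \<Longrightarrow>
      avail (u (i - 1)) (across (p (i - 1)) (p i) (u (i - 1)))"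
    and St_J: "i \<in> St \<Longrightarrow> i - 2 \<in> J \<and> i \<in> J \<and> i + 1 \<in> J"
    and St_inline: "i \<in> St \<Longrightarrow> inline (p (i - 2)) (p (i - 1)) (p i)"
      "i \<in> St \<Longrightarrow> inline (p (i - 1)) (p i) (p (i + 1))"
    and St_T: "i \<in> St \<Longrightarrow> adj (p i) T" "i \<in> St \<Longrightarrow> \<not> inline (p (i - 1)) (p i) T"
    and St_unique: "i \<in> St \<Longrightarrow> k \<in> St \<Longrightarrow> p i = p k"
    and St_avail: "i \<in> St \<Longrightarrow> x \<in> cell T \<Longrightarrow> x \<notin> cell (p i) \<Longrightarrow> y \<in> cell (p i) \<Longrightarrow>
      fst x \<noteq> fst y \<Longrightarrow> snd x \<noteq> snd y \<Longrightarrow> avail x y"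
begin

lemma adj': "i \<in> J \<Longrightarrow> i + 1 \<in> J \<Longrightarrow> adj (p i) (p (i + 1))"
  using adj[of "i + 1"] by simp

lemma ne2': "i - 1 \<in> J \<Longrightarrow> i + 1 \<in> J \<Longrightarrow> p (i - 1) \<noteq> p (i + 1)"
  using ne2[of "i + 1"] by (simp add: algebra_simps)

lemma p_Q: "i \<in> J \<Longrightarrow> p i \<in> Q"
  using Q by auto

lemma T_Q: "i \<in> St \<Longrightarrow> T \<in> Q"
  using Q by auto

lemma St_pred: "i \<in> St \<Longrightarrow> i - 1 \<in> J"
  using St_J[of i] convex[of "i - 2" i "i - 1"] by simp

lemma u_new: "i - 1 \<in> J \<Longrightarrow> i \<in> J \<Longrightarrow> u i \<in> cell (p i) - cell (p (i - 1))"
  using shift_new(1)[OF adj u_cell] u_step by simp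

lemma inline_u:
  assumes "i - 2 \<in> J" "i \<in> J" "inline (p (i - 2)) (p (i - 1)) (p i)"
  shows "u (i - 1) \<in> cell (p i)"
proof -
  have J: "i - 1 \<in> J" using convex[OF assms(1,2), of "i - 1"] by simp
  have a: "adj (p (i - 2)) (p (i - 1))" using adj[of "i - 1"] J assms(1) by simp
  show ?thesis
    using inline_stays[OF a adj[OF J assms(2)] ne2[OF assms(1,2)] assms(3)] u_new[of "i - 1"] J assms(1) by simp
qed

text \<open>Turning back would give \<open>p (j - 1) = p (j + 1)\<close>, so the sign of the first
  step persists.\<close>

lemma run_linear:
  assumes "i \<le> j" and J: "i \<in> J" "j \<in> J" and row: "\<And>k. k \<in> {i..j} \<Longrightarrow> ac t (p k) = r"
  shows "\<exists>\<epsilon> \<in> {1, -1}. \<forall>k \<in> {i..j}. int (co t (p k)) = int (co t (p i)) + \<epsilon> * (k - i)"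
  using assms
proof (induction j rule: int_ge_induct)
  case base
  then show ?case by (intro bexI[of _ 1]) auto
next
  case (step j)
  have J': "k \<in> J" if "k \<in> {i..j + 1}" for k
    using convex[OF step.prems(1,2)] that by simp
  obtain \<epsilon> where \<epsilon>: "\<epsilon> \<in> {1, -1}" "\<forall>k \<in> {i..j}. int (co t (p k)) = int (co t (p i)) + \<epsilon> * (k - i)"
  proof -
    have "j \<in> J" using step.hyps by (intro J') simp
    moreover have "ac t (p k) = r" if "k \<in> {i..j}" for k
      using that by (intro step.prems(3)) simp
    ultimately show ?thesis
      using step.IH[OF step.prems(1)] that by blast
  qed
  have j1: "j \<in> {i..j + 1}" "j + 1 \<in> {i..j + 1}" using step.hyps by auto
  have eq: "ac t (p j) = ac t (p (j + 1))"
    using step.prems(3)[OF j1(1)] step.prems(3)[OF j1(2)] by simp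
  have a: "int (co t (p (j + 1))) = int (co t (p j)) + 1 \<or> int (co t (p (j + 1))) = int (co t (p j)) - 1"
    using adj'[OF J'[OF j1(1)] J'[OF j1(2)]]
    by (cases rule: adj_cases4[of _ _ t]) (use eq in linarith)+
  show ?case
  proof (cases "j = i")
    case True
    show ?thesis
    proof -
      obtain \<delta> :: int where \<delta>: "\<delta> \<in> {1, -1}" "int (co t (p (i + 1))) = int (co t (p i)) + \<delta>"
        using a True by force
      have "int (co t (p k)) = int (co t (p i)) + \<delta> * (k - i)" if "k \<in> {i..j + 1}" for k
      proof -
        have "k = i \<or> k = i + 1" using that True by auto
        then show ?thesis using \<delta>(2) by auto
      qed
      then show ?thesis using \<delta>(1) by blast
    qed
  next
    case False
    then have j: "j - 1 \<in> {i..j}" "j \<in> {i..j}" using step.hyps by auto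
    have "p (j - 1) \<noteq> p (j + 1)"
      using ne2'[of j] J' j by auto
    then have "co t (p (j - 1)) \<noteq> co t (p (j + 1))"
      using step.prems(3)[of "j - 1"] step.prems(3)[of "j + 1"] j step.hyps
      by (auto simp: vertex_eq_iff[of _ _ t])
    moreover have "int (co t (p j)) = int (co t (p (j - 1))) + \<epsilon>"
      using \<epsilon>(2)[rule_format, OF j(1)] \<epsilon>(2)[rule_format, OF j(2)] by (simp add: algebra_simps)
    ultimately have "int (co t (p (j + 1))) = int (co t (p j)) + \<epsilon>"
      using a \<epsilon>(1) by auto
    then have "int (co t (p (j + 1))) = int (co t (p i)) + \<epsilon> * (j + 1 - i)"
      using \<epsilon>(2)[rule_format, OF j(2)] by (simp add: algebra_simps)
    moreover have "k \<in> {i..j} \<or> k = j + 1" if "k \<in> {i..j + 1}" for k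
      using that by auto
    ultimately show ?thesis
      using \<epsilon> by blast
  qed
qed

text \<open>The minor chosen for the first cell may be that of a rectangle reaching outside the run.
  The ladder then starts one cell earlier or carries the preceding cell as a short row. The
  auxiliary fact \<open>finish\<close> handles a ladder starting at some \<open>a\<close> \<le>
  \<open>i\<close>, and the cases at the end supply its seed.\<close>

lemma run:
  assumes ij: "i \<le> j" and J: "i \<in> J" "j \<in> J" and row: "\<And>k. k \<in> {i..j} \<Longrightarrow> ac t (p k) = r"
    and T: "\<And>k. k \<in> St \<Longrightarrow> k \<in> {i..j} \<Longrightarrow> ac t T \<noteq> r"
  shows "\<exists>K \<in> family. K \<subseteq> I \<and>
    (\<forall>k \<in> {i..j}. \<forall>k' \<in> {i..j}. \<forall>x \<in> cell (p k). \<forall>y \<in> cell (p k'). minor x y \<in> K) \<and>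
    (\<forall>k \<in> St \<inter> {i..j}. \<forall>x \<in> cell T \<union> cell (p k). \<forall>y \<in> cell T \<union> cell (p k). minor x y \<in> K)"
proof -
  have J': "k \<in> J" if "k \<in> {i..j}" for k
    using convex[OF J] that by simp
  \<comment> \<open>By \<open>St_unique\<close> all indices of \<open>St\<close> in the run denote
    the same cell, so any one of them may be picked.\<close>
  define Z3 where "Z3 = (if St \<inter> {i..j} = {} then {} else cols t (p (SOME s. s \<in> St \<inter> {i..j})))"
  define r3 where "r3 = (if r < ac t T then ac t T + 1 else ac t T)"
  have Z3_eq: "Z3 = cols t (p s)" if "s \<in> St \<inter> {i..j}" for s
  proof -
    have "(SOME s. s \<in> St \<inter> {i..j}) \<in> St \<inter> {i..j}" using that by (rule someI)
    then have eq: "p (SOME s. s \<in> St \<inter> {i..j}) = p s"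
      using that by (intro St_unique) blast+
    have "St \<inter> {i..j} \<noteq> {}" using that by blast
    then show ?thesis
      unfolding Z3_def eq by (rule if_not_P)
  qed
  have T_row: "co t (p s) = co t T \<and> (ac t T = r + 1 \<or> r = ac t T + 1)" if "s \<in> St \<inter> {i..j}" for s
    using St_T(1)[of s, unfolded adj_iff[of _ _ t]] T[of s] row[of s] that by (metis IntE)
  have apex3: "apexed t (p s) r3" if s: "s \<in> St \<inter> {i..j}" for s
  proof -
    have "apexed t (p s) (far_row t (p s) T)"
    proof (rule apexed_cell)
      show "adj (p s) T" "co t (p s) = co t T" "p s \<in> Q" "T \<in> Q"
        using s St_T(1) T_row[OF s] p_Q T_Q J' by auto
      fix x y assume xy: "x \<in> cell T" "x \<notin> cell (p s)" "y \<in> cell (p s)" "co t x \<noteq> co t y"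
      have "ac t x \<noteq> ac t y"
        using xy(1-3) T_row[OF s] unfolding cell_iff[of _ _ t] by metis
      then have "fst x \<noteq> fst y" "snd x \<noteq> snd y"
        using xy(4) by (cases t; simp add: co_def ac_def)+
      then show "avail x y" using St_avail xy(1-3) s by blast
    qed
    moreover have "far_row t (p s) T = r3"
      using row[of s] s by (simp add: far_row_def r3_def)
    ultimately show ?thesis by simp
  qed
  have Z3: "Z3 = {} \<or> (\<exists>s \<in> {a..j}. Z3 = cols t (p s) \<and> apexed t (p s) r3)" if "a \<le> i" for a
  proof (cases "St \<inter> {i..j} = {}")
    case True
    then show ?thesis by (simp add: Z3_def)
  next
    case False
    then obtain s where "s \<in> St \<inter> {i..j}" by blast
    then show ?thesis using Z3_eq[of s] apex3[of s] that by (intro disjI2 bexI[of _ s]) auto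
  qed
  have step: "avail (u (k - 1)) (across (p (k - 1)) (p k) (u (k - 1))) \<or> Z3 = cols t (p k)"
    if "k \<in> {i..j}" "k - 1 \<in> J" for k
    using step_avail[of k] Z3_eq[of k] that J' by blast
  have finish: ?thesis
    if a: "a \<le> i" "a \<in> J" "\<And>k. k \<in> {a..j} \<Longrightarrow> ac t (p k) = r"
      and av: "\<And>k. k \<in> {a<..j} \<Longrightarrow>
        avail (u (k - 1)) (across (p (k - 1)) (p k) (u (k - 1))) \<or> Z3 = cols t (p k)"
      and Z2: "Z2 = {} \<or> Z2 = cols t (p a) \<and> apexed t (p a) r2" "Z2 \<inter> Z3 = {}"
      and seed: "Z2 \<noteq> {} \<or> Z3 = cols t (p a) \<or> avail (mk t (co t (p a)) r) (mk t (co t (p a) + 1) (r + 1))"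
    for a Z2 r2
  proof -
    have Ja: "k \<in> J" if "k \<in> {a..j}" for k
      using convex[OF a(2) J(2)] that by simp
    have aj: "a \<le> j" using a(1) ij by simp
    have "\<exists>K \<in> family. K \<subseteq> I \<and>
      (\<forall>x \<in> (\<Union>k \<in> {a..j}. cell (p k)). \<forall>y \<in> (\<Union>k \<in> {a..j}. cell (p k)). minor x y \<in> K) \<and>
      (\<forall>c \<in> Z3. \<forall>c' \<in> Z3. \<forall>e \<in> {r, r + 1, r3}. \<forall>e' \<in> {r, r + 1, r3}. minor (mk t c e) (mk t c' e') \<in> K)"
    proof (rule run_minors[OF aj a(3)])
      show "p k \<in> Q" if "k \<in> {a..j}" for k using Ja[OF that] p_Q by blast
      show "adj (p (k - 1)) (p k)" if "k \<in> {a<..j}" for k using that by (intro adj Ja) auto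
      show "u k \<in> cell (p k)" if "k \<in> {a..j}" for k using Ja[OF that] u_cell by blast
      show "u k = shift (p (k - 1)) (p k) (u (k - 1))" if "k \<in> {a<..j}" for k
        using that by (intro u_step Ja) auto
    qed (use av Z2 Z3[OF a(1)] seed in blast)+
    then obtain K where K: "K \<in> family" "K \<subseteq> I \<and>
      (\<forall>x \<in> (\<Union>k \<in> {a..j}. cell (p k)). \<forall>y \<in> (\<Union>k \<in> {a..j}. cell (p k)). minor x y \<in> K) \<and>
      (\<forall>c \<in> Z3. \<forall>c' \<in> Z3. \<forall>e \<in> {r, r + 1, r3}. \<forall>e' \<in> {r, r + 1, r3}. minor (mk t c e) (mk t c' e') \<in> K)"
      by (rule bexE)
    note K1 = K(2)[THEN conjunct1]
      and K2 = K(2)[THEN conjunct2, THEN conjunct1, rule_format]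
      and K3 = K(2)[THEN conjunct2, THEN conjunct2, rule_format]
    have m1: "minor x y \<in> K"
      if kk: "k \<in> {i..j}" "k' \<in> {i..j}" and xy: "x \<in> cell (p k)" "y \<in> cell (p k')" for k k' x y
    proof -
      have "k \<in> {a..j}" "k' \<in> {a..j}" using kk a(1) by auto
      then have "x \<in> (\<Union>k \<in> {a..j}. cell (p k))" "y \<in> (\<Union>k \<in> {a..j}. cell (p k))"
        using xy by blast+
      then show ?thesis by (rule K2)
    qed
    have m2: "minor x y \<in> K"
      if k: "k \<in> St \<inter> {i..j}" and xy: "x \<in> cell T \<union> cell (p k)" "y \<in> cell T \<union> cell (p k)" for k x y
    proof -
      have rk: "ac t (p k) = r" using row k by blast
      have Zk: "co t v \<in> Z3" if "v \<in> cell T \<union> cell (p k)" for v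
        using that T_row[OF k] unfolding Z3_eq[OF k] cell_iff[of _ _ t] cols_def Un_iff by auto
      have Rk: "ac t v \<in> {r, r + 1, r3}" if "v \<in> cell T \<union> cell (p k)" for v
        using that T_row[OF k] rk unfolding cell_iff[of _ _ t] r3_def Un_iff by (elim disjE conjE) simp_all
      have "minor (mk t (co t x) (ac t x)) (mk t (co t y) (ac t y)) \<in> K"
        by (rule K3[OF Zk[OF xy(1)] Zk[OF xy(2)] Rk[OF xy(1)] Rk[OF xy(2)]])
      then show ?thesis by simp
    qed
    show ?thesis
      by (intro bexI[OF _ K(1)] conjI ballI) (fact K1, erule (3) m1, erule (2) m2)
  qed
  have unit: "avail (mk t (co t (p k)) r) (mk t (co t (p k) + 1) (r + 1))"
    if "avail x y" "x \<in> cell (p k)" "y \<in> cell (p k)" "co t x \<noteq> co t y" "ac t x \<noteq> ac t y" "ac t (p k) = r"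
    for k x y
    using avail_cell[OF that(1-5), of "mk t (co t (p k)) r" "mk t (co t (p k) + 1) (r + 1)"] that(6)
    by (auto simp: cell_iff[of _ _ t])
  have i: "i \<in> {i..j}" using ij by simp
  \<comment> \<open>The first cell begins the path, or carries the attached cell, or has its own
    minor, or has only the minor of the rectangle formed with its predecessor.\<close>
  consider (start) "i - 1 \<notin> J" | (stub) "i - 1 \<in> J" "i \<in> St"
    | (inner) "i - 1 \<in> J" "i \<notin> St" "u (i - 1) \<in> cell (p i)"
    | (corner) "i - 1 \<in> J" "i \<notin> St" "u (i - 1) \<notin> cell (p i)"
    by blast
  then show ?thesis
  proof cases
    case start
    let ?y = "(fst (p i) + 1, snd (p i) + 1)"
    have "?y \<in> cell (p i)" "co t (p i) \<noteq> co t ?y" "ac t (p i) \<noteq> ac t ?y"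
      by (auto simp: cell_iff_fst_snd co_def ac_def)
    then have "avail (mk t (co t (p i)) r) (mk t (co t (p i) + 1) (r + 1))"
      using unit[OF start_avail[OF J(1) start]] row[OF i] by simp
    then show ?thesis
      using finish[of i "{}"] row J step J' by simp
  next
    case stub
    then show ?thesis
      using finish[of i "{}"] row J step J' Z3_eq[of i] i by simp
  next
    case inner
    have a: "adj (p (i - 1)) (p i)" using adj inner(1) J(1) by blast
    have u: "u (i - 1) \<in> cell (p (i - 1))" using u_cell inner(1) by blast
    have "avail (mk t (co t (p i)) r) (mk t (co t (p i) + 1) (r + 1))"
      using unit[OF step_avail[OF inner(1) J(1) inner(2)] inner(3) _ _ _ row[OF i]]
        shift_new(2)[OF a u] shift_across_coords[OF a u] by blast
    then show ?thesis
      using finish[of i "{}"] row J step J' by simp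
  next
    case corner
    have i2: "i - 2 \<in> J"
      using u_start[of "i - 1"] corner J(1) by auto
    have a1: "adj (p (i - 1)) (p i)" using adj corner(1) J(1) by blast
    have a2: "adj (p (i - 2)) (p (i - 1))" using adj[of "i - 1"] i2 corner(1) by simp
    have not_inline: "\<not> inline (p (i - 2)) (p (i - 1)) (p i)"
      using inline_u[OF i2 J(1)] corner(3) by blast
    have u2: "u (i - 2) \<in> cell (p (i - 2))" using u_cell i2 by blast
    \<comment> \<open>Two such rectangles in succession are impossible by
      \<open>shift_stays\<close>, so the predecessor has its own minor available.\<close>
    have u2': "u (i - 2) \<in> cell (p (i - 1))"
    proof (rule ccontr)
      assume out: "u (i - 2) \<notin> cell (p (i - 1))"
      then have i3: "i - 3 \<in> J"
        using u_start[of "i - 2"] i2 corner(1) by auto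
      have "adj (p (i - 3)) (p (i - 2))" using adj[of "i - 2"] i3 i2 by simp
      moreover have "p (i - 3) \<noteq> p (i - 1)" using ne2[of "i - 1"] i3 corner(1) by simp
      moreover have "p (i - 2) \<noteq> p i" using ne2 i2 J(1) by blast
      moreover have "u (i - 2) \<in> cell (p (i - 2))" "u (i - 2) \<notin> cell (p (i - 3))"
        using u_new[of "i - 2"] i3 i2 by auto
      ultimately have "shift (p (i - 2)) (p (i - 1)) (u (i - 2)) \<in> cell (p i)"
        using shift_stays[OF _ a2 a1 _ _ far[OF i3 J(1)]] out by blast
      then show False
        using corner(3) u_step[of "i - 1"] i2 corner(1) by simp
    qed
    have "i - 1 \<notin> St"
    proof
      assume "i - 1 \<in> St"
      then show False using St_inline(2)[of "i - 1"] not_inline by simp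
    qed
    then have av1: "avail (u (i - 2)) (across (p (i - 2)) (p (i - 1)) (u (i - 2)))"
      using step_avail[of "i - 1"] i2 corner(1) by simp
    have w1: "across (p (i - 2)) (p (i - 1)) (u (i - 2)) \<in> cell (p (i - 1))"
      using shift_new(2)[OF a2 u2] by blast
    note d1 = shift_across_coords[OF a2 u2]
    have av2: "avail (u (i - 1)) (across (p (i - 1)) (p i) (u (i - 1)))"
      using step_avail corner J(1) by blast
    show ?thesis
    proof (cases "ac t (p (i - 1)) = r")
      case True
      \<comment> \<open>The predecessor is in line with the run. Starting there, its own minor is
        the seed and the rectangle becomes an ordinary step.\<close>
      have "avail (mk t (co t (p (i - 1))) r) (mk t (co t (p (i - 1)) + 1) (r + 1))"
        using unit[OF av1 u2' w1 d1 True] .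
      moreover have "ac t (p k) = r" if "k \<in> {i - 1..j}" for k
        using that True row[of k] by (cases "k = i - 1") auto
      moreover have "avail (u (k - 1)) (across (p (k - 1)) (p k) (u (k - 1))) \<or> Z3 = cols t (p k)"
        if "k \<in> {i - 1<..j}" for k
        using that step[of k] J'[of "k - 1"] corner(1) by (cases "k = i") auto
      ultimately show ?thesis
        using finish[of "i - 1" "{}"] corner(1) by simp
    next
      case False
      have co: "co t (p i) = co t (p (i - 1))"
        and aci: "ac t (p (i - 1)) = r + 1 \<or> r = ac t (p (i - 1)) + 1"
        using a1[unfolded adj_iff[of _ _ t]] False row[OF i] by metis+
      have uc: "u (i - 1) \<in> cell (p (i - 1))" using u_cell corner(1) by blast
      note w2 = shift_new(2)[OF a1 uc] and d2 = shift_across_coords[OF a1 uc]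
      \<comment> \<open>The predecessor stands across the run, and its outer edge becomes the short
        row over the first cell.\<close>
      have apex: "apexed t (p i) (far_row t (p i) (p (i - 1)))"
      proof (rule apexed_cell)
        show "adj (p i) (p (i - 1))" "co t (p i) = co t (p (i - 1))" "p i \<in> Q" "p (i - 1) \<in> Q"
          using adj_sym[OF a1] co p_Q J(1) corner(1) by auto
        fix x y assume xy: "x \<in> cell (p (i - 1))" "x \<notin> cell (p i)" "y \<in> cell (p i)" "co t x \<noteq> co t y"
        show "avail x y"
        proof (cases "y \<in> cell (p (i - 1))")
          case True
          have "ac t x \<noteq> ac t y"
            using xy(1-3) co aci unfolding cell_iff[of _ _ t] by metis
          then show ?thesis
            using avail_cell[OF av1 u2' w1 d1] xy True by blast
        next
          case False
          let ?w = "across (p (i - 1)) (p i) (u (i - 1))"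
          have "{co t (u (i - 1)), co t ?w} = {co t x, co t y}"
            using xy(1,3,4) uc w2 d2(1) co unfolding cell_iff[of _ _ t] Diff_iff doubleton_eq_iff by (smt (verit))
          moreover have "ac t x = ac t (u (i - 1))" "ac t y = ac t ?w"
            using xy False uc corner(3) w2 co aci row[OF i] unfolding cell_iff[of _ _ t] Diff_iff by (smt (verit))+
          ultimately show ?thesis
            using avail_rect'[OF av2, of t] by simp
        qed
      qed
      \<comment> \<open>The short rows must occupy different columns. Since the path is straight
        before the cell carrying the attached one, that cell comes at least two steps later.\<close>
      have "cols t (p i) \<inter> Z3 = {}"
      proof (cases "St \<inter> {i..j} = {}")
        case True
        then show ?thesis by (simp add: Z3_def)
      next
        case False
        then obtain s where s: "s \<in> St \<inter> {i..j}" by blast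
        have "s \<noteq> i" using s corner(2) by blast
        moreover have "s \<noteq> i + 1"
        proof
          assume si: "s = i + 1"
          then have "inline (p (i - 1)) (p i) (p (i + 1))"
            using St_inline(1)[of s] s by simp
          moreover have "ac t (p (i + 1)) = r" using row[of "i + 1"] s si by auto
          moreover have "adj (p i) (p (i + 1))" using adj'[of i] J(1) J'[of "i + 1"] s si by auto
          ultimately show False
            using aci row[OF i] unfolding inline_iff[of _ _ _ t] adj_iff[of _ _ t]
            by (elim disjE conjE) linarith+
        qed
        ultimately have s2: "i + 2 \<le> s" using s by auto
        obtain \<epsilon> where \<epsilon>: "\<epsilon> \<in> {1, -1}"
          "\<forall>k \<in> {i..j}. int (co t (p k)) = int (co t (p i)) + \<epsilon> * (k - i)"
          using run_linear[OF ij J row] by (rule bexE)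
        have "int (co t (p s)) = int (co t (p i)) + \<epsilon> * (s - i)"
          using \<epsilon>(2) s by blast
        then have "int (co t (p s)) \<ge> int (co t (p i)) + 2 \<or> int (co t (p s)) \<le> int (co t (p i)) - 2"
          using s2 \<epsilon>(1) by (elim insertE emptyE) simp_all
        then show ?thesis
          unfolding Z3_eq[OF s] by (auto simp: cols_def)
      qed
      then show ?thesis
        using finish[of i "cols t (p i)"] row J step J' apex by (auto simp: cols_def)
    qed
  qed
qed

end

section \<open>Inner intervals along a route\<close>

lemma adj_irrefl: "\<not> adj q q"
  by (simp add: adj_def)

locale covered_route = route +
  assumes nbr: "i \<in> J \<Longrightarrow> q \<in> p ` J \<Longrightarrow> adj (p i) q \<Longrightarrow>
      i - 1 \<in> J \<and> q = p (i - 1) \<or> i + 1 \<in> J \<and> q = p (i + 1)"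
    and ne4: "i \<in> J \<Longrightarrow> i + 4 \<in> J \<Longrightarrow> p i \<noteq> p (i + 4)"
    and T_nbr: "St \<noteq> {} \<Longrightarrow> q \<in> p ` J \<Longrightarrow> adj T q \<Longrightarrow> \<exists>i \<in> St. q = p i"
begin

text \<open>Each step of \<open>q\<close> changes the index by one according to \<open>nbr\<close>,
  and never turning back keeps the sign fixed.\<close>

lemma line:
  fixes q :: "nat \<Rightarrow> vertex"
  assumes "\<And>k. k \<le> m \<Longrightarrow> q k \<in> p ` J" "\<And>k. k < m \<Longrightarrow> adj (q k) (q (k + 1))"
    and "\<And>k. k + 2 \<le> m \<Longrightarrow> q k \<noteq> q (k + 2)"
  shows "\<exists>i. \<exists>\<epsilon> \<in> {1, -1}. \<forall>k \<le> m. i + \<epsilon> * int k \<in> J \<and> q k = p (i + \<epsilon> * int k)"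
  using assms
proof (induction m)
  case 0
  then show ?case by force
next
  case (Suc m)
  have "\<exists>i. \<exists>\<epsilon> \<in> {1, -1}. \<forall>k \<le> m. i + \<epsilon> * int k \<in> J \<and> q k = p (i + \<epsilon> * int k)"
    using Suc.prems by (intro Suc.IH) simp_all
  then obtain i \<epsilon> where \<epsilon>: "\<epsilon> \<in> {1, -1}"
    and IH: "\<And>k. k \<le> m \<Longrightarrow> i + \<epsilon> * int k \<in> J \<and> q k = p (i + \<epsilon> * int k)"
    by blast
  let ?i = "i + \<epsilon> * int m"
  have "adj (p ?i) (q (Suc m))"
    using Suc.prems(2)[of m] IH[of m] by simp
  then have n: "?i - 1 \<in> J \<and> q (Suc m) = p (?i - 1) \<or> ?i + 1 \<in> J \<and> q (Suc m) = p (?i + 1)"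
    using nbr[of ?i "q (Suc m)"] IH[of m] Suc.prems(1)[of "Suc m"] by blast
  show ?case
  proof (cases m)
    case 0
    obtain \<delta> :: int where "\<delta> \<in> {1, -1}" "i + \<delta> \<in> J \<and> q (Suc m) = p (i + \<delta>)"
      using n 0 by force
    moreover have "i \<in> J \<and> q 0 = p i" using IH[of 0] by simp
    ultimately have "\<forall>k \<le> Suc m. i + \<delta> * int k \<in> J \<and> q k = p (i + \<delta> * int k)"
      using 0 by (auto simp: le_Suc_eq)
    then show ?thesis using \<open>\<delta> \<in> _\<close> by blast
  next
    case (Suc m')
    have "q m' \<noteq> q (Suc m)"
      using Suc.prems(3)[of m'] Suc by simp
    moreover have "q m' = p (?i - \<epsilon>)"
      using IH[of m'] Suc by (simp add: algebra_simps)
    ultimately have "?i + \<epsilon> \<in> J \<and> q (Suc m) = p (?i + \<epsilon>)"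
      using n \<epsilon> by auto
    then have "i + \<epsilon> * int (Suc m) \<in> J \<and> q (Suc m) = p (i + \<epsilon> * int (Suc m))"
      by (simp add: algebra_simps)
    then have "\<forall>k \<le> Suc m. i + \<epsilon> * int k \<in> J \<and> q k = p (i + \<epsilon> * int k)"
      using IH unfolding le_Suc_eq by blast
    then show ?thesis using \<epsilon> by blast
  qed
qed

lemma Q_cases: "q \<in> Q \<Longrightarrow> q \<in> p ` J \<or> St \<noteq> {} \<and> q = T"
  using Q by (auto split: if_splits)

lemma T_nbr_unique: "St \<noteq> {} \<Longrightarrow> q \<in> Q \<Longrightarrow> adj T q \<Longrightarrow> s \<in> St \<Longrightarrow> q = p s"
  using T_nbr[of q] St_unique[of _ s] Q_cases[of q] adj_irrefl by blast

text \<open>A neighbour in direction \<open>t\<close> makes the path pass straight through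
  \<open>p s\<close> in this direction, whereas the attached cell leaves sideways.\<close>

lemma St_perpendicular:
  assumes "s \<in> St" "k = s - 1 \<or> k = s + 1" "ac t (p k) = ac t (p s)"
  shows "ac t T \<noteq> ac t (p s)"
proof
  assume T: "ac t T = ac t (p s)"
  have J: "s - 1 \<in> J" "s \<in> J" "s + 1 \<in> J"
    using St_J[OF assms(1)] St_pred[OF assms(1)] by auto
  have "ac t (p (s - 1)) = ac t (p s)"
  proof (cases "k = s - 1")
    case False
    then have k: "ac t (p (s + 1)) = ac t (p s)" using assms(2,3) by simp
    have "co t (p s) \<noteq> co t (p (s + 1))"
      using adj'[OF J(2,3)] k unfolding adj_iff[of _ _ t] by (elim disjE conjE) linarith+
    then show ?thesis
      using St_inline(2)[OF assms(1)] unfolding inline_iff[of _ _ _ t] by metis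
  qed (use assms(3) in simp)
  then have "inline (p (s - 1)) (p s) T"
    using T unfolding inline_iff[of _ _ _ t] by simp
  then show False using St_T(2)[OF assms(1)] by blast
qed

lemma single:
  assumes "i \<in> J"
  shows "\<exists>K \<in> family. K \<subseteq> I \<and> (\<forall>x \<in> cell (p i). \<forall>y \<in> cell (p i). minor x y \<in> K) \<and>
    (i \<in> St \<longrightarrow> (\<forall>x \<in> cell T \<union> cell (p i). \<forall>y \<in> cell T \<union> cell (p i). minor x y \<in> K))"
proof -
  \<comment> \<open>A single cell is a run in either direction; the one chosen has the attached cell
    standing across it.\<close>
  obtain t where t: "i \<in> St \<Longrightarrow> ac t T \<noteq> ac t (p i)"
  proof (cases "fst T = fst (p i)")
    case True
    then have "snd T \<noteq> snd (p i)" if "i \<in> St"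
      using St_T(1)[OF that] by (auto simp: adj_def)
    then show ?thesis using that[of False] by (simp add: ac_def)
  next
    case False
    then show ?thesis using that[of True] by (simp add: ac_def)
  qed
  have "\<exists>K \<in> family. K \<subseteq> I \<and>
    (\<forall>k \<in> {i..i}. \<forall>k' \<in> {i..i}. \<forall>x \<in> cell (p k). \<forall>y \<in> cell (p k'). minor x y \<in> K) \<and>
    (\<forall>k \<in> St \<inter> {i..i}. \<forall>x \<in> cell T \<union> cell (p k). \<forall>y \<in> cell T \<union> cell (p k). minor x y \<in> K)"
    by (rule run[of i i t "ac t (p i)"]) (use assms t in auto)
  then obtain K where K: "K \<in> family" "K \<subseteq> I \<and>
    (\<forall>k \<in> {i..i}. \<forall>k' \<in> {i..i}. \<forall>x \<in> cell (p k). \<forall>y \<in> cell (p k'). minor x y \<in> K) \<and>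
    (\<forall>k \<in> St \<inter> {i..i}. \<forall>x \<in> cell T \<union> cell (p k). \<forall>y \<in> cell T \<union> cell (p k). minor x y \<in> K)"
    by (rule bexE)
  note K1 = K(2)[THEN conjunct2, THEN conjunct1, rule_format, of i i]
    and K2 = K(2)[THEN conjunct2, THEN conjunct2, rule_format, of i]
  show ?thesis
  proof (intro bexI[OF _ K(1)] conjI ballI impI)
    show "K \<subseteq> I" using K(2) by (rule conjunct1)
    show "minor x y \<in> K" if "x \<in> cell (p i)" "y \<in> cell (p i)" for x y
      by (rule K1[OF _ _ that]) simp_all
    show "minor x y \<in> K" if "i \<in> St" "x \<in> cell T \<union> cell (p i)" "y \<in> cell T \<union> cell (p i)" for x y
      by (rule K2[OF _ that(2,3)]) (use that(1) in simp)
  qed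
qed

text \<open>A block of two by two cells is a cycle of four adjacent cells. As the attached cell has
  only one neighbour, the block would lie on the path and close up after four steps, against
  \<open>ne4\<close>.\<close>

lemma inner_interval_thin:
  assumes "inner_interval (cell ` Q) a b"
  shows "fst b = fst a + 1 \<or> snd b = snd a + 1"
proof (rule ccontr)
  assume "\<not> ?thesis"
  moreover have "fst a < fst b" "snd a < snd b"
    using assms by (auto simp: inner_interval_def proper_interval_def)
  ultimately have ab: "fst a + 1 < fst b" "snd a + 1 < snd b" by auto
  let ?a10 = "(fst a + 1, snd a)" and ?a01 = "(fst a, snd a + 1)" and ?a11 = "(fst a + 1, snd a + 1)"
  have inQ: "a \<in> Q" "?a10 \<in> Q" "?a01 \<in> Q" "?a11 \<in> Q"
    using ab by (auto intro: inner_interval_cells[OF assms])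
  have adjs: "adj a ?a10" "adj a ?a01" "adj ?a10 ?a11" "adj ?a01 ?a11"
    by (auto simp: adj_def)
  have notT: "q \<noteq> T" if "St \<noteq> {}" "adj q q1" "adj q q2" "q1 \<noteq> q2" "q1 \<in> Q" "q2 \<in> Q" for q q1 q2
    using that T_nbr_unique by blast
  have dist: "?a10 \<noteq> ?a01" "a \<noteq> ?a11"
    by (auto simp: prod_eq_iff)
  have J: "a \<in> p ` J" "?a10 \<in> p ` J" "?a01 \<in> p ` J" "?a11 \<in> p ` J"
    using Q_cases[OF inQ(1)] Q_cases[OF inQ(2)] Q_cases[OF inQ(3)] Q_cases[OF inQ(4)]
      notT[OF _ adjs(1,2) dist(1) inQ(2,3)]
      notT[OF _ adj_sym[OF adjs(1)] adjs(3) dist(2) inQ(1,4)]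
      notT[OF _ adj_sym[OF adjs(2)] adjs(4) dist(2) inQ(1,4)]
      notT[OF _ adj_sym[OF adjs(3)] adj_sym[OF adjs(4)] dist(1) inQ(2,3)] by blast+
  obtain i where i: "i \<in> J" "a = p i" using J(1) by blast
  have two: "i + 2 * \<epsilon> \<in> J \<and> ?a11 = p (i + 2 * \<epsilon>)"
    if "i + \<epsilon> \<in> J" "x = p (i + \<epsilon>)" "adj x ?a11" "\<epsilon> \<in> {1, -1}" for x \<epsilon>
    using nbr[OF that(1) J(4)] that dist(2) i by (auto simp: algebra_simps)
  have "\<exists>\<epsilon> \<in> {1, -1}. i + \<epsilon> \<in> J \<and> ?a10 = p (i + \<epsilon>) \<and> i - \<epsilon> \<in> J \<and> ?a01 = p (i - \<epsilon>)"
  proof -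
    have "i - 1 \<in> J \<and> ?a10 = p (i - 1) \<and> i + 1 \<in> J \<and> ?a01 = p (i + 1) \<or>
        i + 1 \<in> J \<and> ?a10 = p (i + 1) \<and> i - 1 \<in> J \<and> ?a01 = p (i - 1)"
      using nbr[OF i(1) J(2)] nbr[OF i(1) J(3)] adjs(1,2) dist(1) unfolding i(2) by metis
    then show ?thesis
    proof
      assume "i - 1 \<in> J \<and> ?a10 = p (i - 1) \<and> i + 1 \<in> J \<and> ?a01 = p (i + 1)"
      then show ?thesis by (intro bexI[of _ "-1"]) simp_all
    next
      assume "i + 1 \<in> J \<and> ?a10 = p (i + 1) \<and> i - 1 \<in> J \<and> ?a01 = p (i - 1)"
      then show ?thesis by (intro bexI[of _ 1]) simp_all
    qed
  qed
  then obtain \<epsilon> :: int where \<epsilon>: "\<epsilon> \<in> {1, -1}" "i + \<epsilon> \<in> J" "?a10 = p (i + \<epsilon>)" "i - \<epsilon> \<in> J" "?a01 = p (i - \<epsilon>)"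
    by blast
  have "i + 2 * \<epsilon> \<in> J \<and> ?a11 = p (i + 2 * \<epsilon>)"
    using two[OF \<epsilon>(2,3) adjs(3) \<epsilon>(1)] .
  moreover have "i + 2 * (- \<epsilon>) \<in> J \<and> ?a11 = p (i + 2 * (- \<epsilon>))"
    using \<epsilon> adjs(4) by (intro two[of _ ?a01]) auto
  moreover have "p (i - 2) \<noteq> p (i + 2)" if "i - 2 \<in> J" "i + 2 \<in> J"
    using ne4[of "i - 2"] that by (simp add: algebra_simps)
  ultimately show False
    using \<epsilon>(1) by (elim insertE emptyE conjE) simp_all
qed

text \<open>A row containing the attached cell has at most two cells, since it cannot go on beyond
  the cell it is attached to. Every other row consists of consecutive indices, possibly in reverse
  order, and is covered by \<open>run\<close>.\<close>

lemma inner_minor_covered: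
  assumes ab: "inner_interval (cell ` Q) a b"
  shows "\<exists>K \<in> family. minor a b \<in> K \<and> K \<subseteq> I"
proof -
  obtain t where t: "ac t b = ac t a + 1"
    using inner_interval_thin[OF ab] by (metis ac_def)
  have co: "co t a < co t b"
    using ab by (auto simp: inner_interval_def proper_interval_def co_def)
  define m where "m = co t b - co t a - 1"
  define q where "q k = mk t (co t a + k) (ac t a)" for k
  have qQ: "q k \<in> Q" if "k \<le> m" for k
  proof (rule inner_interval_cells[OF ab])
    show "fst a \<le> fst (q k)" "fst (q k) < fst b" "snd a \<le> snd (q k)" "snd (q k) < snd b"
      using that t co by (cases t; simp add: q_def mk_def co_def ac_def m_def)+
  qed
  have q_adj: "adj (q k) (q (k + 1))" for k
    by (simp add: q_def adj_iff[of _ _ t])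
  have q_inj: "q k = q k' \<longleftrightarrow> k = k'" for k k'
    by (simp add: q_def)
  have q_row: "ac t (q k) = ac t a" for k
    by (simp add: q_def)
  have a: "a \<in> cell (q 0)"
    by (simp add: q_def)
  have b: "b \<in> cell (q m)"
    using t co by (simp add: q_def m_def cell_iff[of _ _ t])
  show ?thesis
  proof (cases "St \<noteq> {} \<and> T \<in> q ` {..m}")
    case True
    then obtain s k0 where s: "s \<in> St" and k0: "k0 \<le> m" "q k0 = T" by auto
    have sJ: "s \<in> J" using St_J[OF s] by simp
    have nb: "q k = p s" if "k \<le> m" "k = k0 + 1 \<or> k0 = k + 1" for k
    proof -
      have "adj T (q k)"
        using that(2)
      proof
        assume "k = k0 + 1"
        then show ?thesis using q_adj[of k0] unfolding k0(2) by simp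
      next
        assume "k0 = k + 1"
        then show ?thesis using adj_sym[OF q_adj[of k]] k0(2) by simp
      qed
      then show ?thesis using T_nbr_unique[OF _ qQ[OF that(1)] _ s] s by blast
    qed
    have third: False if "k \<le> m" "k' \<le> m" "k = k0 + 1 \<or> k0 = k + 1" "k' = k + 1 \<or> k = k' + 1" "k' \<noteq> k0" for k k'
    proof -
      have ps: "q k = p s" using nb that by blast
      have "q k' \<noteq> T"
        using q_inj[of k' k0] that(5) unfolding k0(2) by simp
      then have "q k' \<in> p ` J"
        using Q_cases[OF qQ[OF that(2)]] by blast
      moreover have "adj (q k) (q k')"
        using that(4) q_adj[of k] adj_sym[OF q_adj[of k']] by metis
      then have "adj (p s) (q k')" unfolding ps .
      ultimately obtain l where l: "l = s - 1 \<or> l = s + 1" "q k' = p l"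
        using nbr[OF sJ] by blast
      have "ac t (p l) = ac t (p s)" "ac t T = ac t (p s)"
        using l(2) ps k0(2) q_row by metis+
      then show False using St_perpendicular[OF s l(1)] by blast
    qed
    have "q k \<in> {T, p s}" if "k \<le> m" for k
    proof (cases "k = k0")
      case False
      have "k = k0 + 1 \<or> k0 = k + 1"
      proof (rule ccontr)
        assume "\<not> ?thesis"
        then have "k0 + 2 \<le> k \<or> k + 2 \<le> k0" using False by auto
        then show False
        proof
          assume "k0 + 2 \<le> k"
          then show False
            by (intro third[of "k0 + 1" "k0 + 2"]) (use that in simp_all)
        next
          assume "k + 2 \<le> k0"
          then show False
            by (intro third[of "k0 - 1" "k0 - 2"]) (use k0(1) in linarith)+
        qed
      qed
      then show ?thesis using nb[OF that] by blast
    qed (use k0 in simp)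
    then have "a \<in> cell T \<union> cell (p s)" "b \<in> cell T \<union> cell (p s)"
      using a b by (metis UnI1 UnI2 empty_iff insert_iff le0 order_refl)+
    then show ?thesis using single[OF sJ] s by meson
  next
    case False
    have qJ: "q k \<in> p ` J" if "k \<le> m" for k
      using Q_cases[OF qQ[OF that]] False that by blast
    have "\<exists>i. \<exists>\<epsilon> \<in> {1, -1}. \<forall>k \<le> m. i + \<epsilon> * int k \<in> J \<and> q k = p (i + \<epsilon> * int k)"
      by (rule line) (use qJ q_adj q_inj in simp_all)
    then obtain i \<epsilon> where \<epsilon>: "\<epsilon> = 1 \<or> \<epsilon> = -1"
      and i: "\<And>k. k \<le> m \<Longrightarrow> i + \<epsilon> * int k \<in> J \<and> q k = p (i + \<epsilon> * int k)"
      by blast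
    show ?thesis
    proof (cases "m = 0")
      case True
      have iJ: "i \<in> J" and "q 0 = p i" using i[of 0] by simp_all
      then have "a \<in> cell (p i)" "b \<in> cell (p i)"
        using a b unfolding True by simp_all
      then show ?thesis using single[OF iJ] by blast
    next
      case m: False
      define l where "l = min i (i + \<epsilon> * int m)"
      define h where "h = max i (i + \<epsilon> * int m)"
      have lh: "h = l + int m" using \<epsilon> by (auto simp: l_def h_def)
      have idx: "\<exists>k' \<le> m. k = i + \<epsilon> * int k'" if "k \<in> {l..h}" for k
        using \<epsilon>
      proof
        assume "\<epsilon> = 1"
        then show ?thesis
          using that by (intro exI[of _ "nat (k - i)"]) (auto simp: l_def h_def)
      next
        assume "\<epsilon> = -1"
        then show ?thesis
          using that by (intro exI[of _ "nat (i - k)"]) (auto simp: l_def h_def)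
      qed
      have row: "ac t (p k) = ac t a" if "k \<in> {l..h}" for k
        using idx[OF that] i q_row by metis
      have lhJ: "l \<in> J" "h \<in> J"
        using i[of 0] i[of m] by (auto simp: l_def h_def min_def max_def)
      have perp: "ac t T \<noteq> ac t a" if k: "k \<in> St" "k \<in> {l..h}" for k
      proof -
        have "k - 1 \<in> {l..h} \<or> k + 1 \<in> {l..h}"
          using k(2) m lh by auto
        then obtain k' where k': "k' = k - 1 \<or> k' = k + 1" "k' \<in> {l..h}" by blast
        show ?thesis
          using St_perpendicular[OF k(1) k'(1), of t] row[OF k'(2)] row[OF k(2)] by simp
      qed
      have "\<exists>K \<in> family. K \<subseteq> I \<and>
        (\<forall>k \<in> {l..h}. \<forall>k' \<in> {l..h}. \<forall>x \<in> cell (p k). \<forall>y \<in> cell (p k'). minor x y \<in> K) \<and>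
        (\<forall>k \<in> St \<inter> {l..h}. \<forall>x \<in> cell T \<union> cell (p k). \<forall>y \<in> cell T \<union> cell (p k). minor x y \<in> K)"
        by (rule run[OF _ lhJ row perp]) (simp add: lh)
      then obtain K where K: "K \<in> family" "K \<subseteq> I"
        "\<And>k k' x y. k \<in> {l..h} \<Longrightarrow> k' \<in> {l..h} \<Longrightarrow> x \<in> cell (p k) \<Longrightarrow> y \<in> cell (p k') \<Longrightarrow> minor x y \<in> K"
        by metis
      have "a \<in> cell (p i)" "b \<in> cell (p (i + \<epsilon> * int m))"
        using a b i[of 0] i[of m] by auto
      then have "minor a b \<in> K"
        by (rule K(3)[rotated 2]) (auto simp: l_def h_def)
      then show ?thesis using K(1,2) by blast
    qed
  qed
qed

end

section \<open>Chessboard parity, common edges and weakly closed paths\<close>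

lemma adj_odd: "adj a b \<Longrightarrow> odd (fst a + snd a + (fst b + snd b))"
  unfolding adj_def by (elim disjE conjE) simp_all

text \<open>Adjacent cells have opposite chessboard colours, so there are no triangles.\<close>

lemma adj_parity:
  assumes "adj a b" "adj b c"
  shows "\<not> adj a c"
  using adj_odd[OF assms(1)] adj_odd[OF assms(2)] adj_odd[of a c] by auto

lemma adj_common:
  assumes "adj a b"
  shows "\<exists>x y. x \<noteq> y \<and> {x, y} \<subseteq> cell a \<inter> cell b"
  using assms
proof (cases rule: adj_cases)
  case (1 t)
  then show ?thesis
    by (intro exI[of _ "mk t (co t b) (ac t b)"] exI[of _ "mk t (co t b) (ac t b + 1)"])
      (simp add: cell_iff[of _ _ t] del: co_ac_mk(3))
next
  case (2 t)
  then show ?thesis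
    by (intro exI[of _ "mk t (co t a) (ac t a)"] exI[of _ "mk t (co t a) (ac t a + 1)"])
      (simp add: cell_iff[of _ _ t] del: co_ac_mk(3))
qed

lemma opposite_vertex:
  assumes "adj q p" "v \<in> cell q" "v \<notin> cell p"
  obtains u where "u \<in> cell q" "u \<in> cell p" "across p q u = v"
proof -
  have pq: "adj p q" using adj_sym[OF assms(1)] .
  have "\<exists>u. u \<in> cell q \<and> u \<in> cell p \<and> across p q u = v"
    using assms(1)
  proof (cases rule: adj_cases)
    case (1 t)
    have c: "co t v = co t q"
      using assms(2,3) 1 unfolding cell_iff[of _ _ t] by presburger
    have a: "ac t v = ac t q \<or> ac t v = ac t q + 1"
      using assms(2) unfolding cell_iff[of _ _ t] by blast
    \<comment> \<open>The common edge is at \<open>co t p\<close>, and reflection in the middle line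
      of the cells is an involution.\<close>
    have "across p q (mk t (co t p) (2 * ac t q + 1 - ac t v)) = v"
      unfolding shift_along(2)[OF pq 1(1)[symmetric]] vertex_eq_iff[of _ v t] co_ac_mk
      using a 1(2) c by (elim disjE) simp_all
    moreover have "mk t (co t p) (2 * ac t q + 1 - ac t v) \<in> cell q \<inter> cell p"
      unfolding cell_iff[of _ _ t] Int_iff co_ac_mk 1(1)[symmetric]
      using a 1(2) by (elim disjE) simp_all
    ultimately show ?thesis by blast
  next
    case (2 t)
    have c: "co t v = co t q + 1"
      using assms(2,3) 2 unfolding cell_iff[of _ _ t] by presburger
    have a: "ac t v = ac t q \<or> ac t v = ac t q + 1"
      using assms(2) unfolding cell_iff[of _ _ t] by blast
    have "across p q (mk t (co t q) (2 * ac t q + 1 - ac t v)) = v"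
      unfolding shift_along(2)[OF pq 2(1)[symmetric]] vertex_eq_iff[of _ v t] co_ac_mk
      using a 2(2) c by (elim disjE) simp_all
    moreover have "mk t (co t q) (2 * ac t q + 1 - ac t v) \<in> cell q \<inter> cell p"
      unfolding cell_iff[of _ _ t] Int_iff co_ac_mk 2(1)[symmetric]
      using a 2(2) by (elim disjE) simp_all
    ultimately show ?thesis by blast
  qed
  then show ?thesis using that by blast
qed

lemma (in covered_route) knutson_polyomino_ideal:
  assumes "schedule V E labels" "f = schedule.f E" "0 \<in> J"
  shows "knutson_ideal V I"
proof -
  interpret schedule V E labels by fact
  let ?G = "{minor a b | a b. inner_interval (cell ` Q) a b} :: (vertex, 'a) mpoly set"
  have fin: "finite ?G"
  proof -
    have "finite V" using finite_Q by (auto simp: vertices_def cell_def interval_def)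
    moreover have "?G \<subseteq> (\<lambda>(a, b). minor a b) ` (V \<times> V)"
      using inner_interval_corners by force
    ultimately show ?thesis using finite_subset by blast
  qed
  have "inner_interval (cell ` Q) (p 0) (fst (p 0) + 1, snd (p 0) + 1)"
  proof (rule inner_intervalI)
    fix c assume "fst (p 0) \<le> fst c" "fst c < fst (fst (p 0) + 1, snd (p 0) + 1)"
      "snd (p 0) \<le> snd c" "snd c < snd (fst (p 0) + 1, snd (p 0) + 1)"
    then have "c = p 0" by (simp add: prod_eq_iff)
    then show "c \<in> Q" using p_Q[OF assms(3)] by simp
  qed auto
  then have "?G \<noteq> {}" by blast
  moreover have "\<exists>K \<in> knutson_family (mpoly_ring V) f. g \<in> K \<and> K \<subseteq> Idl\<^bsub>mpoly_ring V\<^esub> ?G" if "g \<in> ?G" for g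
    using inner_minor_covered that unfolding polyomino_ideal_eq by blast
  ultimately show ?thesis
    unfolding polyomino_ideal_eq
    using knutson_ideal_Idl[OF fin _ inner_minors_polys] unfolding assms(2) by blast
qed

text \<open>The lower left corners of the cells of a weakly closed path.\<close>

locale wcpath =
  fixes n :: nat and q :: "nat \<Rightarrow> vertex"
  assumes n: "6 \<le> n"
    and q_adj: "i + 1 < n \<Longrightarrow> adj (q i) (q (i + 1))"
    and q_inj: "i < n \<Longrightarrow> j < n \<Longrightarrow> q i = q j \<Longrightarrow> i = j"
    and touch: "\<exists>v. cell (q 0) \<inter> cell (q (n - 1)) = {v}"
    and q_far: "i + 3 \<le> j \<Longrightarrow> j < n \<Longrightarrow> j + 3 \<le> n + i \<Longrightarrow> cell (q i) \<inter> cell (q j) = {}"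
begin

lemma two_apart: "i + 2 < n \<Longrightarrow> cell (q i) \<inter> cell (q (i + 2)) \<subseteq> cell (q (i + 1))"
  using cells_two_apart[OF q_adj[of i] q_adj[of "i + 1"]] q_inj[of i "i + 2"] by auto

end

section \<open>Paths whose ends meet only in the touching vertex\<close>

locale open_wcpath = wcpath +
  assumes open_ends: "cell (q (n - 1)) \<inter> cell (q 1) = {}" "cell (q (n - 2)) \<inter> cell (q 0) = {}"
begin

definition v :: vertex where "v = (THE v. cell (q 0) \<inter> cell (q (n - 1)) = {v})"

lemma v: "cell (q 0) \<inter> cell (q (n - 1)) = {v}"
proof -
  obtain v' where v': "cell (q 0) \<inter> cell (q (n - 1)) = {v'}" using touch by blast
  then have "v = v'" unfolding v_def by simp
  then show ?thesis using v' by simp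
qed

lemma v_cells: "v \<in> cell (q 0)" "v \<in> cell (q (n - 1))" "v \<notin> cell (q 1)"
  using v open_ends(1) by auto

text \<open>The vertex opposite to \<open>v\<close> in the first cell. It lies on the edge towards
  the second cell, whose own minor can therefore be chosen.\<close>

definition u0 :: vertex where
  "u0 = (SOME u. u \<in> cell (q 0) \<and> u \<in> cell (q 1) \<and> across (q 1) (q 0) u = v)"

lemma adj01: "adj (q 0) (q 1)" "adj (q 1) (q 0)"
  using q_adj[of 0] n adj_sym by auto

lemma u0: "u0 \<in> cell (q 0)" "u0 \<in> cell (q 1)" "across (q 1) (q 0) u0 = v"
proof -
  obtain u where "u \<in> cell (q 0) \<and> u \<in> cell (q 1) \<and> across (q 1) (q 0) u = v"
    using opposite_vertex[OF adj01(1) v_cells(1,3)] by blast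
  then have "u0 \<in> cell (q 0) \<and> u0 \<in> cell (q 1) \<and> across (q 1) (q 0) u0 = v"
    unfolding u0_def by (rule someI)
  then show "u0 \<in> cell (q 0)" "u0 \<in> cell (q 1)" "across (q 1) (q 0) u0 = v" by auto
qed

definition w0 :: vertex where "w0 = shift (q 1) (q 0) u0"

lemma w0: "w0 \<in> cell (q 0)" "w0 \<notin> cell (q 1)" "w0 \<noteq> v"
  using shift_new[OF adj01(2) u0(2)] u0(3) by (auto simp: w0_def)

text \<open>The fourth vertex of the first cell, so that \<open>w0\<close> and \<open>w0'\<close>
  form the diagonal avoiding \<open>u0\<close> and \<open>v\<close>.\<close>

definition w0' :: vertex where
  "w0' = (SOME x. x \<in> cell (q 0) \<and> x \<in> cell (q 1) \<and> x \<noteq> u0 \<and>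
    {(fst w0, snd x), (fst x, snd w0)} = {u0, v} \<and> fst w0 \<noteq> fst x \<and> snd w0 \<noteq> snd x)"

lemma w0': "w0' \<in> cell (q 0)" "w0' \<in> cell (q 1)" "w0' \<noteq> u0"
    "{(fst w0, snd w0'), (fst w0', snd w0)} = {u0, v}" "fst w0 \<noteq> fst w0'" "snd w0 \<noteq> snd w0'"
proof -
  obtain x where x: "x \<in> cell (q 1)" "x \<noteq> u0" "x \<in> cell (q 0)"
    "{(fst u0, snd v), (fst v, snd u0)} = {w0, x}"
    using minor_corners[OF adj01(2) u0(2)] u0(1) unfolding u0(3) w0_def by blast
  have "fst u0 \<noteq> fst v" "snd u0 \<noteq> snd v"
    using shift_across_coords[OF adj01(2) u0(2), of False] unfolding u0(3)
    by (simp_all add: co_def ac_def)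
  moreover have "w0 = (fst u0, snd v) \<and> x = (fst v, snd u0) \<or> x = (fst u0, snd v) \<and> w0 = (fst v, snd u0)"
    using x(4) by (auto simp: doubleton_eq_iff)
  ultimately have "{(fst w0, snd x), (fst x, snd w0)} = {u0, v} \<and> fst w0 \<noteq> fst x \<and> snd w0 \<noteq> snd x"
    by (elim disjE conjE) (simp_all add: insert_commute)
  then have "x \<in> cell (q 0) \<and> x \<in> cell (q 1) \<and> x \<noteq> u0 \<and>
    {(fst w0, snd x), (fst x, snd w0)} = {u0, v} \<and> fst w0 \<noteq> fst x \<and> snd w0 \<noteq> snd x"
    using x by blast
  then have "w0' \<in> cell (q 0) \<and> w0' \<in> cell (q 1) \<and> w0' \<noteq> u0 \<and>
    {(fst w0, snd w0'), (fst w0', snd w0)} = {u0, v} \<and> fst w0 \<noteq> fst w0' \<and> snd w0 \<noteq> snd w0'"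
    unfolding w0'_def by (rule someI)
  then show "w0' \<in> cell (q 0)" "w0' \<in> cell (q 1)" "w0' \<noteq> u0"
    "{(fst w0, snd w0'), (fst w0', snd w0)} = {u0, v}" "fst w0 \<noteq> fst w0'" "snd w0 \<noteq> snd w0'"
    by blast+
qed

fun u :: "nat \<Rightarrow> vertex" where
  "u 0 = u0"
| "u (Suc i) = shift (q i) (q (Suc i)) (u i)"

definition w :: "nat \<Rightarrow> vertex" where
  "w i = across (q (i - 1)) (q i) (u (i - 1))"

lemma u_cell: "i < n \<Longrightarrow> u i \<in> cell (q i)"
proof (induction i)
  case (Suc i)
  then show ?case using shift_new(1)[of "q i" "q (Suc i)" "u i"] q_adj[of i] by auto
qed (simp add: u0)

lemma uw_new:
  assumes "1 \<le> i" "i < n"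
  shows "u i \<in> cell (q i)" "u i \<notin> cell (q (i - 1))" "w i \<in> cell (q i)" "w i \<notin> cell (q (i - 1))" "u i \<noteq> w i"
proof -
  obtain j where j: "i = Suc j" using assms(1) by (cases i) auto
  have "adj (q j) (q (Suc j))" "u j \<in> cell (q j)"
    using q_adj[of j] u_cell[of j] assms(2) j by auto
  from shift_new[OF this] show "u i \<in> cell (q i)" "u i \<notin> cell (q (i - 1))" "w i \<in> cell (q i)"
    "w i \<notin> cell (q (i - 1))" "u i \<noteq> w i"
    by (simp_all add: j w_def)
qed

declare u.simps(2) [simp del]

text \<open>Nearby cells are excluded by \<open>two_apart\<close> and most others by
  \<open>q_far\<close>. This leaves three pairs of cells around the closing, of which
  \<open>open_ends\<close> admits only the first and the last cell, meeting in
  \<open>v\<close>.\<close>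

lemma new_disjoint:
  assumes "j < i" "i < n" "x \<in> cell (q i)" "x \<notin> cell (q (i - 1))" "x \<in> cell (q j)"
  shows "j = 0 \<and> i = n - 1 \<and> x = v"
proof -
  have "i \<noteq> j + 1" using assms(4,5) by auto
  moreover have "i \<noteq> j + 2" using two_apart[of j] assms by auto
  ultimately have ij: "j + 3 \<le> i" using assms(1) by simp
  then have "n + j < i + 3"
    using q_far[of j i] assms(2,3,5) by force
  then consider "j = 0" "i = n - 1" | "j = 0" "i = n - 2" | "j = 1" "i = n - 1"
    using assms(2) by linarith
  then show ?thesis
    using assms(3,5) v open_ends by cases auto
qed

lemma w0_only: "i < n \<Longrightarrow> w0 \<in> cell (q i) \<Longrightarrow> i = 0"
proof (rule ccontr)
  assume i: "i < n" "w0 \<in> cell (q i)" "i \<noteq> 0"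
  have "i \<noteq> 1" using w0(2) i(2) by auto
  moreover have "i \<noteq> 2" using two_apart[of 0] w0(1,2) i by (auto simp: numeral_2_eq_2)
  ultimately have "3 \<le> i" using i(3) by simp
  then have "n < i + 3" using q_far[of 0 i] i w0(1) by force
  then consider "i = n - 1" | "i = n - 2" using i(1) by linarith
  then show False
    using i(2) w0(1,3) v open_ends(2) by cases auto
qed

definition Qs :: "vertex set" where "Qs = q ` {..<n}"

abbreviation Vs :: "vertex set" where "Vs \<equiv> vertices (cell ` Qs)"

lemma Vs_I: "i < n \<Longrightarrow> x \<in> cell (q i) \<Longrightarrow> x \<in> Vs"
  by (auto simp: vertices_def Qs_def)

lemma u_corners:
  assumes "i + 1 < n"
  obtains z where "z \<in> cell (q i)" "u i \<in> cell (q (i + 1)) \<Longrightarrow> z \<in> cell (q (i + 1))"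
    "{(fst (u i), snd (w (i + 1))), (fst (w (i + 1)), snd (u i))} = {u (i + 1), z}"
proof -
  obtain z where "z \<in> cell (q i)" "u i \<in> cell (q (i + 1)) \<longrightarrow> z \<in> cell (q (i + 1))"
    "{(fst (u i), snd (w (i + 1))), (fst (w (i + 1)), snd (u i))} = {u (i + 1), z}"
    using minor_corners[OF q_adj[OF assms] u_cell[of i]] assms
    unfolding w_def by (simp add: u.simps(2)) blast
  then show ?thesis using that by blast
qed

text \<open>Every cell after the first contributes the new vertex \<open>w i\<close> and uses up the vertex \<open>u (i - 1)\<close>
  left over from its predecessor. In the first cell, \<open>w0\<close> and its opposite vertex are used, so that
  the touching vertex \<open>v\<close> is still free for the last cell.\<close>

definition E :: "(vertex \<times> vertex) set" where
  "E = insert (w0, w0') ((\<lambda>i. (u i, w (i + 1))) ` {i. i + 1 < n})"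

text \<open>The new vertex \<open>w i\<close> outranks what came before. The first minor is the
  exception: it has \<open>v\<close>, which may be \<open>w (n - 1)\<close>, on its antidiagonal,
  and so \<open>w0\<close> receives a label above all others.\<close>

definition labels :: "(vertex \<times> nat) set" where
  "labels = insert (w0, n + 1) ((\<lambda>i. (w i, i)) ` {1..<n})"

lemma start_vertices: "w0 \<noteq> w0'" "w0 \<noteq> u0" "w0' \<noteq> u0" "u0 \<noteq> v" "w0' \<noteq> v" "w0 \<noteq> v"
  using w0 w0' u0 v_cells by metis+

text \<open>The cell in which a vertex first appears, except that \<open>v\<close> is credited to
  the last cell instead of the first.\<close>

definition fresh :: "nat \<Rightarrow> vertex \<Rightarrow> bool" where
  "fresh i x \<longleftrightarrow> i < n \<and> x \<in> cell (q i) \<and> (if i = 0 then x \<noteq> v else x \<notin> cell (q (i - 1)))"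

lemma fresh_unique: "fresh i x \<Longrightarrow> fresh j x \<Longrightarrow> i = j"
  using new_disjoint[of i j x] new_disjoint[of j i x] unfolding fresh_def
  by (metis linorder_neqE_nat not_less_zero)

lemma fresh_start: "fresh 0 w0" "fresh 0 w0'" "fresh 0 u0"
  using n w0 w0' u0 start_vertices by (simp_all add: fresh_def)

lemma fresh_u: "i < n \<Longrightarrow> fresh i (u i)"
  using fresh_start(3) uw_new(1,2)[of i] by (cases "i = 0") (simp_all add: fresh_def)

lemma fresh_w: "1 \<le> i \<Longrightarrow> i < n \<Longrightarrow> fresh i (w i)"
  using uw_new(3,4)[of i] by (simp add: fresh_def)

lemma u_neq_w:
  assumes ij: "i < n" "1 \<le> j" "j < n"
  shows "u i \<noteq> w j"
proof
  assume eq: "u i = w j"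
  have "i = j"
    using fresh_unique[OF fresh_u[OF ij(1)]] fresh_w[OF ij(2,3)] unfolding eq by blast
  then show False using uw_new(5)[OF ij(2,3)] eq by simp
qed

lemma schedule: "schedule Vs E labels"
proof
  show "finite Vs"
    unfolding vertices_def Qs_def by (auto simp: cell_def interval_def)
  have "finite {i. i + 1 < n}" by (rule finite_subset[of _ "{..n}"]) auto
  then show "finite E" unfolding E_def by simp
  show "finite labels" unfolding labels_def by simp
  have Ecases: "(a = w0 \<and> b = w0') \<or> (\<exists>i. i + 1 < n \<and> a = u i \<and> b = w (i + 1))" if "(a, b) \<in> E" for a b
    using that unfolding E_def by auto
  show "{a, b, (fst a, snd b), (fst b, snd a)} \<subseteq> Vs" if "(a, b) \<in> E" for a b
    using Ecases[OF that]
  proof (elim disjE exE conjE)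
    assume ab: "a = w0" "b = w0'"
    have "{w0, w0', u0, v} \<subseteq> Vs"
      using Vs_I[of 0] n w0(1) w0'(1) u0(1) v_cells(1) by auto
    then show ?thesis using w0'(4) unfolding ab by auto
  next
    fix i assume i: "i + 1 < n" and ab: "a = u i" "b = w (i + 1)"
    obtain z where z: "z \<in> cell (q i)"
      "{(fst (u i), snd (w (i + 1))), (fst (w (i + 1)), snd (u i))} = {u (i + 1), z}"
      using u_corners[OF i] by blast
    have "{u i, w (i + 1), u (i + 1), z} \<subseteq> Vs"
      using Vs_I[of i] Vs_I[of "i + 1"] i u_cell[of i] u_cell[of "i + 1"] uw_new(3)[of "i + 1"] z(1) by simp
    then show ?thesis using z(2) unfolding ab by auto
  qed
  show "a \<noteq> b" if "(a, b) \<in> E" for a b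
    using Ecases[OF that] start_vertices(1) u_neq_w by auto
  show "{a, b} \<inter> {a', b'} = {}"
    if ab: "(a, b) \<in> E" "(a', b') \<in> E" "(a, b) \<noteq> (a', b')" for a b a' b'
  proof -
    have ww: "w0 \<noteq> w i" "w0' \<noteq> w i" if "1 \<le> i" "i < n" for i
      using fresh_unique[OF fresh_start(1), of i] fresh_unique[OF fresh_start(2), of i] fresh_w[OF that] that(1)
      by auto
    have wu: "w0 \<noteq> u i" "w0' \<noteq> u i" if "i < n" for i
      using fresh_unique[OF fresh_start(1), of i] fresh_unique[OF fresh_start(2), of i] fresh_u[OF that]
        start_vertices by (cases "i = 0"; auto)+
    have u_inj: "i = j" if "u i = u j" "i < n" "j < n" for i j
      using fresh_unique[OF fresh_u[OF that(2)]] fresh_u[OF that(3)] that(1) by metis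
    have w_inj: "i = j" if "w i = w j" "i < n" "j < n" "1 \<le> i" "1 \<le> j" for i j
      using fresh_unique[OF fresh_w] fresh_w that by metis
    show ?thesis
      using Ecases[OF ab(1)] Ecases[OF ab(2)]
    proof (elim disjE exE conjE)
      assume "a = w0" "b = w0'" "a' = w0" "b' = w0'"
      then show ?thesis using ab(3) by simp
    next
      fix i assume "i + 1 < n" "a = u i" "b = w (i + 1)" "a' = w0" "b' = w0'"
      then show ?thesis using ww[of "i + 1"] wu[of i] by auto
    next
      fix i assume "i + 1 < n" "a' = u i" "b' = w (i + 1)" "a = w0" "b = w0'"
      then show ?thesis using ww[of "i + 1"] wu[of i] by auto
    next
      fix i j assume *: "i + 1 < n" "a = u i" "b = w (i + 1)" "j + 1 < n" "a' = u j" "b' = w (j + 1)"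
      then have "i \<noteq> j" using ab(3) by auto
      then have "u i \<noteq> u j" "w (i + 1) \<noteq> w (j + 1)"
        using u_inj[of i j] w_inj[of "i + 1" "j + 1"] * by auto
      moreover have "u i \<noteq> w (j + 1)" "u j \<noteq> w (i + 1)"
        using u_neq_w[of i "j + 1"] u_neq_w[of j "i + 1"] * by auto
      ultimately show ?thesis using * by auto
    qed
  qed
  have lab: "x = w0 \<and> k = n + 1 \<or> 1 \<le> k \<and> k < n \<and> x = w k" if "(x, k) \<in> labels" for x k
    using that unfolding labels_def by auto
  show "\<exists>t \<in> {a, b}. \<exists>k > 0. (t, k) \<in> labels \<and>
      (\<forall>k'. ((fst a, snd b), k') \<in> labels \<or> ((fst b, snd a), k') \<in> labels \<longrightarrow> k' < k)"
    if "(a, b) \<in> E" for a b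
    using Ecases[OF that]
  proof (elim disjE exE conjE)
    assume ab: "a = w0" "b = w0'"
    have "k' < n + 1" if "(x, k') \<in> labels" "x \<in> {u0, v}" for x k'
      using lab[OF that(1)] that(2) start_vertices by auto
    moreover have "(fst w0, snd w0') \<in> {u0, v}" "(fst w0', snd w0) \<in> {u0, v}"
      using w0'(4) by blast+
    ultimately have "\<forall>k'. ((fst a, snd b), k') \<in> labels \<or> ((fst b, snd a), k') \<in> labels \<longrightarrow> k' < n + 1"
      unfolding ab by blast
    moreover have "(w0, n + 1) \<in> labels" by (simp add: labels_def)
    ultimately show ?thesis unfolding ab by (intro bexI[of _ w0] exI[of _ "n + 1"]) simp_all
  next
    fix i assume i: "i + 1 < n" and ab: "a = u i" "b = w (i + 1)"
    obtain z where z: "z \<in> cell (q i)" "u i \<in> cell (q (i + 1)) \<Longrightarrow> z \<in> cell (q (i + 1))"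
      "{(fst (u i), snd (w (i + 1))), (fst (w (i + 1)), snd (u i))} = {u (i + 1), z}"
      using u_corners[OF i] by blast
    \<comment> \<open>For \<open>i = 0\<close> the rectangle is the second cell itself, which
      contains neither \<open>w0\<close> nor \<open>v\<close>.\<close>
    have z0: "z \<in> cell (q 1)" if "i = 0" using z(2) u0(2) that by simp
    have "k' < i + 1" if l: "(x, k') \<in> labels" and x: "x \<in> {u (i + 1), z}" for x k'
      using lab[OF l]
    proof (elim disjE conjE)
      assume "x = w0" "k' = n + 1"
      have "x \<noteq> u (i + 1)"
        using fresh_unique[OF fresh_start(1), of "i + 1"] fresh_u[OF i] \<open>x = w0\<close> by auto
      then have "w0 \<in> cell (q i)" using x z(1) \<open>x = w0\<close> by simp
      then have "i = 0" using w0_only[of i] i by simp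
      then show ?thesis using z0 w0(2) x \<open>x \<noteq> u (i + 1)\<close> \<open>x = w0\<close> by simp
    next
      assume k: "1 \<le> k'" "k' < n" "x = w k'"
      have "x \<noteq> u (i + 1)" using u_neq_w[OF i k(1,2)] k(3) by simp
      then have xz: "w k' = z" using x k(3) by simp
      show ?thesis
      proof (rule ccontr)
        assume "\<not> ?thesis"
        then have "i < k'" by simp
        then have "i = 0 \<and> k' = n - 1 \<and> w k' = v"
          using new_disjoint[OF _ k(2) uw_new(3,4)[OF k(1,2)], of i] z(1) xz by simp
        then show False using z0 xz v_cells(3) by simp
      qed
    qed
    moreover have "(fst (u i), snd (w (i + 1))) \<in> {u (i + 1), z}" "(fst (w (i + 1)), snd (u i)) \<in> {u (i + 1), z}"
      using z(3) by blast+
    ultimately have "\<forall>k'. ((fst a, snd b), k') \<in> labels \<or> ((fst b, snd a), k') \<in> labels \<longrightarrow> k' < i + 1"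
      unfolding ab by blast
    moreover have "(w (i + 1), i + 1) \<in> labels" using i by (simp add: labels_def)
    ultimately show ?thesis unfolding ab by (intro bexI[of _ "w (i + 1)"] exI[of _ "i + 1"]) simp_all
  qed
qed

text \<open>The absence of triangles rules out distance two and \<open>q_far\<close> most larger
  distances; the pairs around the closing share at most one vertex, fewer than an edge has.\<close>

lemma adj_Qs:
  assumes "i < n" "j < n" "adj (q i) (q j)"
  shows "j = i + 1 \<or> i = j + 1"
proof -
  have main: "j = i + 1" if ij: "i < j" "j < n" "adj (q i) (q j)" for i j
  proof (rule ccontr)
    assume "j \<noteq> i + 1"
    obtain x y where xy: "x \<noteq> y" "{x, y} \<subseteq> cell (q i) \<inter> cell (q j)"
      using adj_common[OF ij(3)] by blast
    have "j \<noteq> i + 2"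
    proof
      assume j: "j = i + 2"
      then show False
        using adj_parity[OF q_adj[of i] q_adj[of "i + 1"]] ij by simp
    qed
    then have "i + 3 \<le> j" using \<open>i < j\<close> \<open>j \<noteq> i + 1\<close> by simp
    then have "n + i < j + 3" using q_far[of i j] ij(2) xy(2) by force
    then consider "i = 0" "j = n - 1" | "i = 0" "j = n - 2" | "i = 1" "j = n - 1"
      using ij(2) by linarith
    then show False
    proof cases
      case 1
      have "{x, y} \<subseteq> {v}" using xy(2) unfolding 1 v .
      then show ?thesis using xy(1) by simp
    qed (use xy(2) open_ends in auto)
  qed
  have "i \<noteq> j" using assms(3) adj_irrefl by blast
  then show ?thesis
    using main[of i j] main[of j i] assms adj_sym[OF assms(3)] by linarith
qed

theorem knutson: "knutson_ideal Vs (polyomino_ideal (cell ` Qs) :: (vertex, 'k::field) mpoly set)"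
proof -
  interpret S: schedule Vs E labels by (rule schedule)
  interpret B: board Qs "S.f :: (vertex, 'k) mpoly"
  proof
    show "finite Qs" by (simp add: Qs_def)
  qed (rule S.f_polys)
  let ?J = "{0..<int n}" and ?p = "\<lambda>i. q (nat i)" and ?u = "\<lambda>i. u (nat i)"
  have av: "B.avail a b" if "(a, b) \<in> E" for a b
    unfolding B.avail_def using S.PIdl_minor[OF that] .
  interpret R: covered_route Qs "S.f :: (vertex, 'k) mpoly" ?J ?p ?u "{}" undefined
  proof unfold_locales
    show "Qs = ?p ` ?J \<union> (if {} = {} then {} else {undefined})"
    proof -
      have "?p ` ?J = q ` nat ` ?J" by (simp add: image_image)
      also have "nat ` ?J = {..<n}"
      proof (intro equalityI subsetI)
        fix x assume "x \<in> {..<n}"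
        then show "x \<in> nat ` ?J" by (intro image_eqI[of _ _ "int x"]) simp_all
      qed auto
      finally show ?thesis by (simp add: Qs_def)
    qed
    show "adj (?p (i - 1)) (?p i)" if "i - 1 \<in> ?J" "i \<in> ?J" for i
      using q_adj[of "nat (i - 1)"] that by (auto simp: nat_diff_distrib')
    show "?p (i - 2) \<noteq> ?p i" if "i - 2 \<in> ?J" "i \<in> ?J" for i
    proof
      assume "?p (i - 2) = ?p i"
      then have "nat (i - 2) = nat i" using that by (intro q_inj) auto
      then show False using that by simp
    qed
    show "cell (?p (i - 3)) \<inter> cell (?p i) = {}" if "i - 3 \<in> ?J" "i \<in> ?J" for i
      using q_far[of "nat (i - 3)" "nat i"] that n by simp
    show "?u i \<in> cell (?p i)" if "i \<in> ?J" for i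
      using that by (intro u_cell) auto
    show "?u i = shift (?p (i - 1)) (?p i) (?u (i - 1))" if "i - 1 \<in> ?J" "i \<in> ?J" for i
    proof -
      have "nat i = Suc (nat (i - 1))" using that by simp
      then show ?thesis by (simp add: u.simps(2))
    qed
    show "?u i \<in> cell (?p (i + 1))" if "i \<in> ?J" "i - 1 \<notin> ?J" for i
    proof -
      have "i = 0" using that by simp
      then show ?thesis using u0(2) by simp
    qed
    show "B.avail (?p i) (fst (?p i) + 1, snd (?p i) + 1)" if "i \<in> ?J" "i - 1 \<notin> ?J" for i
    proof -
      have i: "i = 0" using that by simp
      have "B.avail w0 w0'" by (rule av) (simp add: E_def)
      then show ?thesis
        unfolding i
        using B.avail_cell[of w0 w0' "q 0" False "q 0" "(fst (q 0) + 1, snd (q 0) + 1)"] w0(1) w0'(1,5,6)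
        by (simp add: co_def ac_def cell_iff_fst_snd)
    qed
    show "B.avail (?u (i - 1)) (across (?p (i - 1)) (?p i) (?u (i - 1)))" if "i - 1 \<in> ?J" "i \<in> ?J" for i
    proof -
      have i: "nat i = nat (i - 1) + 1" "nat (i - 1) + 1 < n" using that by auto
      have "B.avail (u (nat (i - 1))) (w (nat (i - 1) + 1))"
        using i(2) by (intro av) (auto simp: E_def)
      then show ?thesis unfolding i(1) w_def by simp
    qed
    show "i - 1 \<in> ?J \<and> x = ?p (i - 1) \<or> i + 1 \<in> ?J \<and> x = ?p (i + 1)"
      if i: "i \<in> ?J" and x: "x \<in> ?p ` ?J" and a: "adj (?p i) x" for i x
    proof -
      obtain j where j: "j \<in> ?J" "x = ?p j" using x by blast
      have "nat j = nat i + 1 \<or> nat i = nat j + 1"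
        using i j a by (intro adj_Qs) auto
      then have "j = i + 1 \<or> j = i - 1" using i j by auto
      then show ?thesis using j by blast
    qed
    show "?p i \<noteq> ?p (i + 4)" if "i \<in> ?J" "i + 4 \<in> ?J" for i
    proof
      assume "?p i = ?p (i + 4)"
      then have "nat i = nat (i + 4)" using that by (intro q_inj) auto
      then show False using that by simp
    qed
  qed auto
  show ?thesis
    using n by (intro R.knutson_polyomino_ideal[OF schedule refl]) simp
qed

end

section \<open>Cycles of cells with one attached cell\<close>

text \<open>Otherwise the cells after the first one form a closed cycle, and the first cell \<open>T\<close> is attached
  to it. The cycle is indexed by the integers modulo \<open>N\<close>, starting after a corner, and \<open>T\<close> is
  attached to the cell with index \<open>s\<close>.\<close>

locale cycle_with_stub =
  fixes N :: nat and c :: "int \<Rightarrow> vertex" and s :: int and T :: vertex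
  assumes N: "6 \<le> N"
    and period: "c (i + int N) = c i"
    and c_adj: "adj (c i) (c (i + 1))"
    and c_inj: "c i = c j \<Longrightarrow> (i - j) mod int N = 0"
    and c_far: "3 \<le> d \<Longrightarrow> d \<le> int N - 3 \<Longrightarrow> cell (c i) \<inter> cell (c (i + d)) = {}"
    and inline0: "inline (c (- 1)) (c 0) (c 1)"
    and corner: "\<not> inline (c (- 2)) (c (- 1)) (c 0)"
    and s: "1 \<le> s" "s + 2 \<le> int N"
    and inline_s: "inline (c (s - 2)) (c (s - 1)) (c s)" "inline (c (s - 1)) (c s) (c (s + 1))"
    and T_adj: "adj (c s) T" and T_perp: "\<not> inline (c (s - 1)) (c s) T"
    and T_new: "x \<in> cell T \<Longrightarrow> x \<notin> cell (c s) \<Longrightarrow> x \<notin> cell (c i)"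
    and T_nbr: "adj T (c i) \<Longrightarrow> c i = c s"
begin

lemma c_cong:
  assumes "(i - j) mod int N = 0"
  shows "c i = c j"
proof -
  have up: "c (j + int N * int k) = c j" for j k
  proof (induction k)
    case (Suc k)
    then show ?case using period[of "j + int N * int k"] by (simp add: algebra_simps)
  qed simp
  obtain m where m: "i = j + int N * m" using assms by (metis add.commute diff_add_cancel mod_0_imp_dvd dvdE)
  show ?thesis
  proof (cases "0 \<le> m")
    case True
    then show ?thesis using up[of j "nat m"] m by simp
  next
    case False
    then show ?thesis using up[of i "nat (- m)"] m by simp
  qed
qed

lemma c_mod: "c (i mod int N) = c i"
  by (rule c_cong) (simp add: mod_diff_left_eq)

lemma c_adj': "adj (c (i - 1)) (c i)"
  using c_adj[of "i - 1"] by simp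

lemma c_ne2: "c (i - 2) \<noteq> c i"
proof
  assume "c (i - 2) = c i"
  then have "2 mod int N = 0" using c_inj[of i "i - 2"] by simp
  then show False using N by simp
qed

definition fresh :: "int \<Rightarrow> vertex \<Rightarrow> bool" where
  "fresh i x \<longleftrightarrow> x \<in> cell (c i) \<and> x \<notin> cell (c (i - 1))"

lemma fresh_cong: "(i - j) mod int N = 0 \<Longrightarrow> fresh i x \<longleftrightarrow> fresh j x"
  using c_cong[of i j] c_cong[of "i - 1" "j - 1"] by (simp add: fresh_def)

text \<open>A vertex new at \<open>i\<close> belongs at most to this cell and the next two. It is
  missing from the preceding cell, hence by \<open>cells_two_apart\<close> from the one before, and
  cells farther away are disjoint.\<close>

lemma fresh_near:
  assumes "fresh i x" "x \<in> cell (c j)"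
  shows "(i - j) mod int N \<in> {0, int N - 1, int N - 2}"
proof (rule ccontr)
  let ?d = "(i - j) mod int N"
  assume *: "\<not> ?thesis"
  have "?d < int N" "0 \<le> ?d" using N by auto
  then have d: "1 \<le> ?d" "?d \<le> int N - 3" using * by auto
  have "j + ?d - i = int N * (- ((i - j) div int N))"
    using mult_div_mod_eq[of "int N" "i - j"] by (simp add: algebra_simps)
  then have e: "(j + ?d - i) mod int N = 0"
    by (simp only: mod_mult_self1_is_0)
  have "c (j + ?d) = c i"
    by (rule c_cong[OF e])
  moreover have "c (j + ?d - 1) = c (i - 1)"
  proof (rule c_cong)
    have "j + ?d - 1 - (i - 1) = j + ?d - i" by simp
    then show "(j + ?d - 1 - (i - 1)) mod int N = 0" using e by metis
  qed
  ultimately have x: "x \<in> cell (c (j + ?d))" "x \<notin> cell (c (j + ?d - 1))"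
    using assms(1) by (simp_all add: fresh_def)
  have "?d \<noteq> 1" using x(2) assms(2) by auto
  moreover have "?d \<noteq> 2"
  proof
    assume "?d = 2"
    then have "x \<in> cell (c (j + 2))" "x \<notin> cell (c (j + 1))" using x by (simp_all add: add.commute)
    moreover have "adj (c (j + 1)) (c (j + 2))"
    proof -
      have "j + 1 + 1 = j + 2" by simp
      then show ?thesis using c_adj[of "j + 1"] by metis
    qed
    ultimately show False
      using cells_two_apart[OF c_adj[of j], of "c (j + 2)"] c_ne2[of "j + 2"] assms(2) by auto
  qed
  ultimately have "3 \<le> ?d" using d(1) by simp
  then show False
    using c_far[OF _ d(2), of j] x(1) assms(2) by blast
qed

text \<open>By \<open>fresh_near\<close> both the cyclic distance and its complement would lie in
  {0, N - 1, N - 2}; as N \<ge> 6, only distance 0 is possible.\<close>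

lemma fresh_unique:
  assumes "fresh i x" "fresh j x"
  shows "(i - j) mod int N = 0"
proof (rule ccontr)
  assume d: "(i - j) mod int N \<noteq> 0"
  have 1: "(i - j) mod int N \<in> {0, int N - 1, int N - 2}"
    using fresh_near[OF assms(1)] assms(2) by (simp add: fresh_def)
  have 2: "(j - i) mod int N \<in> {0, int N - 1, int N - 2}"
    using fresh_near[OF assms(2)] assms(1) by (simp add: fresh_def)
  have "(j - i) mod int N = int N - (i - j) mod int N"
    using zmod_zminus1_eq_if[of "i - j" "int N"] d by simp
  then show False using 1 2 d N by auto
qed

lemma mod_eq_imp_eq:
  assumes "(i - j) mod int N = 0" "0 \<le> i" "i < int N" "0 \<le> j" "j < int N"
  shows "i = j"
proof -
  have "i mod int N = j mod int N" using assms(1) by (simp add: mod_eq_dvd_iff mod_eq_0_iff_dvd)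
  then show ?thesis using assms by simp
qed

text \<open>An arbitrary vertex new at the corner with index -1. By
  \<open>corner_shift_unique\<close> the choice is forgotten in the next step, and this is why
  \<open>u\<close>, though defined by recursion, satisfies its recursion also across the end of the
  period.\<close>

definition x0 :: vertex where "x0 = shift (c (- 2)) (c (- 1)) (c (- 2))"

fun u' :: "nat \<Rightarrow> vertex" where
  "u' 0 = shift (c (- 1)) (c 0) x0"
| "u' (Suc i) = shift (c (int i)) (c (int i + 1)) (u' i)"

definition u :: "int \<Rightarrow> vertex" where "u i = u' (nat (i mod int N))"
definition w :: "int \<Rightarrow> vertex" where "w i = across (c (i - 1)) (c i) (u (i - 1))"

lemma x0: "x0 \<in> cell (c (- 1)) - cell (c (- 2))"
  unfolding x0_def using shift_new(1)[of "c (- 2)" "c (- 1)" "c (- 2)"] c_adj[of "- 2"] by simp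

lemma u'_fresh: "fresh (int i) (u' i)"
proof (induction i)
  case 0
  show ?case
    using shift_new(1)[of "c (- 1)" "c 0" x0] c_adj[of "- 1"] x0 by (simp add: fresh_def)
next
  case (Suc i)
  then show ?case
    using shift_new(1)[of "c (int i)" "c (int i + 1)" "u' i"] c_adj[of "int i"]
    by (simp add: fresh_def add.commute)
qed

lemma u_fresh: "fresh i (u i)"
proof -
  have "fresh (i mod int N) (u i)"
    using u'_fresh[of "nat (i mod int N)"] N by (simp add: u_def)
  then show ?thesis
    using fresh_cong[of "i mod int N" i] by (simp add: mod_diff_left_eq)
qed

lemma u_cell: "u i \<in> cell (c i)"
  using u_fresh by (simp add: fresh_def)

lemma u_cong: "(i - j) mod int N = 0 \<Longrightarrow> u i = u j"
  by (simp add: u_def mod_eq_dvd_iff mod_eq_0_iff_dvd flip: mod_eq_dvd_iff)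

lemma w_cong: "(i - j) mod int N = 0 \<Longrightarrow> w i = w j"
  using c_cong[of i j] c_cong[of "i - 1" "j - 1"] u_cong[of "i - 1" "j - 1"] by (simp add: w_def)

lemma u_step: "u i = shift (c (i - 1)) (c i) (u (i - 1))"
proof (cases "i mod int N = 0")
  case True
  have "fresh (- 1) (u (i - 1))"
    using u_fresh[of "i - 1"] fresh_cong[of "i - 1" "- 1"] True by simp
  then have "shift (c (- 1)) (c 0) (u (i - 1)) = shift (c (- 1)) (c 0) x0"
    using corner_shift_unique[of "c (- 2)" "c (- 1)" "c 0" "u (i - 1)" x0] c_adj[of "- 2"] c_adj[of "- 1"]
      corner x0 by (simp add: fresh_def)
  moreover have "c (i - 1) = c (- 1)" "c i = c 0"
    using c_cong[of "i - 1" "- 1"] c_cong[of i 0] True by simp_all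
  ultimately show ?thesis using True by (simp add: u_def)
next
  case False
  have "0 \<le> i mod int N" "i mod int N < int N" using N by auto
  then obtain m where m: "i mod int N = int (Suc m)" "Suc m < N"
    using False by (metis gr0_conv_Suc nat_eq_iff2 nat_less_iff of_nat_0 neq0_conv zero_le_imp_eq_int of_nat_less_iff)
  have i1: "(i - 1) mod int N = int m"
  proof -
    have "(i - 1) mod int N = (i mod int N - 1) mod int N" by (simp add: mod_diff_left_eq)
    also have "\<dots> = int m" using m by simp
    finally show ?thesis .
  qed
  have "c (int m) = c (i - 1)" "c (int m + 1) = c i"
    using c_mod[of "i - 1"] c_mod[of i] i1 m(1) by (simp_all add: add.commute)
  then show ?thesis
    unfolding u_def i1 m(1) nat_int u'.simps by simp
qed

lemma uw_new: "fresh i (w i)" "u i \<noteq> w i"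
  using shift_new[OF c_adj'[of i] u_cell[of "i - 1"]] u_step[of i] by (auto simp: w_def fresh_def)

lemma u_neq_w: "u i \<noteq> w j"
proof
  assume eq: "u i = w j"
  then have "(i - j) mod int N = 0"
    using fresh_unique[OF u_fresh[of i], of j] uw_new(1)[of j] by simp
  then show False using w_cong[of i j] uw_new(2)[of i] eq by simp
qed

lemma u_stays: "inline (c (i - 1)) (c i) (c (i + 1)) \<Longrightarrow> u i \<in> cell (c (i + 1))"
  using inline_stays[OF c_adj'[of i] c_adj[of i]] c_ne2[of "i + 1"] u_fresh[of i]
  by (simp add: fresh_def algebra_simps)

lemma corners:
  obtains z where "z \<in> cell (c (i - 1))" "u (i - 1) \<in> cell (c i) \<Longrightarrow> z \<in> cell (c i)" "z \<noteq> u (i - 1)"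
    "{(fst (u (i - 1)), snd (w i)), (fst (w i), snd (u (i - 1)))} = {u i, z}"
  using minor_corners[OF c_adj'[of i] u_cell[of "i - 1"]] unfolding w_def u_step[of i, symmetric] by blast

lemma inline0_disjoint: "cell (c (- 1)) \<inter> cell (c 1) = {}"
  using inline_disjoint[of "c (- 1)" "c 0" "c 1"] c_adj[of "- 1"] c_adj[of 0] c_ne2[of 1] inline0 by simp

text \<open>Only a vertex from the end of the cycle that reaches over index 0 could violate the
  order. The path is straight at index 0, so the cells with indices -1 and 1 are disjoint, which
  prevents this. For \<open>i = 1\<close> the cell \<open>c 0\<close> can share vertices with
  \<open>c (- 1)\<close>, hence the last premise.\<close>

lemma fresh_earlier:
  assumes "fresh j z" "0 \<le> j" "j < int N" "1 \<le> i" "i < int N" "z \<in> cell (c (i - 1))"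
    and "i = 1 \<Longrightarrow> z \<in> cell (c 1)"
  shows "j \<le> i - 1"
proof (rule ccontr)
  assume "\<not> ?thesis"
  then have ij: "i \<le> j" by simp
  have "(j - (i - 1)) mod int N \<in> {0, int N - 1, int N - 2}"
    using fresh_near[OF assms(1,6)] .
  moreover have "(j - (i - 1)) mod int N = (if j - (i - 1) = int N then 0 else j - (i - 1))"
    using ij assms(3,4) by auto
  ultimately have "j - (i - 1) = int N - 1 \<or> j - (i - 1) = int N - 2"
    using ij assms(3,4) N by (auto split: if_splits)
  then consider "i = 1" "j = int N - 1" | "i = 1" "j = int N - 2" | "i = 2" "j = int N - 1"
    using assms(3,4) by fastforce
  then show False
  proof cases
    case 1
    have "z \<in> cell (c (- 1))" using assms(1) 1 c_cong[of j "- 1"] by (simp add: fresh_def)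
    then show ?thesis using inline0_disjoint assms(7) 1 by blast
  next
    case 2
    have "(j - 1) mod int N = j - 1" using 2 N by (intro mod_pos_pos_trivial) auto
    moreover have "(j - 1) mod int N \<in> {0, int N - 1, int N - 2}"
      using fresh_near[OF assms(1)] assms(7) 2 by blast
    ultimately show ?thesis using N 2 by simp
  next
    case 3
    have "z \<in> cell (c (- 1))" using assms(1) 3 c_cong[of j "- 1"] by (simp add: fresh_def)
    then show ?thesis using inline0_disjoint assms(6) 3 by auto
  qed
qed

definition cols :: "bool \<Rightarrow> vertex \<Rightarrow> nat set" where
  "cols t q = {co t q, co t q + 1}"

text \<open>This is the fourth corner of the minor that closes the cycle. As the mirror image of
  \<open>u (- 1)\<close> it falls on the edge that the corner cell shares with
  \<open>c (- 2)\<close>, so it is older than the corner cell.\<close>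

lemma corner_z:
  assumes "z \<in> {(fst (u (- 1)), snd (w 0)), (fst (w 0), snd (u (- 1)))}" "z \<noteq> u 0"
  shows "\<not> fresh (- 1) z"
proof -
  have a: "adj (c (- 2)) (c (- 1))" "adj (c (- 1)) (c 0)"
    using c_adj[of "- 2"] c_adj[of "- 1"] by simp_all
  have ui: "u (- 1) \<in> cell (c (- 1))" "u (- 1) \<notin> cell (c (- 2))"
    using u_fresh[of "- 1"] by (simp_all add: fresh_def)
  have main: "z \<in> cell (c (- 2))"
    if t: "ac t (c (- 1)) = ac t (c 0)" "co t (c (- 1)) \<noteq> co t (c 0)" for t
  proof -
    have "ac t (c (- 2)) \<noteq> ac t (c (- 1))"
      using corner t(1) unfolding inline_iff[of _ _ _ t] by metis
    then have p: "co t (c (- 2)) = co t (c (- 1))"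
      "ac t (c (- 2)) = ac t (c (- 1)) + 1 \<or> ac t (c (- 1)) = ac t (c (- 2)) + 1"
      using a(1)[unfolded adj_iff[of _ _ t]] by blast+
    have w: "w 0 = mk t (co t (u 0)) (2 * ac t (c 0) + 1 - ac t (u (- 1)))"
      "u 0 = mk t (co t (u 0)) (ac t (u (- 1)))"
      using shift_along[OF a(2) t(1), of "u (- 1)"] u_step[of 0] by (simp_all add: w_def)
    have "z = mk t (co t (u (- 1))) (ac t (w 0)) \<or> z = mk t (co t (w 0)) (ac t (u (- 1)))"
      using assms(1) unfolding corners_mk[of _ _ t] by blast
    then have "z = mk t (co t (u (- 1))) (ac t (w 0))"
      using assms(2) w by (metis co_ac_mk(1))
    then have z: "z = mk t (co t (u (- 1))) (2 * ac t (c 0) + 1 - ac t (u (- 1)))"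
      using w(1) by (metis co_ac_mk(2))
    have "co t (u (- 1)) = co t (c (- 2)) \<or> co t (u (- 1)) = co t (c (- 2)) + 1"
      using ui(1) unfolding cell_iff[of _ _ t] p(1) by blast
    moreover have "ac t (u (- 1)) = ac t (c 0) \<or> ac t (u (- 1)) = ac t (c 0) + 1"
      using ui(1) unfolding cell_iff[of _ _ t] t(1) by blast
    moreover have "\<not> (ac t (u (- 1)) = ac t (c (- 2)) \<or> ac t (u (- 1)) = ac t (c (- 2)) + 1)"
      using ui(2) calculation(1) unfolding cell_iff[of _ _ t] by blast
    ultimately show ?thesis
      using p(2) unfolding z cell_iff[of _ _ t] co_ac_mk t(1) by (elim disjE) simp_all
  qed
  have "z \<in> cell (c (- 2))"
    using a(2)
  proof (cases rule: adj_cases)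
    case (1 t)
    then show ?thesis by (intro main[of t]) simp_all
  next
    case (2 t)
    then show ?thesis by (intro main[of t]) simp_all
  qed
  then show ?thesis by (simp add: fresh_def)
qed

text \<open>The vertices \<open>t1\<close> and \<open>t2\<close> are the two that the attached cell
  adds: \<open>t1\<close> in the column of \<open>u (s - 1)\<close>, \<open>t2\<close> in the common
  column of \<open>u s\<close> and \<open>w s\<close>.\<close>

definition t1 :: vertex where "t1 = shift (c s) T (u (s - 1))"
definition t2 :: vertex where "t2 = shift (c s) T (u s)"

lemma u_s: "u (s - 1) \<in> cell (c s)" "u s \<in> cell (c (s + 1))"
  using u_stays[of "s - 1"] u_stays[of s] inline_s by simp_all

text \<open>Here \<open>t\<close> is the direction of the path at \<open>s\<close>, with
  \<open>T\<close> standing across it, and \<open>R\<close> is the row of the two vertices added by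
  \<open>T\<close>.\<close>

lemma stub_coordinates:
  obtains t R where "ac t (u s) = ac t (u (s - 1))" "co t (w s) = co t (u s)"
    "{co t (u (s - 1)), co t (u s)} = cols t (c s)" "{ac t (u (s - 1)), ac t (w s)} = {ac t (c s), ac t (c s) + 1}"
    "t1 = mk t (co t (u (s - 1))) R" "t2 = mk t (co t (u s)) R" "R \<notin> {ac t (c s), ac t (c s) + 1}"
    "\<And>x. x \<in> cell T \<Longrightarrow> x \<notin> cell (c s) \<Longrightarrow> ac t x = R \<and> co t x \<in> cols t (c s)"
proof -
  note finish = that
  have a: "adj (c (s - 1)) (c s)" using c_adj'[of s] .
  have uc: "u (s - 1) \<in> cell (c (s - 1))" using u_cell .
  have main: thesis
    if t: "ac t (c (s - 1)) = ac t (c s)" and d: "co t (c s) = co t (c (s - 1)) + 1 \<or> co t (c (s - 1)) = co t (c s) + 1" for t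
  proof -
    have "ac t (c s) \<noteq> ac t T"
      using T_perp t unfolding inline_iff[of _ _ _ t] by metis
    then have T: "co t (c s) = co t T" "ac t (c s) = ac t T + 1 \<or> ac t T = ac t (c s) + 1"
      using T_adj[unfolded adj_iff[of _ _ t]] by blast+
    define R where "R = (if ac t (c s) < ac t T then ac t T + 1 else ac t T)"
    have uw: "u s = mk t (co t (u s)) (ac t (u (s - 1)))"
      "w s = mk t (co t (u s)) (2 * ac t (c s) + 1 - ac t (u (s - 1)))"
      "co t (u s) = (if co t (c (s - 1)) < co t (c s) then co t (c s) + 1 else co t (c s))"
      using shift_along[OF a t, of "u (s - 1)"] u_step[of s] by (simp_all add: w_def)
    have us: "co t (u (s - 1)) = (if co t (c (s - 1)) < co t (c s) then co t (c s) else co t (c s) + 1)"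
      using uc u_s(1) d unfolding cell_iff[of _ _ t] by (elim disjE conjE) simp_all
    have ua: "ac t (u (s - 1)) = ac t (c s) \<or> ac t (u (s - 1)) = ac t (c s) + 1"
      using u_s(1) unfolding cell_iff[of _ _ t] by blast
    show thesis
    proof (rule finish[of t R])
      show "ac t (u s) = ac t (u (s - 1))" using uw(1) by (metis co_ac_mk(2))
      show "co t (w s) = co t (u s)" using uw(2) by (metis co_ac_mk(1))
      show "{co t (u (s - 1)), co t (u s)} = cols t (c s)"
        unfolding us uw(3) cols_def by auto
      have "ac t (w s) = 2 * ac t (c s) + 1 - ac t (u (s - 1))" using uw(2) by (metis co_ac_mk(2))
      then show "{ac t (u (s - 1)), ac t (w s)} = {ac t (c s), ac t (c s) + 1}"
        using ua by (elim disjE) (simp_all add: insert_commute)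
      show "t1 = mk t (co t (u (s - 1))) R" "t2 = mk t (co t (u s)) R"
        unfolding t1_def t2_def R_def using shift_across[OF T_adj T(1)] by simp_all
      show "R \<notin> {ac t (c s), ac t (c s) + 1}"
        unfolding R_def using T(2) by (elim disjE) simp_all
      fix x assume x: "x \<in> cell T" "x \<notin> cell (c s)"
      have cx: "co t x = co t (c s) \<or> co t x = co t (c s) + 1"
        using x(1) T(1) unfolding cell_iff[of _ _ t] by simp
      have "ac t x = ac t T \<or> ac t x = ac t T + 1" "\<not> (ac t x = ac t (c s) \<or> ac t x = ac t (c s) + 1)"
        using x cx unfolding cell_iff[of _ _ t] by blast+
      then have "ac t x = R"
        unfolding R_def using T(2) by (elim disjE) simp_all
      then show "ac t x = R \<and> co t x \<in> cols t (c s)"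
        using cx by (simp add: cols_def)
    qed
  qed
  show thesis
    using a
  proof (cases rule: adj_cases)
    case (1 t)
    then show thesis by (intro main[of t]) simp_all
  next
    case (2 t)
    then show thesis by (intro main[of t]) simp_all
  qed
qed

definition Qs :: "vertex set" where "Qs = range c \<union> {T}"

abbreviation Vs :: "vertex set" where "Vs \<equiv> vertices (cell ` Qs)"

lemma finite_Qs: "finite Qs"
proof -
  have "range c \<subseteq> c ` {0..<int N}"
  proof
    fix x assume "x \<in> range c"
    then obtain i where "x = c (i mod int N)" using c_mod by auto
    then show "x \<in> c ` {0..<int N}" using N by auto
  qed
  then show ?thesis using finite_subset unfolding Qs_def by blast
qed

lemma Vs_I: "x \<in> cell (c i) \<Longrightarrow> x \<in> Vs" "x \<in> cell T \<Longrightarrow> x \<in> Vs"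
  by (auto simp: vertices_def Qs_def)

lemma t12: "t1 \<in> cell T" "t1 \<notin> cell (c i)" "t2 \<in> cell T" "t2 \<notin> cell (c i)" "t1 \<noteq> t2"
proof -
  have 1: "t1 \<in> cell T - cell (c s)" "t2 \<in> cell T - cell (c s)"
    unfolding t1_def t2_def using shift_new(1)[OF T_adj] u_s(1) u_cell[of s] by blast+
  then show "t1 \<in> cell T" "t1 \<notin> cell (c i)" "t2 \<in> cell T" "t2 \<notin> cell (c i)"
    using T_new by blast+
  show "t1 \<noteq> t2"
  proof (rule stub_coordinates)
    fix t R assume "{co t (u (s - 1)), co t (u s)} = cols t (c s)"
      and t: "t1 = mk t (co t (u (s - 1))) R" "t2 = mk t (co t (u s)) R"
    then have "co t (u (s - 1)) \<noteq> co t (u s)"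
      unfolding cols_def by (metis Suc_eq_plus1 doubleton_eq_iff n_not_Suc_n)
    then show ?thesis unfolding t by simp
  qed
qed

lemma uw_neq_t: "u i \<noteq> t1" "u i \<noteq> t2" "w i \<noteq> t1" "w i \<noteq> t2"
  using u_cell[of i] uw_new(1)[of i] t12 by (auto simp: fresh_def)

text \<open>The cell at \<open>s\<close> gives up its own minor. Instead the row of
  \<open>t1\<close> and \<open>t2\<close> is paired with each of the two rows of this cell, once by
  the cell \<open>T\<close> and once by the rectangle of both cells; the minor given up follows by
  comparing rows.\<close>

definition E :: "(vertex \<times> vertex) set" where
  "E = (\<lambda>i. (u (i - 1), w i)) ` ({0..<int N} - {s}) \<union> {(w s, t1), (u (s - 1), t2)}"

text \<open>Three slots for each index, in the order \<open>u i\<close>, then \<open>t2\<close> when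
  \<open>i = s\<close>, then \<open>w i\<close>. Away from 0 and \<open>s\<close> the new vertex
  \<open>w i\<close> leads; at \<open>s\<close>, \<open>w s\<close> beats \<open>t2\<close> in one
  minor and \<open>t2\<close> beats \<open>u s\<close> in the other. The minor at index 0 wraps
  around and is led by the old vertex \<open>u (- 1) = u (N - 1)\<close>, for which the
  \<open>u i\<close> are labelled as well.\<close>

definition labels :: "(vertex \<times> nat) set" where
  "labels = (\<lambda>i. (w i, nat (3 * i + 2))) ` {0..<int N} \<union> (\<lambda>i. (u i, nat (3 * i))) ` {0..<int N} \<union>
    {(t2, nat (3 * s + 1))}"

lemma E_cases:
  assumes "(a, b) \<in> E"
  obtains (path) i where "0 \<le> i" "i < int N" "i \<noteq> s" "a = u (i - 1)" "b = w i"
    | (stub1) "a = w s" "b = t1" | (stub2) "a = u (s - 1)" "b = t2"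
proof -
  have "(\<exists>i \<in> {0..<int N} - {s}. a = u (i - 1) \<and> b = w i) \<or> a = w s \<and> b = t1 \<or> a = u (s - 1) \<and> b = t2"
    using assms unfolding E_def image_iff Un_iff insert_iff empty_iff prod.inject by blast
  then show ?thesis
  proof (elim disjE bexE conjE)
    fix i assume "i \<in> {0..<int N} - {s}" "a = u (i - 1)" "b = w i"
    then show ?thesis by (intro path[of i]) auto
  qed (rule stub1 stub2; assumption)+
qed

lemma labels_cases:
  assumes "(x, k) \<in> labels"
  obtains (w) j where "0 \<le> j" "j < int N" "x = w j" "int k = 3 * j + 2"
    | (u) j where "0 \<le> j" "j < int N" "x = u j" "int k = 3 * j"
    | (t2) "x = t2" "int k = 3 * s + 1"
  using assms s(1) unfolding labels_def by auto

lemma u_inj: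
  assumes "u i = u j"
  shows "(i - j) mod int N = 0"
  using fresh_unique[OF u_fresh[of i], of j] u_fresh[of j] unfolding assms by blast

lemma w_inj:
  assumes "w i = w j"
  shows "(i - j) mod int N = 0"
  using fresh_unique[OF uw_new(1)[of i], of j] uw_new(1)[of j] unfolding assms by blast

lemma labels_u:
  assumes "(u i, k) \<in> labels" "0 \<le> i" "i < int N"
  shows "int k = 3 * i"
  using assms(1)
proof (cases rule: labels_cases)
  case (w j)
  then show ?thesis using u_neq_w by blast
next
  case (u j)
  then show ?thesis using mod_eq_imp_eq[OF u_inj[of i j]] assms(2,3) by simp
next
  case t2
  then show ?thesis using uw_neq_t by blast
qed

lemma labels_fresh:
  assumes "(x, k) \<in> labels" "x \<in> cell (c i)"
  obtains j where "0 \<le> j" "j < int N" "fresh j x" "int k \<le> 3 * j + 2"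
  using assms(1)
proof (cases rule: labels_cases)
  case (w j)
  then show ?thesis using uw_new(1)[of j] by (intro that[of j]) simp_all
next
  case (u j)
  then show ?thesis using u_fresh[of j] by (intro that[of j]) simp_all
next
  case t2
  then show ?thesis using t12(4) assms(2) by blast
qed

lemma stub_corners:
  obtains y where "{(fst (w s), snd t1), (fst t1, snd (w s))} = {t2, y}"
    "{(fst (u (s - 1)), snd t2), (fst t2, snd (u (s - 1)))} = {t1, u s}"
    "y \<in> cell (c (s - 1))" "y \<in> cell (c s)"
proof -
  note finish = that
  show thesis
  proof (rule stub_coordinates)
    fix t R
    assume ac: "ac t (u s) = ac t (u (s - 1))" and co: "co t (w s) = co t (u s)"
      and cols: "{co t (u (s - 1)), co t (u s)} = cols t (c s)"
      and t: "t1 = mk t (co t (u (s - 1))) R" "t2 = mk t (co t (u s)) R"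
    have ne: "co t (u (s - 1)) \<noteq> co t (u s)"
      using cols unfolding cols_def by (metis Suc_eq_plus1 doubleton_eq_iff n_not_Suc_n)
    have us: "u s = mk t (co t (u s)) (ac t (u (s - 1)))"
      using ac by (metis co_ac_mk(3))
    obtain z where z: "z \<in> cell (c (s - 1))" "u (s - 1) \<in> cell (c s) \<Longrightarrow> z \<in> cell (c s)"
      "{(fst (u (s - 1)), snd (w s)), (fst (w s), snd (u (s - 1)))} = {u s, z}"
      using corners[of s] by blast
    have "mk t (co t (u (s - 1))) (ac t (w s)) \<in> {u s, z}"
      using z(3) unfolding corners_mk[of _ _ t] by blast
    moreover have "mk t (co t (u (s - 1))) (ac t (w s)) \<noteq> u s"
      using ne by (metis co_ac_mk(1))
    ultimately have zy: "z = mk t (co t (u (s - 1))) (ac t (w s))" by blast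
    show thesis
    proof (rule finish)
      show "z \<in> cell (c (s - 1))" "z \<in> cell (c s)" using z(1,2) u_s(1) by blast+
      show "{(fst (w s), snd t1), (fst t1, snd (w s))} = {t2, z}"
        unfolding corners_mk[of _ _ t] t zy co_ac_mk co by simp
      show "{(fst (u (s - 1)), snd t2), (fst t2, snd (u (s - 1)))} = {t1, u s}"
        unfolding corners_mk[of _ _ t] t co_ac_mk us[symmetric] by simp
    qed
  qed
qed

lemma schedule: "schedule Vs E labels"
proof
  show "finite Vs"
    using finite_Qs unfolding vertices_def by (auto simp: cell_def interval_def)
  show "finite E" unfolding E_def by simp
  show "finite labels" unfolding labels_def by simp
  show "{a, b, (fst a, snd b), (fst b, snd a)} \<subseteq> Vs" if "(a, b) \<in> E" for a b
    using that
  proof (cases rule: E_cases)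
    case (path i)
    obtain z where z: "z \<in> cell (c (i - 1))"
      "{(fst (u (i - 1)), snd (w i)), (fst (w i), snd (u (i - 1)))} = {u i, z}"
      using corners[of i] by blast
    have "{u (i - 1), w i, u i, z} \<subseteq> Vs"
      using Vs_I(1)[OF u_cell[of i]] Vs_I(1)[OF u_cell[of "i - 1"]] Vs_I(1)[OF z(1)] Vs_I(1)[of "w i" i]
        uw_new(1)[of i] by (simp add: fresh_def)
    then show ?thesis using z(2) unfolding path by auto
  next
    case stub1
    obtain y where y: "{(fst (w s), snd t1), (fst t1, snd (w s))} = {t2, y}"
      "{(fst (u (s - 1)), snd t2), (fst t2, snd (u (s - 1)))} = {t1, u s}"
      "y \<in> cell (c (s - 1))" "y \<in> cell (c s)"
      by (rule stub_corners)
    have "{w s, t1, t2, y} \<subseteq> Vs"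
      using Vs_I(1)[OF y(4)] Vs_I(2)[OF t12(1)] Vs_I(2)[OF t12(3)] Vs_I(1)[of "w s" s] uw_new(1)[of s]
      by (simp add: fresh_def)
    then show ?thesis using y(1) unfolding stub1 by auto
  next
    case stub2
    obtain y where y: "{(fst (w s), snd t1), (fst t1, snd (w s))} = {t2, y}"
      "{(fst (u (s - 1)), snd t2), (fst t2, snd (u (s - 1)))} = {t1, u s}"
      "y \<in> cell (c (s - 1))" "y \<in> cell (c s)"
      by (rule stub_corners)
    have "{u (s - 1), t2, t1, u s} \<subseteq> Vs"
      using Vs_I(1)[OF u_cell[of s]] Vs_I(1)[OF u_cell[of "s - 1"]] Vs_I(2)[OF t12(1)] Vs_I(2)[OF t12(3)]
      by simp
    then show ?thesis using y(2) unfolding stub2 by auto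
  qed
  show "a \<noteq> b" if "(a, b) \<in> E" for a b
    using that by (cases rule: E_cases) (use u_neq_w uw_neq_t in auto)
  show "{a, b} \<inter> {a', b'} = {}"
    if ab: "(a, b) \<in> E" "(a', b') \<in> E" "(a, b) \<noteq> (a', b')" for a b a' b'
  proof -
    have u: "u (i - 1) \<noteq> u (j - 1)" if "i \<noteq> j" "0 \<le> i" "i < int N" "0 \<le> j" "j < int N" for i j
      using u_inj[of "i - 1" "j - 1"] mod_eq_imp_eq[of i j] that by auto
    have w: "w i \<noteq> w j" if "i \<noteq> j" "0 \<le> i" "i < int N" "0 \<le> j" "j < int N" for i j
      using w_inj[of i j] mod_eq_imp_eq[of i j] that by auto
    have sN: "0 \<le> s" "s < int N" using s by auto
    show ?thesis
      using ab(1)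
    proof (cases rule: E_cases)
      case (path i)
      note i = this
      show ?thesis
        using ab(2)
      proof (cases rule: E_cases)
        case (path j)
        then have "i \<noteq> j" using i ab(3) by auto
        then show ?thesis
          using u[of i j] w[of i j] i path u_neq_w[of "i - 1" j] u_neq_w[of "j - 1" i] by auto
      next
        case stub1
        then show ?thesis
          using w[OF i(3,1,2) sN] i u_neq_w[of "i - 1" s] uw_neq_t(1)[of "i - 1"] uw_neq_t(3)[of i] by auto
      next
        case stub2
        then show ?thesis
          using u[OF i(3,1,2) sN] i u_neq_w[of "s - 1" i] uw_neq_t(2)[of "i - 1"] uw_neq_t(4)[of i] by auto
      qed
    next
      case stub1
      note i = this
      show ?thesis
        using ab(2)
      proof (cases rule: E_cases)
        case (path j)
        then show ?thesis
          using w[OF path(3,1,2) sN] i u_neq_w[of "j - 1" s] uw_neq_t(1)[of "j - 1"] uw_neq_t(3)[of j] by auto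
      next
        case stub1
        then show ?thesis using i ab(3) by simp
      next
        case stub2
        then show ?thesis
          using i u_neq_w[of "s - 1" s] uw_neq_t(1)[of "s - 1"] uw_neq_t(4)[of s] t12(5) by auto
      qed
    next
      case stub2
      note i = this
      show ?thesis
        using ab(2)
      proof (cases rule: E_cases)
        case (path j)
        then show ?thesis
          using u[OF path(3,1,2) sN] i u_neq_w[of "s - 1" j] uw_neq_t(2)[of "j - 1"] uw_neq_t(4)[of j] by auto
      next
        case stub1
        then show ?thesis
          using i u_neq_w[of "s - 1" s] uw_neq_t(1)[of "s - 1"] uw_neq_t(4)[of s] t12(5) by auto
      next
        case stub2
        then show ?thesis using i ab(3) by simp
      qed
    qed
  qed
  show "\<exists>t \<in> {a, b}. \<exists>k > 0. (t, k) \<in> labels \<and>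
      (\<forall>k'. ((fst a, snd b), k') \<in> labels \<or> ((fst b, snd a), k') \<in> labels \<longrightarrow> k' < k)"
    if "(a, b) \<in> E" for a b
  proof -
    have enough: ?thesis
      if t: "t \<in> {a, b}" "0 < k" "(t, k) \<in> labels" and X: "{(fst a, snd b), (fst b, snd a)} = X"
        and less: "\<And>x k'. (x, k') \<in> labels \<Longrightarrow> x \<in> X \<Longrightarrow> k' < k" for t k X
    proof (intro bexI[OF _ t(1)] exI[of _ k] conjI allI impI t(2,3))
      have X': "(fst a, snd b) \<in> X" "(fst b, snd a) \<in> X" using X by blast+
      fix k' assume "((fst a, snd b), k') \<in> labels \<or> ((fst b, snd a), k') \<in> labels"
      then show "k' < k"
        by (elim disjE) (erule less[OF _ X'(1)], erule less[OF _ X'(2)])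
    qed
    have sN: "0 \<le> s" "s < int N" using s by auto
    show ?thesis
      using that
    proof (cases rule: E_cases)
      case (path i)
      obtain z where z: "z \<in> cell (c (i - 1))" "u (i - 1) \<in> cell (c i) \<Longrightarrow> z \<in> cell (c i)"
        "{(fst (u (i - 1)), snd (w i)), (fst (w i), snd (u (i - 1)))} = {u i, z}"
        using corners[of i] by blast
      show ?thesis
      proof (cases "i = 0")
        case True
        have un: "u (int N - 1) = u (- 1)" by (rule u_cong) simp
        have "(u (int N - 1), nat (3 * (int N - 1))) \<in> labels"
          using N unfolding labels_def by auto
        then have l: "(u (- 1), nat (3 * (int N - 1))) \<in> labels" unfolding un .
        show ?thesis
        proof (rule enough[OF _ _ l])
          show "u (- 1) \<in> {a, b}" using path(4) True by simp
          show "0 < nat (3 * (int N - 1))" using N by simp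
          show "{(fst a, snd b), (fst b, snd a)} = {u 0, z}" using z(3) path(4,5) True by simp
          fix x k' assume k: "(x, k') \<in> labels" and x: "x \<in> {u 0, z}"
          show "k' < nat (3 * (int N - 1))"
          proof (cases "x = u 0")
            case True
            then show ?thesis using labels_u[of 0 k'] k N by simp
          next
            case False
            then have xz: "x = z" "z \<noteq> u 0" using x by auto
            obtain j where j: "0 \<le> j" "j < int N" "fresh j x" "int k' \<le> 3 * j + 2"
              using labels_fresh[OF k] z(1) xz(1) by blast
            have "z \<in> {(fst (u (- 1)), snd (w 0)), (fst (w 0), snd (u (- 1)))}"
              using z(3) True by auto
            \<comment> \<open>So the label of the fourth corner is at most 3 (N - 2) + 2, one below
              the label 3 (N - 1) of \<open>u (- 1)\<close>.\<close>
            then have "\<not> fresh (- 1) z" using corner_z xz(2) by blast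
            moreover have "fresh (int N - 1) z = fresh (- 1) z" by (rule fresh_cong) simp
            ultimately have "j \<noteq> int N - 1" using j(3) xz(1) by auto
            then show ?thesis using j by simp
          qed
        qed
      next
        case False
        have l: "(w i, nat (3 * i + 2)) \<in> labels"
          using path(1,2) unfolding labels_def by auto
        show ?thesis
        proof (rule enough[OF _ _ l])
          show "w i \<in> {a, b}" using path by simp
          show "0 < nat (3 * i + 2)" using path(1) by simp
          show "{(fst a, snd b), (fst b, snd a)} = {u i, z}" using z(3) path(4,5) by simp
          fix x k' assume k: "(x, k') \<in> labels" and x: "x \<in> {u i, z}"
          show "k' < nat (3 * i + 2)"
          proof (cases "x = u i")
            case True
            then show ?thesis using labels_u[of i k'] k path(1,2) by simp
          next
            case neq: False
            then have xz: "x = z" using x by auto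
            obtain j where j: "0 \<le> j" "j < int N" "fresh j x" "int k' \<le> 3 * j + 2"
              using labels_fresh[OF k] z(1) xz by blast
            have "z \<in> cell (c 1)" if "i = 1"
              using z(2) u_stays[of 0] inline0 that by simp
            then have "j \<le> i - 1"
              using fresh_earlier[OF j(3,1,2), of i] path(1,2) False z(1) xz by simp
            then show ?thesis using j(4) by simp
          qed
        qed
      qed
    next
      case stub1
      obtain y where y: "{(fst (w s), snd t1), (fst t1, snd (w s))} = {t2, y}"
        "{(fst (u (s - 1)), snd t2), (fst t2, snd (u (s - 1)))} = {t1, u s}"
        "y \<in> cell (c (s - 1))" "y \<in> cell (c s)"
        by (rule stub_corners)
      have l: "(w s, nat (3 * s + 2)) \<in> labels"
        using sN unfolding labels_def by auto
      show ?thesis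
      proof (rule enough[OF _ _ l])
        show "w s \<in> {a, b}" using stub1 by simp
        show "0 < nat (3 * s + 2)" using s by simp
        show "{(fst a, snd b), (fst b, snd a)} = {t2, y}" using y(1) stub1 by simp
        fix x k' assume k: "(x, k') \<in> labels" and x: "x \<in> {t2, y}"
        show "k' < nat (3 * s + 2)"
        proof (cases "x = t2")
          case True
          show ?thesis
            using k
          proof (cases rule: labels_cases)
            case (w j)
            then show ?thesis using uw_neq_t(4)[of j] True by simp
          next
            case (u j)
            then show ?thesis using uw_neq_t(2)[of j] True by simp
          next
            case t2
            then show ?thesis by simp
          qed
        next
          case False
          then have xy: "x = y" using x by simp
          obtain j where j: "0 \<le> j" "j < int N" "fresh j x" "int k' \<le> 3 * j + 2"
            using labels_fresh[OF k] y(3) xy by blast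
          have "j \<le> s - 1"
            using fresh_earlier[OF j(3,1,2) s(1) sN(2)] y(3,4) xy by auto
          then show ?thesis using j(4) by simp
        qed
      qed
    next
      case stub2
      obtain y where y: "{(fst (w s), snd t1), (fst t1, snd (w s))} = {t2, y}"
        "{(fst (u (s - 1)), snd t2), (fst t2, snd (u (s - 1)))} = {t1, u s}"
        "y \<in> cell (c (s - 1))" "y \<in> cell (c s)"
        by (rule stub_corners)
      have l: "(t2, nat (3 * s + 1)) \<in> labels"
        unfolding labels_def by auto
      show ?thesis
      proof (rule enough[OF _ _ l])
        show "t2 \<in> {a, b}" using stub2 by simp
        show "0 < nat (3 * s + 1)" using s by simp
        show "{(fst a, snd b), (fst b, snd a)} = {t1, u s}" using y(2) stub2 by simp
        fix x k' assume k: "(x, k') \<in> labels" and x: "x \<in> {t1, u s}"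
        show "k' < nat (3 * s + 1)"
        proof (cases "x = u s")
          case True
          then show ?thesis using labels_u[of s k'] k sN by simp
        next
          case False
          then have x1: "x = t1" using x by simp
          show ?thesis
            using k
          proof (cases rule: labels_cases)
            case (w j)
            then show ?thesis using uw_neq_t(3)[of j] x1 by simp
          next
            case (u j)
            then show ?thesis using uw_neq_t(1)[of j] x1 by simp
          next
            case t2
            then show ?thesis using t12(5) x1 by simp
          qed
        qed
      qed
    qed
  qed
qed

end

context cycle_with_stub
begin

text \<open>Cyclic distance two would create a triangle, and cells at larger distance are
  disjoint.\<close>

lemma adj_c:
  assumes "adj (c i) (c j)"
  shows "c j = c (i - 1) \<or> c j = c (i + 1)"
proof -
  let ?d = "(j - i) mod int N"
  have cj: "c j = c (i + ?d)"
  proof (rule c_cong)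
    have "j - (i + ?d) = int N * ((j - i) div int N)"
      using mult_div_mod_eq[of "int N" "j - i"] by (simp add: algebra_simps)
    then show "(j - (i + ?d)) mod int N = 0" by simp
  qed
  have range: "0 \<le> ?d" "?d < int N" using N by auto
  have neg: "c (i + (int N - e)) = c (i - e)" for e
    by (rule c_cong) simp
  have "?d \<noteq> 0"
  proof
    assume "?d = 0"
    then have "c j = c i" using cj by simp
    then show False using assms adj_irrefl[of "c i"] by simp
  qed
  moreover have "?d \<noteq> 2"
  proof
    assume "?d = 2"
    moreover have "i + 1 + 1 = i + 2" by simp
    ultimately have "c j = c (i + 1 + 1)" using cj by metis
    then show False using adj_parity[OF c_adj[of i] c_adj[of "i + 1"]] assms by simp
  qed
  moreover have "?d \<noteq> int N - 2"
  proof
    assume "?d = int N - 2"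
    moreover have "i - 1 - 1 = i - 2" by simp
    ultimately have "c j = c (i - 1 - 1)" using cj neg[of 2] by metis
    then show False
      using adj_parity[OF adj_sym[OF c_adj'[of i]] adj_sym[OF c_adj'[of "i - 1"]]] assms by simp
  qed
  moreover have "\<not> (3 \<le> ?d \<and> ?d \<le> int N - 3)"
    using c_far[of ?d i] cj adj_common[OF assms] by auto
  ultimately have "?d = 1 \<or> ?d = int N - 1" using range by linarith
  then show ?thesis using cj neg[of 1] by auto
qed

theorem knutson: "knutson_ideal Vs (polyomino_ideal (cell ` Qs) :: (vertex, 'k::field) mpoly set)"
proof -
  interpret S: schedule Vs E labels by (rule schedule)
  interpret B: board Qs "S.f :: (vertex, 'k) mpoly"
    by unfold_locales (rule finite_Qs, rule S.f_polys)
  \<comment> \<open>The route is indexed by all integers and winds around the cycle without a start,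
    so it meets the attached cell at every index congruent to \<open>s\<close>.\<close>
  let ?St = "{i. (i - s) mod int N = 0}"
  have av: "B.avail a b" if "(a, b) \<in> E" for a b
    unfolding B.avail_def using S.PIdl_minor[OF that] .
  have sSt: "s \<in> ?St" by simp
  have cs: "c (i + e) = c (s + e)" if "i \<in> ?St" for i e
    using that by (intro c_cong) simp
  have cs': "c (i - e) = c (s - e)" if "i \<in> ?St" for i e
    using cs[OF that, of "- e"] by simp
  have cs0: "c i = c s" if "i \<in> ?St" for i
    using cs[OF that, of 0] by simp
  interpret R: covered_route Qs "S.f :: (vertex, 'k) mpoly" UNIV c u ?St T
  proof unfold_locales
    show "Qs = range c \<union> (if ?St = {} then {} else {T})"
    proof -
      have "?St \<noteq> {}" using sSt by (metis empty_iff)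
      then show ?thesis unfolding Qs_def by (simp only: if_not_P if_False)
    qed
    show "adj (c (i - 1)) (c i)" for i by (rule c_adj')
    show "c (i - 2) \<noteq> c i" for i by (rule c_ne2)
    show "cell (c (i - 3)) \<inter> cell (c i) = {}" for i
      using c_far[of 3 "i - 3"] N by simp
    show "u i \<in> cell (c i)" for i by (rule u_cell)
    show "u i = shift (c (i - 1)) (c i) (u (i - 1))" for i by (rule u_step)
    show "B.avail (u (i - 1)) (across (c (i - 1)) (c i) (u (i - 1)))" if "i \<notin> ?St" for i
    proof -
      let ?r = "i mod int N"
      have "?r \<noteq> s"
      proof
        assume "?r = s"
        then have "(i - s) mod int N = (i - i mod int N) mod int N" by simp
        then show False using that by (simp add: mod_diff_right_eq)
      qed
      then have "(u (?r - 1), w ?r) \<in> E"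
        using N unfolding E_def by auto
      moreover have "w i = w ?r"
        by (rule w_cong) (simp add: mod_diff_right_eq)
      moreover have "u (i - 1) = u (?r - 1)"
        by (rule u_cong) (simp add: mod_diff_right_eq)
      ultimately show ?thesis
        using av unfolding w_def[of i, symmetric] by simp
    qed
    show "inline (c (i - 2)) (c (i - 1)) (c i)" "inline (c (i - 1)) (c i) (c (i + 1))" if "i \<in> ?St" for i
      using inline_s cs[OF that] cs'[OF that] cs0[OF that] by simp_all
    show "adj (c i) T" "\<not> inline (c (i - 1)) (c i) T" if "i \<in> ?St" for i
      using T_adj T_perp cs'[OF that] cs0[OF that] by simp_all
    show "c i = c k" if "i \<in> ?St" "k \<in> ?St" for i k
      using cs0[OF that(1)] cs0[OF that(2)] by simp
    show "B.avail x y"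
      if i: "i \<in> ?St" and x: "x \<in> cell T" "x \<notin> cell (c i)" and y: "y \<in> cell (c i)"
        and ne: "fst x \<noteq> fst y" "snd x \<noteq> snd y" for i x y
    proof (rule stub_coordinates)
      fix t R
      assume ac: "ac t (u s) = ac t (u (s - 1))" and co: "co t (w s) = co t (u s)"
        and cols: "{co t (u (s - 1)), co t (u s)} = cols t (c s)"
        and rows: "{ac t (u (s - 1)), ac t (w s)} = {ac t (c s), ac t (c s) + 1}"
        and t: "t1 = mk t (co t (u (s - 1))) R" "t2 = mk t (co t (u s)) R"
        and far: "\<And>x. x \<in> cell T \<Longrightarrow> x \<notin> cell (c s) \<Longrightarrow> ac t x = R \<and> co t x \<in> cols t (c s)"
      have x': "ac t x = R" "co t x \<in> cols t (c s)"
        using far[of x] x unfolding cs0[OF i] by blast+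
      have y': "co t y \<in> cols t (c s)" "ac t y \<in> {ac t (u (s - 1)), ac t (w s)}"
        using y unfolding cs0[OF i] cell_iff[of _ _ t] rows cols_def by blast+
      have "co t x \<noteq> co t y" using ne by (simp add: co_def)
      then have xy: "{co t x, co t y} = cols t (c s)"
        using x'(2) y'(1) unfolding cols_def by auto
      show ?thesis
        using y'(2)
      proof (elim insertE emptyE)
        assume a: "ac t y = ac t (u (s - 1))"
        have "B.avail (u (s - 1)) t2" by (rule av) (simp add: E_def)
        then show ?thesis
          by (rule B.avail_rect'[of _ _ t]) (use cols in \<open>simp_all add: t xy x'(1) a insert_commute\<close>)
      next
        assume a: "ac t y = ac t (w s)"
        have "B.avail (w s) t1" by (rule av) (simp add: E_def)
        then show ?thesis
          by (rule B.avail_rect'[of _ _ t]) (use cols in \<open>simp_all add: t co xy x'(1) a insert_commute\<close>)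
      qed
    qed
    show "i - 1 \<in> UNIV \<and> x = c (i - 1) \<or> i + 1 \<in> UNIV \<and> x = c (i + 1)"
      if "x \<in> range c" "adj (c i) x" for i x
      using adj_c that by blast
    show "c i \<noteq> c (i + 4)" for i
    proof
      assume "c i = c (i + 4)"
      then have "4 mod int N = 0" using c_inj[of "i + 4" i] by simp
      then show False using N by simp
    qed
    show "\<exists>i \<in> ?St. x = c i" if "x \<in> range c" "adj T x" for x
      by (rule bexI[OF _ sSt]) (use T_nbr that in blast)
  qed auto
  show ?thesis
    by (rule R.knutson_polyomino_ideal[OF schedule refl UNIV_I])
qed

end

section \<open>Reducing the closed case to a cycle with an attached cell\<close>

lemma single_touch:
  assumes "cell a \<inter> cell b = {v}"
  shows "fst a \<noteq> fst b" "snd a \<noteq> snd b"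
proof -
  have v: "v \<in> cell a" "v \<in> cell b" using assms by auto
  have only: "x = v" if "x \<in> cell a" "x \<in> cell b" for x using assms that by blast
  show "fst a \<noteq> fst b"
  proof
    assume eq: "fst a = fst b"
    have "(fst a, snd v) = v" "(fst a + 1, snd v) = v"
      using v eq by (auto intro!: only simp: cell_iff_fst_snd)
    then show False by (metis fst_conv n_not_Suc_n Suc_eq_plus1)
  qed
  show "snd a \<noteq> snd b"
  proof
    assume eq: "snd a = snd b"
    have "(fst v, snd a) = v" "(fst v, snd a + 1) = v"
      using v eq by (auto intro!: only simp: cell_iff_fst_snd)
    then show False by (metis snd_conv n_not_Suc_n Suc_eq_plus1)
  qed
qed

lemma inline_of_disjoint:
  assumes "adj a b" "adj b c" "cell a \<inter> cell c = {}"
  shows "inline a b c"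
  using assms(1)
proof (cases rule: adj_cases)
  case (1 t)
  show ?thesis
  proof (rule ccontr)
    assume "\<not> ?thesis"
    then have c: "co t b = co t c" "ac t b = ac t c + 1 \<or> ac t c = ac t b + 1"
      using assms(2) 1 unfolding inline_iff[of _ _ _ t] adj_iff[of b c t] by metis+
    have "mk t (co t b) (max (ac t b) (ac t c)) \<in> cell a \<inter> cell c"
      using 1 c unfolding cell_iff[of _ _ t] Int_iff co_ac_mk by (elim disjE) simp_all
    then show False using assms(3) by blast
  qed
next
  case (2 t)
  show ?thesis
  proof (rule ccontr)
    assume "\<not> ?thesis"
    then have c: "co t b = co t c" "ac t b = ac t c + 1 \<or> ac t c = ac t b + 1"
      using assms(2) 2 unfolding inline_iff[of _ _ _ t] adj_iff[of b c t] by metis+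
    have "mk t (co t a) (max (ac t b) (ac t c)) \<in> cell a \<inter> cell c"
      using 2 c unfolding cell_iff[of _ _ t] Int_iff co_ac_mk by (elim disjE) simp_all
    then show False using assms(3) by blast
  qed
qed

text \<open>The side step at \<open>c\<close> keeps the coordinate along the straight part, in which
  \<open>a\<close> and \<open>c\<close> differ by two.\<close>

lemma branch_disjoint:
  assumes "adj a b" "adj b c" "a \<noteq> c" "inline a b c" "adj c d" "\<not> inline b c d"
  shows "cell a \<inter> cell d = {}"
proof -
  have main: ?thesis if t: "ac t b = ac t c" "co t b \<noteq> co t c" for t
  proof -
    have ab: "ac t a = ac t b"
      using assms(4) t unfolding inline_iff[of _ _ _ t] by metis
    have co: "co t a = co t c + 2 \<or> co t c = co t a + 2"
    proof -
      have "co t a \<noteq> co t c" using assms(3) ab t(1) unfolding vertex_eq_iff[of a c t] by simp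
      moreover have "co t a = co t b + 1 \<or> co t b = co t a + 1"
        using assms(1) ab unfolding adj_iff[of a b t] by auto
      moreover have "co t b = co t c + 1 \<or> co t c = co t b + 1"
        using assms(2) t unfolding adj_iff[of b c t] by blast
      ultimately show ?thesis by linarith
    qed
    have "ac t c \<noteq> ac t d" using assms(6) t(1) unfolding inline_iff[of _ _ _ t] by metis
    then have "co t d = co t c" using assms(5) unfolding adj_iff[of c d t] by simp
    then have "co t a = co t d + 2 \<or> co t d = co t a + 2" using co by simp
    then show ?thesis
      unfolding disjoint_iff cell_iff[of _ _ t] by (elim disjE) auto
  qed
  show ?thesis
    using assms(2)
  proof (cases rule: adj_cases)
    case (1 t)
    then show ?thesis by (intro main[of t]) simp_all
  next
    case (2 t)
    then show ?thesis by (intro main[of t]) simp_all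
  qed
qed

text \<open>The first cell of the path is attached to the side of the second one, which shares an edge
  with the last one.\<close>

locale closed_wcpath = wcpath +
  assumes closed_ends: "cell (q (n - 1)) \<inter> cell (q 1) \<noteq> {}"
begin

lemma adj01: "adj (q 0) (q 1)"
  using q_adj[of 0] n by simp

lemma adj12: "adj (q 1) (q 2)"
  using q_adj[of 1] n by (simp add: numeral_2_eq_2)

lemma first_last: "fst (q 0) \<noteq> fst (q (n - 1))" "snd (q 0) \<noteq> snd (q (n - 1))"
  using touch single_touch by metis+

text \<open>The last cell is a diagonal neighbour of the first one. Meeting also the second cell, it
  must lie on the same side of the first cell as the second, hence directly beside the
  latter.\<close>

lemma adj_last: "adj (q (n - 1)) (q 1)"
proof -
  obtain v where v: "v \<in> cell (q 0)" "v \<in> cell (q (n - 1))"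
    using touch by blast
  obtain w where w: "w \<in> cell (q (n - 1))" "w \<in> cell (q 1)"
    using closed_ends by blast
  have main: ?thesis if t: "ac t (q 0) = ac t (q 1)" "co t (q 1) = co t (q 0) + 1 \<or> co t (q 0) = co t (q 1) + 1" for t
  proof -
    have ne: "co t (q 0) \<noteq> co t (q (n - 1))" "ac t (q 0) \<noteq> ac t (q (n - 1))"
      using first_last by (simp_all add: co_def ac_def)
    have "ac t (q (n - 1)) = ac t (q 1) + 1 \<or> ac t (q 1) = ac t (q (n - 1)) + 1"
    proof -
      have "ac t v = ac t (q 0) \<or> ac t v = ac t (q 0) + 1" "ac t v = ac t (q (n - 1)) \<or> ac t v = ac t (q (n - 1)) + 1"
        using v unfolding cell_iff[of _ _ t] by blast+
      then show ?thesis using ne(2) t(1) by (elim disjE) linarith+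
    qed
    moreover have "co t (q (n - 1)) = co t (q 1)"
    proof -
      have "co t v = co t (q 0) \<or> co t v = co t (q 0) + 1" "co t v = co t (q (n - 1)) \<or> co t v = co t (q (n - 1)) + 1"
        "co t w = co t (q (n - 1)) \<or> co t w = co t (q (n - 1)) + 1" "co t w = co t (q 1) \<or> co t w = co t (q 1) + 1"
        using v w unfolding cell_iff[of _ _ t] by blast+
      then show ?thesis using ne(1) t(2) by (elim disjE) linarith+
    qed
    ultimately show ?thesis unfolding adj_iff[of _ _ t] by blast
  qed
  show ?thesis
    using adj01
  proof (cases rule: adj_cases)
    case (1 t)
    then show ?thesis by (intro main[of t]) simp_all
  next
    case (2 t)
    then show ?thesis by (intro main[of t]) simp_all
  qed
qed

text \<open>A closed path of adjacent cells has even length.\<close>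

lemma n7: "7 \<le> n"
proof (rule ccontr)
  assume "\<not> ?thesis"
  then have 6: "n = 6" using n by simp
  define e where "e i = even (fst (q i) + snd (q i))" for i
  have a: "e i \<noteq> e (i + 1)" if "i + 1 < n" for i
    using adj_odd[OF q_adj[OF that]] unfolding e_def even_add[of "fst (q i) + snd (q i)"] .
  have b: "e (n - 1) \<noteq> e 1"
    using adj_odd[OF adj_last] unfolding e_def even_add[of "fst (q (n - 1)) + snd (q (n - 1))"] .
  have s: "1 + 1 = (2::nat)" "2 + 1 = (3::nat)" "3 + 1 = (4::nat)" "4 + 1 = (5::nat)" "6 - 1 = (5::nat)"
    by simp_all
  show False
    using a[of 1] a[of 2] a[of 3] a[of 4] b unfolding 6 s by auto
qed

lemma ne_q: "i < n \<Longrightarrow> j < n \<Longrightarrow> i \<noteq> j \<Longrightarrow> q i \<noteq> q j"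
  using q_inj by blast

text \<open>At a bend the outer cells would share a vertex, but here they are disjoint by
  \<open>q_far\<close>.\<close>

lemma inline_ends: "inline (q (n - 1)) (q 1) (q 2)" "inline (q (n - 2)) (q (n - 1)) (q 1)"
proof -
  have "cell (q 2) \<inter> cell (q (n - 1)) = {}" using q_far[of 2 "n - 1"] n by simp
  then show "inline (q (n - 1)) (q 1) (q 2)"
    using inline_of_disjoint[OF adj_last adj12] by blast
  have "adj (q (n - 2)) (q (n - 1))"
    using q_adj[of "n - 2"] n by (simp add: Suc_diff_Suc numeral_2_eq_2)
  moreover have "cell (q 1) \<inter> cell (q (n - 2)) = {}" using q_far[of 1 "n - 2"] n by simp
  ultimately show "inline (q (n - 2)) (q (n - 1)) (q 1)"
    using inline_of_disjoint[OF _ adj_last] by blast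
qed

lemma not_inline_first: "\<not> inline (q (n - 1)) (q 1) (q 0)"
  using first_last by (auto simp: inline_def)

lemma adj_penultimate: "adj (q (n - 2)) (q (n - 1))"
  using q_adj[of "n - 2"] n by (simp add: Suc_diff_Suc numeral_2_eq_2)

definition corners :: "nat set" where
  "corners = {k \<in> {2..n - 2}. \<not> inline (q (k - 1)) (q k) (q (k + 1))}"

text \<open>A straight row of cells cannot close up. Without a corner, the path would leave
  \<open>q 1\<close> on one side and come back to it on the other; on the way it would have to cross
  the column of \<open>q 1\<close>, repeating a cell.\<close>

lemma corners_nonempty: "corners \<noteq> {}"
proof
  assume empty: "corners = {}"
  obtain t where t: "ac t (q 1) = ac t (q 2)"
    using adj12 by (cases rule: adj_cases) auto
  have row: "ac t (q (k + 1)) = ac t (q 1)" if "k + 1 < n" for k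
    using that
  proof (induction k rule: less_induct)
    case (less k)
    consider "k = 0" | "k = 1" | "2 \<le> k" by linarith
    then show ?case
    proof cases
      case 2
      then show ?thesis using t by (simp add: numeral_2_eq_2)
    next
      case 3
      then have "k \<in> {2..n - 2}" using less.prems by auto
      then have il: "inline (q (k - 1)) (q k) (q (k + 1))"
        using empty unfolding corners_def by blast
      have k: "ac t (q (k - 1)) = ac t (q 1)" "ac t (q k) = ac t (q 1)"
        using less.IH[of "k - 2"] less.IH[of "k - 1"] 3 less.prems by (simp_all add: Suc_diff_Suc numeral_2_eq_2)
      have "adj (q (k - 1)) (q k)" using q_adj[of "k - 1"] 3 less.prems by simp
      then have "co t (q (k - 1)) \<noteq> co t (q k)"
        using k unfolding adj_iff[of _ _ t] by (elim disjE conjE) linarith+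
      then show ?thesis using il k unfolding inline_iff[of _ _ _ t] by metis
    qed simp
  qed
  have row': "ac t (q k) = ac t (q 1)" if "1 \<le> k" "k < n" for k
    using row[of "k - 1"] that by simp
  have step: "co t (q (k + 1)) = co t (q k) + 1 \<or> co t (q k) = co t (q (k + 1)) + 1" if "1 \<le> k" "k + 1 < n" for k
    using q_adj[OF that(2)] row'[of k] row'[of "k + 1"] that
    unfolding adj_iff[of _ _ t] by (elim disjE conjE) simp_all
  have co_ne: "co t (q i) \<noteq> co t (q j)" if "1 \<le> i" "i < n" "1 \<le> j" "j < n" "i \<noteq> j" for i j
    using ne_q[OF that(2,4,5)] row'[OF that(1,2)] row'[OF that(3,4)] unfolding vertex_eq_iff[of _ _ t] by simp
  define g where "g k = co t (q (nat k))" for k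
  have last: "co t (q (n - 1)) = co t (q 1) + 1 \<or> co t (q 1) = co t (q (n - 1)) + 1"
    using adj_last row'[of "n - 1"] n unfolding adj_iff[of _ _ t] by auto
  have second: "co t (q 2) = co t (q 1) + 1 \<or> co t (q 1) = co t (q 2) + 1"
    using step[of 1] n by (simp add: numeral_2_eq_2)
  have pen: "co t (q (n - 1)) = co t (q (n - 2)) + 1 \<or> co t (q (n - 2)) = co t (q (n - 1)) + 1"
    using step[of "n - 2"] n by (simp add: Suc_diff_Suc numeral_2_eq_2)
  have "co t (q 2) \<noteq> co t (q (n - 1))" "co t (q (n - 2)) \<noteq> co t (q 1)"
    using co_ne[of 2 "n - 1"] co_ne[of "n - 2" 1] n by auto
  then have "co t (q 2) \<le> co t (q 1) \<and> co t (q 1) \<le> co t (q (n - 2)) \<or>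
      co t (q (n - 2)) \<le> co t (q 1) \<and> co t (q 1) \<le> co t (q 2)"
    using last second pen by linarith
  then obtain k1 k2 where k: "k1 \<in> {2..int n - 2}" "k2 \<in> {2..int n - 2}" "g k1 \<le> co t (q 1)" "co t (q 1) \<le> g k2"
  proof
    assume "co t (q 2) \<le> co t (q 1) \<and> co t (q 1) \<le> co t (q (n - 2))"
    then show thesis
      using n by (intro that[of 2 "int n - 2"]) (simp_all add: g_def nat_diff_distrib)
  next
    assume "co t (q (n - 2)) \<le> co t (q 1) \<and> co t (q 1) \<le> co t (q 2)"
    then show thesis
      using n by (intro that[of "int n - 2" 2]) (simp_all add: g_def nat_diff_distrib)
  qed
  have "\<exists>i \<in> {2..int n - 2}. g i = co t (q 1)"
  proof (rule int_steps_intermediate[OF _ _ k])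
    show "2 \<le> int n - 2" using n by simp
    fix k :: int assume "2 < k" "k \<le> int n - 2"
    then have "nat k = nat (k - 1) + 1" "1 \<le> nat (k - 1)" "nat (k - 1) + 1 < n" by auto
    then show "g k \<le> g (k - 1) + 1 \<and> g (k - 1) \<le> g k + 1"
      using step[of "nat (k - 1)"] unfolding g_def by auto
  qed
  then obtain i where "i \<in> {2..int n - 2}" "co t (q (nat i)) = co t (q 1)"
    unfolding g_def by blast
  moreover from this have "nat i \<noteq> 1" "1 \<le> nat i" "nat i < n" using n by auto
  ultimately show False
    using co_ne[of "nat i" 1] n by simp
qed

text \<open>The last corner is taken so that the path is straight at the following cell, as
  \<open>inline0\<close> demands.\<close>

definition k :: nat where "k = Max corners"

lemma finite_corners: "finite corners"
  unfolding corners_def by simp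

lemma k: "2 \<le> k" "k \<le> n - 2" "\<not> inline (q (k - 1)) (q k) (q (k + 1))"
  using Max_in[OF finite_corners corners_nonempty] unfolding k_def corners_def by auto

lemma after_k: "k < i \<Longrightarrow> i \<le> n - 2 \<Longrightarrow> inline (q (i - 1)) (q i) (q (i + 1))"
proof (rule ccontr)
  assume i: "k < i" "i \<le> n - 2" "\<not> inline (q (i - 1)) (q i) (q (i + 1))"
  then have "i \<in> corners" using k(1) unfolding corners_def by simp
  then have "i \<le> k" unfolding k_def by (rule Max_ge[OF finite_corners])
  then show False using i(1) by simp
qed

definition N :: nat where "N = n - 1"
text \<open>Cycle index \<open>j\<close> stands for path index k + 1 + j, reduced to the range from
  1 to \<open>N\<close>. The corner receives index -1, and \<open>q 1\<close>, which carries the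
  first cell, receives N - k.\<close>

definition idx :: "int \<Rightarrow> nat" where "idx j = 1 + nat ((int k + j) mod int N)"

lemma idx: "1 \<le> idx j" "idx j < n"
proof -
  have "0 < int N" using n unfolding N_def by simp
  then have "(int k + j) mod int N < int N" "0 \<le> (int k + j) mod int N" by simp_all
  then have "nat ((int k + j) mod int N) < N" by linarith
  then show "1 \<le> idx j" "idx j < n" unfolding idx_def using n N_def by linarith+
qed

lemma idx_eq: "int k + j = m + int N * e \<Longrightarrow> 0 \<le> m \<Longrightarrow> m < int N \<Longrightarrow> idx j = 1 + nat m"
  unfolding idx_def by simp

lemma idx_add:
  assumes "0 \<le> d" "d < int N"
  shows "idx (j + d) = idx j + nat d \<or> idx j + nat d = idx (j + d) + N"
proof -
  let ?m = "(int k + j) mod int N"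
  have m: "0 \<le> ?m" "?m < int N" using assms by auto
  have e: "int k + j = ?m + int N * ((int k + j) div int N)" by simp
  show ?thesis
  proof (cases "?m + d < int N")
    case True
    have "idx (j + d) = 1 + nat (?m + d)"
      by (rule idx_eq[of _ _ "(int k + j) div int N"]) (use e m True assms in \<open>linarith+\<close>)
    then show ?thesis using m assms by (simp add: idx_def nat_add_distrib)
  next
    case False
    have "idx (j + d) = 1 + nat (?m + d - int N)"
    proof (rule idx_eq[of _ _ "(int k + j) div int N + 1"])
      show "int k + (j + d) = ?m + d - int N + int N * ((int k + j) div int N + 1)"
        using e by (simp add: distrib_left)
    qed (use m False assms in linarith)+
    moreover have "nat ?m + nat d = nat (?m + d - int N) + N"
      using m(1) False assms(1) by linarith
    ultimately have "idx j + nat d = idx (j + d) + N" unfolding idx_def[of j] by linarith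
    then show ?thesis ..
  qed
qed

lemma idx_values:
  "idx (- 2) = k - 1" "idx (- 1) = k" "idx 0 = k + 1"
  "idx (int N - int k - 2) = n - 2" "idx (int N - int k - 1) = n - 1"
  "idx (int N - int k) = 1" "idx (int N - int k + 1) = 2"
  using k(1,2) n idx_eq[of "- 2" "int k - 2" 0] idx_eq[of "- 1" "int k - 1" 0] idx_eq[of 0 "int k" 0]
    idx_eq[of "int N - int k - 2" "int N - 2" 0] idx_eq[of "int N - int k - 1" "int N - 1" 0]
    idx_eq[of "int N - int k" 0 1] idx_eq[of "int N - int k + 1" 1 1]
  by (simp_all add: N_def nat_diff_distrib)

lemma q_cycle_far:
  assumes "1 \<le> i" "i < j" "j < n" "3 \<le> j - i" "j - i \<le> n - 4"
  shows "cell (q i) \<inter> cell (q j) = {}"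
  using q_far[of i j] assms by simp

lemma cycle_with_stub: "cycle_with_stub N (\<lambda>j. q (idx j)) (int N - int k) (q 0)"
proof
  show "6 \<le> N" using n7 unfolding N_def by simp
  show "q (idx (i + int N)) = q (idx i)" for i
    unfolding idx_def by (simp add: add.assoc[symmetric])
  show "adj (q (idx i)) (q (idx (i + 1)))" for i
  proof -
    have "idx (i + 1) = idx i + 1 \<or> idx i + 1 = idx (i + 1) + N"
      using idx_add[of 1 i] n unfolding N_def by simp
    then show ?thesis
    proof
      assume "idx (i + 1) = idx i + 1"
      then show ?thesis using q_adj[of "idx i"] idx(2)[of "i + 1"] by simp
    next
      assume "idx i + 1 = idx (i + 1) + N"
      then have "idx i = n - 1" "idx (i + 1) = 1"
        using idx[of i] idx[of "i + 1"] n unfolding N_def by linarith+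
      then show ?thesis using adj_last by simp
    qed
  qed
  show "(i - j) mod int N = 0" if "q (idx i) = q (idx j)" for i j
  proof -
    have "idx i = idx j" using q_inj idx that by blast
    moreover have "0 < int N" using n unfolding N_def by simp
    ultimately have "(int k + i) mod int N = (int k + j) mod int N"
      unfolding idx_def using pos_mod_sign[of "int N"] by (simp add: eq_nat_nat_iff)
    then have "int N dvd (int k + i) - (int k + j)" by (simp only: mod_eq_dvd_iff)
    then show ?thesis by simp
  qed
  show "cell (q (idx i)) \<inter> cell (q (idx (i + d))) = {}" if d: "3 \<le> d" "d \<le> int N - 3" for d i
  proof -
    have "idx (i + d) = idx i + nat d \<or> idx i + nat d = idx (i + d) + N"
      using idx_add[of d i] d by simp
    then show ?thesis
    proof
      assume e: "idx (i + d) = idx i + nat d"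
      then have "idx i < idx (i + d)" "3 \<le> idx (i + d) - idx i" "idx (i + d) - idx i \<le> n - 4"
        using d unfolding N_def by linarith+
      then show ?thesis using q_cycle_far idx by blast
    next
      assume e: "idx i + nat d = idx (i + d) + N"
      then have "idx (i + d) < idx i" "3 \<le> idx i - idx (i + d)" "idx i - idx (i + d) \<le> n - 4"
        using d n unfolding N_def by linarith+
      then show ?thesis using q_cycle_far[of "idx (i + d)" "idx i"] idx by blast
    qed
  qed
  show "inline (q (idx (- 1))) (q (idx 0)) (q (idx 1))"
  proof (cases "k = n - 2")
    case True
    then have "int N - int k = 1" using n unfolding N_def by linarith
    then have "idx 1 = 1" using idx_values(6) by simp
    moreover have "k + 1 = n - 1" using True n by simp
    ultimately show ?thesis
      unfolding idx_values(2,3) using inline_ends(2) True by simp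
  next
    case False
    then have "idx 1 = 1 + nat (int k + 1)"
      using k(2) n by (intro idx_eq[of _ _ 0]) (auto simp: N_def)
    then have "idx 1 = k + 2" by simp
    then show ?thesis
      unfolding idx_values(2,3) using after_k[of "k + 1"] False k(2) n by simp
  qed
  show "\<not> inline (q (idx (- 2))) (q (idx (- 1))) (q (idx 0))"
    unfolding idx_values using k(3) .
  show "1 \<le> int N - int k" "int N - int k + 2 \<le> int N"
    using k(1,2) n unfolding N_def by simp_all
  show "inline (q (idx (int N - int k - 2))) (q (idx (int N - int k - 1))) (q (idx (int N - int k)))"
    "inline (q (idx (int N - int k - 1))) (q (idx (int N - int k))) (q (idx (int N - int k + 1)))"
    unfolding idx_values using inline_ends by simp_all
  show "adj (q (idx (int N - int k))) (q 0)"
    unfolding idx_values using adj_sym[OF adj01] .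
  show "\<not> inline (q (idx (int N - int k - 1))) (q (idx (int N - int k))) (q 0)"
    unfolding idx_values using not_inline_first .
  \<comment> \<open>Besides \<open>q 1\<close> the first cell can only meet the two cycle neighbours
    of \<open>q 1\<close>. The penultimate cell, too close for \<open>q_far\<close>, is excluded by
    \<open>branch_disjoint\<close>.\<close>
  have cases: "j = 1 \<or> j = 2 \<or> j = n - 1 \<or> cell (q 0) \<inter> cell (q j) = {}" if "1 \<le> j" "j < n" for j
  proof -
    have "cell (q (n - 2)) \<inter> cell (q 0) = {}"
      using n by (intro branch_disjoint[OF adj_penultimate adj_last _ inline_ends(2) adj_sym[OF adj01] not_inline_first] ne_q) auto
    moreover have "cell (q 0) \<inter> cell (q j) = {}" if "3 \<le> j" "j \<le> n - 3"
      using q_far[of 0 j] that n by simp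
    moreover have "j = 1 \<or> j = 2 \<or> j = n - 1 \<or> j = n - 2 \<or> 3 \<le> j \<and> j \<le> n - 3"
      using that by linarith
    ultimately show ?thesis by blast
  qed
  show "x \<notin> cell (q (idx i))" if "x \<in> cell (q 0)" "x \<notin> cell (q (idx (int N - int k)))" for x i
  proof
    assume x: "x \<in> cell (q (idx i))"
    have x1: "x \<notin> cell (q 1)" using that(2) unfolding idx_values .
    have "cell (q 0) \<inter> cell (q 2) \<subseteq> cell (q 1)"
      using n by (intro cells_two_apart[OF adj01 adj12] ne_q) auto
    moreover have "cell (q 0) \<inter> cell (q (n - 1)) \<subseteq> cell (q 1)"
      using n by (intro cells_two_apart[OF adj01 adj_sym[OF adj_last]] ne_q) auto
    ultimately show False
      using cases[OF idx[of i]] x x1 that(1) by auto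
  qed
  show "q (idx i) = q (idx (int N - int k))" if "adj (q 0) (q (idx i))" for i
  proof -
    have "idx i \<noteq> 2" using adj_parity[OF adj01 adj12] that by auto
    moreover have "idx i \<noteq> n - 1" using adj_parity[OF adj01 adj_sym[OF adj_last]] that by auto
    moreover have "cell (q 0) \<inter> cell (q (idx i)) \<noteq> {}" using adj_common[OF that] by blast
    ultimately have "idx i = 1" using cases[OF idx[of i]] by blast
    then show ?thesis unfolding idx_values by simp
  qed
qed

theorem knutson: "knutson_ideal (vertices (cell ` q ` {..<n})) (polyomino_ideal (cell ` q ` {..<n}) :: (vertex, 'k::field) mpoly set)"
proof -
  interpret C: cycle_with_stub N "\<lambda>j. q (idx j)" "int N - int k" "q 0" by (rule cycle_with_stub)
  have "C.Qs = q ` {..<n}"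
  proof -
    have "q i \<in> range (\<lambda>j. q (idx j))" if "1 \<le> i" "i < n" for i
    proof -
      have "idx (int i - 1 - int k) = 1 + nat (int i - 1)"
        using that by (intro idx_eq[of _ _ 0]) (auto simp: N_def)
      then have "idx (int i - 1 - int k) = i" using that by simp
      then show ?thesis by (metis rangeI)
    qed
    then have "q i \<in> C.Qs" if "i < n" for i
      unfolding C.Qs_def using that by (cases "i = 0") simp_all
    then have "q ` {..<n} \<subseteq> C.Qs" by blast
    moreover have "C.Qs \<subseteq> q ` {..<n}"
      unfolding C.Qs_def using idx n by auto
    ultimately show ?thesis by blast
  qed
  then show ?thesis using C.knutson[where ?'k = 'k] by simp
qed

end

section \<open>Reversal, the case distinction and the translation of the definition\<close>

context wcpath
begin

text \<open>Read backwards, a path whose penultimate cell meets the first one becomes a path whose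
  last cell meets the second one.\<close>

lemma reverse: "wcpath n (\<lambda>i. q (n - 1 - i))"
proof
  show "6 \<le> n" by (rule n)
  show "adj (q (n - 1 - i)) (q (n - 1 - (i + 1)))" if "i + 1 < n" for i
  proof -
    have "n - 1 - i = n - 1 - (i + 1) + 1" using that by simp
    then show ?thesis using adj_sym[OF q_adj[of "n - 1 - (i + 1)"]] that by simp
  qed
  show "i = j" if "i < n" "j < n" "q (n - 1 - i) = q (n - 1 - j)" for i j
    using q_inj[of "n - 1 - i" "n - 1 - j"] that by simp
  show "\<exists>v. cell (q (n - 1 - 0)) \<inter> cell (q (n - 1 - (n - 1))) = {v}"
    using touch by (simp add: Int_commute)
  show "cell (q (n - 1 - i)) \<inter> cell (q (n - 1 - j)) = {}" if "i + 3 \<le> j" "j < n" "j + 3 \<le> n + i" for i j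
    using q_far[of "n - 1 - j" "n - 1 - i"] that by (simp add: Int_commute)
qed

theorem knutson: "knutson_ideal (vertices (cell ` q ` {..<n})) (polyomino_ideal (cell ` q ` {..<n}) :: (vertex, 'k::field) mpoly set)"
proof -
  consider "cell (q (n - 1)) \<inter> cell (q 1) \<noteq> {}" | "cell (q (n - 2)) \<inter> cell (q 0) \<noteq> {}"
    | "cell (q (n - 1)) \<inter> cell (q 1) = {}" "cell (q (n - 2)) \<inter> cell (q 0) = {}" by blast
  then show ?thesis
  proof cases
    case 1
    then interpret closed_wcpath n q by unfold_locales
    show ?thesis by (rule knutson)
  next
    case 2
    interpret R: wcpath n "\<lambda>i. q (n - 1 - i)" by (rule reverse)
    interpret R: closed_wcpath n "\<lambda>i. q (n - 1 - i)"
      using 2 n by unfold_locales (simp add: Int_commute numeral_2_eq_2)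
    have "(\<lambda>i. q (n - 1 - i)) ` {..<n} = q ` (\<lambda>i. n - 1 - i) ` {..<n}"
      by (simp add: image_image)
    also have "(\<lambda>i. n - 1 - i) ` {..<n} = {..<n}"
    proof (intro equalityI subsetI)
      fix i assume "i \<in> {..<n}"
      then show "i \<in> (\<lambda>i. n - 1 - i) ` {..<n}"
        by (intro image_eqI[of _ _ "n - 1 - i"]) auto
    qed auto
    finally show ?thesis using R.knutson[where ?'k = 'k] by simp
  next
    case 3
    then interpret O: open_wcpath n q by unfold_locales
    show ?thesis using O.knutson[where ?'k = 'k] by (simp add: O.Qs_def)
  qed
qed

end

lemma adj_of_common_edge:
  assumes "cell a \<inter> cell b \<in> cell_edges (cell a)"
  shows "adj a b"
proof -
  consider i j where "cell a \<inter> cell b = {(i, j), (i + 1, j)}" | i j where "cell a \<inter> cell b = {(i, j), (i, j + 1)}"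
    using assms unfolding cell_edges_def by blast
  then show ?thesis
  proof cases
    case (1 i j)
    then have e: "(i, j) \<in> cell a" "(i + 1, j) \<in> cell a" "(i, j) \<in> cell b" "(i + 1, j) \<in> cell b" by blast+
    then have f: "fst a = i" "fst b = i" by (auto simp: cell_iff_fst_snd)
    have "snd a \<noteq> snd b"
    proof
      assume "snd a = snd b"
      then have "(i, snd a) \<in> cell a \<inter> cell b" "(i, snd a + 1) \<in> cell a \<inter> cell b"
        using f by (auto simp: cell_iff_fst_snd)
      then show False using 1 by auto
    qed
    moreover have "j = snd a \<or> j = snd a + 1" "j = snd b \<or> j = snd b + 1"
      using e by (auto simp: cell_iff_fst_snd)
    ultimately have "snd a = snd b + 1 \<or> snd b = snd a + 1" by linarith
    then show ?thesis unfolding adj_def using f by simp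
  next
    case (2 i j)
    then have e: "(i, j) \<in> cell a" "(i, j + 1) \<in> cell a" "(i, j) \<in> cell b" "(i, j + 1) \<in> cell b" by blast+
    then have f: "snd a = j" "snd b = j" by (auto simp: cell_iff_fst_snd)
    have "fst a \<noteq> fst b"
    proof
      assume "fst a = fst b"
      then have "(fst a, j) \<in> cell a \<inter> cell b" "(fst a + 1, j) \<in> cell a \<inter> cell b"
        using f by (auto simp: cell_iff_fst_snd)
      then show False using 2 by auto
    qed
    moreover have "i = fst a \<or> i = fst a + 1" "i = fst b \<or> i = fst b + 1"
      using e by (auto simp: cell_iff_fst_snd)
    ultimately have "fst a = fst b + 1 \<or> fst b = fst a + 1" by linarith
    then show ?thesis unfolding adj_def using f by simp
  qed
qed

lemma wcpath_of_weakly_closed_path: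
  assumes "weakly_closed_path n A"
  obtains q where "wcpath n q" "\<And>i. i < n \<Longrightarrow> A i = cell (q i)"
proof -
  have n: "6 \<le> n" and cells: "\<forall>i \<le> n. \<exists>a. fst a \<ge> 1 \<and> snd a \<ge> 1 \<and> A i = cell a" and A0: "A 0 = A n"
    and inj: "\<forall>i \<in> {1..n}. \<forall>j \<in> {1..n}. i \<noteq> j \<longrightarrow> A i \<noteq> A j" and touch: "\<exists>v. A 0 \<inter> A (n - 1) = {v}"
    and edges: "\<forall>i \<in> {0..n - 2}. A i \<inter> A (i + 1) \<in> cell_edges (A i) \<inter> cell_edges (A (i + 1))"
    and far: "\<forall>i \<in> {1..n}. \<forall>j \<in> {1..n}.
        (\<forall>d \<in> {-2..2}. int j mod int n \<noteq> (int i + d) mod int n) \<longrightarrow> A i \<inter> A j = {}"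
    using assms unfolding weakly_closed_path_def by blast+
  define q where "q i = (SOME a. A i = cell a)" for i
  have Aq: "A i = cell (q i)" if "i < n" for i
  proof -
    have "\<exists>a. A i = cell a" using cells that by (metis less_imp_le_nat)
    then show ?thesis unfolding q_def by (rule someI_ex)
  qed
  \<comment> \<open>Distinctness and disjointness are stated for the indices from 1 to
    \<open>n\<close>, where \<open>n\<close> represents the first cell.\<close>
  define r where "r i = (if i = 0 then n else i)" for i
  have Ar: "A i = A (r i)" for i using A0 by (simp add: r_def)
  have r: "r i \<in> {1..n}" if "i < n" for i using that by (auto simp: r_def)
  have "wcpath n q"
  proof
    show "6 \<le> n" by (rule n)
    show "adj (q i) (q (i + 1))" if "i + 1 < n" for i
    proof (rule adj_of_common_edge)
      have "i \<in> {0..n - 2}" using that by auto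
      then have "A i \<inter> A (i + 1) \<in> cell_edges (A i)" using edges by blast
      then show "cell (q i) \<inter> cell (q (i + 1)) \<in> cell_edges (cell (q i))"
        using Aq[of i] Aq[of "i + 1"] that by simp
    qed
    show "i = j" if ij: "i < n" "j < n" "q i = q j" for i j
    proof (rule ccontr)
      assume "i \<noteq> j"
      then have "r i \<noteq> r j" using ij(1,2) unfolding r_def by auto
      then have "A (r i) \<noteq> A (r j)" using inj r[OF ij(1)] r[OF ij(2)] by blast
      then show False using Ar[of i] Ar[of j] Aq[OF ij(1)] Aq[OF ij(2)] ij(3) by simp
    qed
    show "\<exists>v. cell (q 0) \<inter> cell (q (n - 1)) = {v}"
      using touch Aq[of 0] Aq[of "n - 1"] n by simp
    show "cell (q i) \<inter> cell (q j) = {}" if ij: "i + 3 \<le> j" "j < n" "j + 3 \<le> n + i" for i j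
    proof -
      have i: "i < n" using ij by simp
      have rj: "r j = j" using ij by (simp add: r_def)
      have "int j mod int n \<noteq> (int (r i) + d) mod int n" if d: "d \<in> {-2..2}" for d
      proof
        assume "int j mod int n = (int (r i) + d) mod int n"
        also have "(int (r i) + d) mod int n = (int i + d) mod int n"
          unfolding r_def by simp
        finally have "int n dvd int j - (int i + d)" by (simp only: mod_eq_dvd_iff)
        \<comment> \<open>The cyclic distance is at least three on both sides, while
          \<open>d\<close> has absolute value at most two.\<close>
        moreover have "0 < int j - (int i + d)" "int j - (int i + d) < int n"
          using ij d by auto
        ultimately show False using zdvd_not_zless by blast
      qed
      then have "A (r i) \<inter> A (r j) = {}"
        using far r[OF i] r[OF ij(2)] unfolding rj by blast
      then show ?thesis using Ar[of i] Ar[of j] Aq[OF i] Aq[OF ij(2)] by simp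
    qed
  qed
  then show ?thesis using that Aq by blast
qed

theorem corollary3p14:
  fixes n :: nat and A :: "nat \<Rightarrow> vertex set" and P :: "vertex set set"
  assumes "weakly_closed_path n A" and "P = A ` {0..n - 1}"
  shows "knutson_ideal (vertices P) (polyomino_ideal P :: (vertex, 'k::field) mpoly set)"
proof -
  obtain q where q: "wcpath n q" "\<And>i. i < n \<Longrightarrow> A i = cell (q i)"
    using wcpath_of_weakly_closed_path[OF assms(1)] by blast
  have "{0..n - 1} = {..<n}" using wcpath.n[OF q(1)] by auto
  then have "P = cell ` q ` {..<n}"
    unfolding assms(2) image_image using q(2) by (intro image_cong) auto
  then show ?thesis using wcpath.knutson[OF q(1)] by metis
qed

end
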